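(* Let $n\ge 2$ and let $\Gamma$ be a nonelementary torsion-free discrete subgroup of $\mathrm{SU}(n,1)$ (respectively of $\mathrm{Sp}(n,1)$). Then the following are equivalent: (i) there exists a discrete faithful representation $\rho:\Gamma\to\mathrm{SU}(n,1)$ (respectively $\rho:\Gamma\to\mathrm{Sp}(n,1)$) such that the trace field of $\rho(\Gamma)$ is contained in $\mathbb R$; (ii) there exists a discrete faithful representation $\rho:\Gamma\to\mathrm{SO}(n,1)$ (respectively $\rho:\Gamma\to\mathrm{O}(n,1)$).
   Context: $\mathrm{SU}(n,1)$ is the group of complex $(n+1)\times(n+1)$ matrices of determinant $1$ preserving the Hermitian form $w^*I_{n,1}z$, $I_{n,1}=\mathrm{diag}(1,\dots,1,-1)$. $\mathrm{Sp}(n,1)=\{A\in\mathrm{GL}(n+1,\mathbb H): A^*I_{n,1}A=I_{n,1}\}$ over the quaternions $\mathbb H$. $\mathrm{O}(n,1)$ and $\mathrm{SO}(n,1)$ are the real matrices in these groups (preserving $I_{n,1}$, resp. also with determinant $1$). Nonelementary means the limit set in the boundary of the corresponding hyperbolic space has more than two points. The trace of a (complex or quaternionic) matrix is the sum of its diagonal entries; the trace field of a group is the field (skew field in the quaternionic case) generated over $\mathbb Q$ by the traces of its elements. *)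

theory Defs
  imports Complex_Main "Jordan_Normal_Form.Determinant"
begin

datatype quat = Quat (qre: real) (qim_i: real) (qim_j: real) (qim_k: real)

instantiation quat :: "{zero, one, plus, minus, uminus, times, inverse}"
begin
definition "0 = Quat 0 0 0 0"
definition "1 = Quat 1 0 0 0"
definition "p + q = Quat (qre p + qre q) (qim_i p + qim_i q) (qim_j p + qim_j q) (qim_k p + qim_k q)"
definition "p - q = Quat (qre p - qre q) (qim_i p - qim_i q) (qim_j p - qim_j q) (qim_k p - qim_k q)"
definition "- q = Quat (- qre q) (- qim_i q) (- qim_j q) (- qim_k q)"
definition "p * q = Quat
   (qre p * qre q - qim_i p * qim_i q - qim_j p * qim_j q - qim_k p * qim_k q)
   (qre p * qim_i q + qim_i p * qre q + qim_j p * qim_k q - qim_k p * qim_j q)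
   (qre p * qim_j q - qim_i p * qim_k q + qim_j p * qre q + qim_k p * qim_i q)
   (qre p * qim_k q + qim_i p * qim_j q - qim_j p * qim_i q + qim_k p * qre q)"
definition "inverse q = (let d = (qre q)\<^sup>2 + (qim_i q)\<^sup>2 + (qim_j q)\<^sup>2 + (qim_k q)\<^sup>2 in
   Quat (qre q / d) (- qim_i q / d) (- qim_j q / d) (- qim_k q / d))"
definition "divide_quat p q = p * inverse (q::quat)"
instance ..
end

lemma quat_eq_iff: "p = q \<longleftrightarrow> qre p = qre q \<and> qim_i p = qim_i q \<and> qim_j p = qim_j q \<and> qim_k p = qim_k q"
  by (cases p; cases q) auto

lemmas quat_defs = zero_quat_def one_quat_def plus_quat_def minus_quat_def uminus_quat_def
  times_quat_def inverse_quat_def divide_quat_def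

instance quat :: ring_1
  by standard (auto simp: quat_defs quat_eq_iff algebra_simps)

lemma quat_sumsq_pos:
  assumes "(q::quat) \<noteq> 0"
  shows "(qre q)\<^sup>2 + (qim_i q)\<^sup>2 + (qim_j q)\<^sup>2 + (qim_k q)\<^sup>2 \<noteq> 0"
proof
  assume "(qre q)\<^sup>2 + (qim_i q)\<^sup>2 + (qim_j q)\<^sup>2 + (qim_k q)\<^sup>2 = 0"
  hence "qre q = 0 \<and> qim_i q = 0 \<and> qim_j q = 0 \<and> qim_k q = 0"
    by (smt (verit) power2_less_eq_zero_iff zero_le_power2)
  thus False using assms by (simp add: quat_eq_iff zero_quat_def)
qed

lemma quat_inverse_mult:
  fixes w x y z :: real
  assumes d: "w\<^sup>2 + x\<^sup>2 + y\<^sup>2 + z\<^sup>2 \<noteq> 0"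
  shows "inverse (Quat w x y z) * Quat w x y z = 1" "Quat w x y z * inverse (Quat w x y z) = 1"
proof -
  define D where "D = w\<^sup>2 + (x\<^sup>2 + (y\<^sup>2 + z\<^sup>2))"
  have D: "D \<noteq> 0" using d by (simp add: D_def add.assoc)
  have e: "w * w / D + (x * x / D + (y * y / D + z * z / D)) = 1"
    unfolding add_divide_distrib[symmetric] using D by (simp add: D_def power2_eq_square)
  show "inverse (Quat w x y z) * Quat w x y z = 1" "Quat w x y z * inverse (Quat w x y z) = 1"
    using e by (simp_all add: quat_eq_iff times_quat_def inverse_quat_def one_quat_def Let_def
        add.assoc D_def[symmetric] algebra_simps)
qed

instance quat :: division_ring
proof
  fix a :: quat
  assume a: "a \<noteq> 0"
  obtain w x y z where q: "a = Quat w x y z" by (cases a)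
  have d: "w\<^sup>2 + x\<^sup>2 + y\<^sup>2 + z\<^sup>2 \<noteq> 0" using quat_sumsq_pos[OF a] by (simp add: q)
  show "inverse a * a = 1" "a * inverse a = 1" using quat_inverse_mult[OF d] by (simp_all add: q)
next
  fix a b :: quat show "a / b = a * inverse b" by (simp add: divide_quat_def)
next
  show "inverse (0::quat) = 0" by (simp add: quat_defs quat_eq_iff Let_def)
qed

class entry_abs =
  fixes eabs :: "'a \<Rightarrow> real"

instantiation complex :: entry_abs
begin
definition "eabs z = cmod z"
instance ..
end

instantiation quat :: entry_abs
begin
definition "eabs q = sqrt ((qre q)\<^sup>2 + (qim_i q)\<^sup>2 + (qim_j q)\<^sup>2 + (qim_k q)\<^sup>2)"
instance ..
end

definition real_quat :: "real \<Rightarrow> quat" where "real_quat r = Quat r 0 0 0"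

definition qcnj :: "quat \<Rightarrow> quat" where
  "qcnj q = Quat (qre q) (- qim_i q) (- qim_j q) (- qim_k q)"

definition conj_trans :: "('a \<Rightarrow> 'a) \<Rightarrow> 'a mat \<Rightarrow> 'a mat" where
  "conj_trans c A = mat (dim_col A) (dim_row A) (\<lambda>(i,j). c (A $$ (j,i)))"

definition I_n1 :: "nat \<Rightarrow> 'a::ring_1 mat" where
  "I_n1 n = mat (n+1) (n+1) (\<lambda>(i,j). if i = j then (if i = n then -1 else 1) else 0)"

definition SU_n1 :: "nat \<Rightarrow> complex mat set" where
  "SU_n1 n = {A \<in> carrier_mat (n+1) (n+1).
      conj_trans cnj A * I_n1 n * A = I_n1 n \<and> det A = 1}"

definition Sp_n1 :: "nat \<Rightarrow> quat mat set" where
  "Sp_n1 n = {A \<in> carrier_mat (n+1) (n+1). conj_trans qcnj A * I_n1 n * A = I_n1 n}"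

definition SO_n1 :: "nat \<Rightarrow> complex mat set" where
  "SO_n1 n = {A \<in> SU_n1 n. \<forall>i<n+1. \<forall>j<n+1. A $$ (i,j) \<in> range complex_of_real}"

definition O_n1 :: "nat \<Rightarrow> quat mat set" where
  "O_n1 n = {A \<in> Sp_n1 n. \<forall>i<n+1. \<forall>j<n+1. A $$ (i,j) \<in> range real_quat}"

definition is_mat_subgroup :: "nat \<Rightarrow> 'a::semiring_1 mat set \<Rightarrow> 'a mat set \<Rightarrow> bool" where
  "is_mat_subgroup N \<Gamma> G \<longleftrightarrow> \<Gamma> \<subseteq> G \<and> 1\<^sub>m N \<in> \<Gamma> \<and>
     (\<forall>A\<in>\<Gamma>. \<forall>B\<in>\<Gamma>. A * B \<in> \<Gamma>) \<and>
     (\<forall>A\<in>\<Gamma>. \<exists>B\<in>\<Gamma>. A * B = 1\<^sub>m N \<and> B * A = 1\<^sub>m N)"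

definition torsion_free :: "nat \<Rightarrow> 'a::semiring_1 mat set \<Rightarrow> bool" where
  "torsion_free N \<Gamma> \<longleftrightarrow> (\<forall>A\<in>\<Gamma>. \<forall>k::nat. k > 0 \<and> A ^\<^sub>m k = 1\<^sub>m N \<longrightarrow> A = 1\<^sub>m N)"

definition discrete_mats :: "'a::{minus,entry_abs} mat set \<Rightarrow> bool" where
  "discrete_mats S \<longleftrightarrow> (\<forall>A\<in>S. \<exists>e>0. \<forall>B\<in>S. B \<noteq> A \<longrightarrow>
      (\<exists>i<dim_row A. \<exists>j<dim_col A. e \<le> eabs (A $$ (i,j) - B $$ (i,j))))"

definition is_rep :: "'a::semiring_0 mat set \<Rightarrow> 'a mat set \<Rightarrow> ('a mat \<Rightarrow> 'a mat) \<Rightarrow> bool" where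
  "is_rep \<Gamma> G \<rho> \<longleftrightarrow> (\<forall>A\<in>\<Gamma>. \<rho> A \<in> G) \<and> (\<forall>A\<in>\<Gamma>. \<forall>B\<in>\<Gamma>. \<rho> (A * B) = \<rho> A * \<rho> B)"

definition discrete_faithful_rep ::
    "'a::{semiring_0,minus,entry_abs} mat set \<Rightarrow> 'a mat set \<Rightarrow> ('a mat \<Rightarrow> 'a mat) \<Rightarrow> bool" where
  "discrete_faithful_rep \<Gamma> G \<rho> \<longleftrightarrow> is_rep \<Gamma> G \<rho> \<and> inj_on \<rho> \<Gamma> \<and> discrete_mats (\<rho> ` \<Gamma>)"

definition mtrace :: "'a::comm_monoid_add mat \<Rightarrow> 'a" where
  "mtrace A = (\<Sum>i<dim_row A. A $$ (i,i))"

definition is_sub_division_ring :: "'a::division_ring set \<Rightarrow> bool" where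
  "is_sub_division_ring F \<longleftrightarrow> 0 \<in> F \<and> 1 \<in> F \<and> (\<forall>x\<in>F. \<forall>y\<in>F. x + y \<in> F \<and> x * y \<in> F) \<and>
     (\<forall>x\<in>F. - x \<in> F \<and> inverse x \<in> F)"

definition trace_field :: "'a::division_ring mat set \<Rightarrow> 'a set" where
  "trace_field S = \<Inter> {F. is_sub_division_ring F \<and> mtrace ` S \<subseteq> F}"

text \<open>Points of \<open>H^n_F\<close> are negative lines \<open>[z]\<close>, \<open>z \<in> F^{n+1}\<close>; in the inhomogeneous
  coordinates \<open>p_i = z_i z_n^{-1}\<close> (\<open>i < n\<close>) these form the open unit ball of \<open>F^n\<close>, and the
  boundary (null lines) is the unit sphere, with the Euclidean topology.\<close>

definition lift_pt :: "nat \<Rightarrow> 'a::ring_1 vec \<Rightarrow> 'a vec" where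
  "lift_pt n p = vec (n+1) (\<lambda>i. if i < n then p $ i else 1)"

definition proj_pt :: "nat \<Rightarrow> 'a::division_ring vec \<Rightarrow> 'a vec" where
  "proj_pt n z = vec n (\<lambda>i. z $ i * inverse (z $ n))"

definition ball_act :: "nat \<Rightarrow> 'a::division_ring mat \<Rightarrow> 'a vec \<Rightarrow> 'a vec" where
  "ball_act n A p = proj_pt n (A *\<^sub>v lift_pt n p)"

definition limit_set :: "nat \<Rightarrow> 'a::{division_ring,entry_abs} mat set \<Rightarrow> 'a vec set" where
  "limit_set n \<Gamma> = {\<xi> \<in> carrier_vec n. (\<Sum>i<n. (eabs (\<xi> $ i))\<^sup>2) = 1 \<and>
     (\<exists>g::nat \<Rightarrow> 'a mat. (\<forall>k. g k \<in> \<Gamma>) \<and>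
        (\<forall>i<n. (\<lambda>k. eabs (ball_act n (g k) (0\<^sub>v n) $ i - \<xi> $ i)) \<longlonglongrightarrow> 0))}"

definition nonelementary :: "nat \<Rightarrow> 'a::{division_ring,entry_abs} mat set \<Rightarrow> bool" where
  "nonelementary n \<Gamma> \<longleftrightarrow> \<not> (finite (limit_set n \<Gamma>) \<and> card (limit_set n \<Gamma>) \<le> 2)"

end

theory Submission
  imports Defs "HOL-Analysis.Analysis"
begin

text \<open>Write \<open>\<Delta> = \<rho>(\<Gamma>)\<close>. Limits of rescaled elements of \<open>\<Delta>\<close> are rank-one matrices
  \<open>\<xi> \<eta>\<^sup>* J\<close> with null vectors \<open>\<xi>\<close>, \<open>\<eta>\<close>. The group \<open>\<Delta>\<close> fixes no boundary point: by ping-pong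
  \<open>[\<Gamma>, \<Gamma>]\<close> contains a free semigroup on two generators, whereas commutators fixing a boundary point
  are parabolic or elliptic and generate a discrete group of polynomial growth. Hence some
  \<open>\<xi> s \<xi>\<^sup>* J\<close> is a limit of rescaled elements, and reality of traces
  passes to the limit: \<open>g \<xi> s (h \<xi>)\<^sup>* J\<close> has real trace for all \<open>g, h \<in> \<Delta>\<close>. The equality case of the
  Cauchy-Schwarz inequality then forces all values of the Hermitian form on the orbit \<open>\<Delta> \<xi>\<close> to lie on
  one real line \<open>\<real> \<sigma>\<close> with \<open>\<sigma>\<close> real or purely imaginary. If \<open>\<sigma>\<close> is real, the real span of the orbit
  is a Lorentz space of dimension at most \<open>n + 1\<close>; if it is imaginary, that span is a symplectic plane
  and \<open>\<Delta>\<close> acts through \<open>SL(2,\<real>)\<close>, which acts on \<open>\<real>\<^bsup>2,1\<^esup>\<close> by its symmetric square. Both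
  actions are proper, so they stay discrete, and faithful because \<open>\<Gamma>\<close> is torsion-free.\<close>

section \<open>Scalars with conjugation\<close>

text \<open>A discrete faithful representation need not respect limit sets or the types of elements,
  so nonelementarity of \<open>\<Gamma>\<close> cannot be carried to the image geometrically. A free
  semigroup is a property of the abstract group and survives. It is taken inside commutators because
  the norm of the multiplier on a fixed line is a homomorphism to an abelian group, hence trivial on
  them.

  The second obstacle is noncommutativity: a quaternionic trace is not conjugation invariant, and
  the trace of x s y* J is not a function of s and the form value of x and y. The scalars s that
  occur in limits are therefore studied as a set of their own, stable under s, s' -> s <x,y> s';
  reality of traces cuts its span down to one real line.

  The bound \<open>n \<ge> 2\<close> makes room for the three-dimensional Lorentz space of the
  symplectic case. To land in SO instead of O over the complex numbers, the sign of the determinant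
  is absorbed in a spare direction; if there is none, the orbit spans a real form of the whole space
  and the determinant 1 is inherited.\<close>

class hyp_scalar = real_normed_div_algebra + euclidean_space + entry_abs +
  assumes eabs_norm: "eabs x = norm x"
    and mult_reflect: "x * ((2 * inner x 1) *\<^sub>R 1 - x) = ((norm x)\<^sup>2) *\<^sub>R 1"
    and commutant: "x * a = a * x \<Longrightarrow> inner a 1 = 0 \<Longrightarrow> a \<noteq> 0 \<Longrightarrow> \<exists>r s. x = r *\<^sub>R 1 + s *\<^sub>R a"

instance complex :: hyp_scalar
proof
  fix x a :: complex
  show "eabs x = norm x" by (simp add: eabs_complex_def)
  show "x * ((2 * inner x 1) *\<^sub>R 1 - x) = ((norm x)\<^sup>2) *\<^sub>R 1"
    by (simp add: complex_eq_iff inner_complex_def cmod_power2 power2_eq_square[of "Re x"]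
        power2_eq_square[of "Im x"] algebra_simps)
  assume "inner a 1 = 0" "a \<noteq> 0"
  then have "Re a = 0" "Im a \<noteq> 0" by (auto simp: complex_eq_iff inner_complex_def)
  then show "\<exists>r s. x = r *\<^sub>R 1 + s *\<^sub>R a"
    by (intro exI[of _ "Re x"] exI[of _ "Im x / Im a"]) (simp add: complex_eq_iff)
qed

section \<open>The quaternions as a Euclidean normed division algebra\<close>

instantiation quat :: real_vector
begin
definition "scaleR_quat r q = Quat (r * qre q) (r * qim_i q) (r * qim_j q) (r * qim_k q)"
instance
  by standard (auto simp: quat_eq_iff scaleR_quat_def plus_quat_def algebra_simps)
end

instantiation quat :: real_inner
begin
definition "inner_quat p q = qre p * qre q + qim_i p * qim_i q + qim_j p * qim_j q + qim_k p * qim_k q"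
definition "norm_quat (q::quat) = sqrt (inner q q)"
definition "sgn_quat (q::quat) = q /\<^sub>R norm q"
definition "dist_quat p (q::quat) = norm (p - q)"
definition [code del]:
  "(uniformity :: (quat \<times> quat) filter) = (INF e\<in>{0<..}. principal {(x, y). dist x y < e})"
definition [code del]:
  "open (U :: quat set) \<longleftrightarrow> (\<forall>x\<in>U. eventually (\<lambda>(x', y). x' = x \<longrightarrow> y \<in> U) uniformity)"
instance
proof
  fix x y z :: quat and r s :: real and U :: "quat set"
  show "inner x y = inner y x" "inner (x + y) z = inner x z + inner y z"
    "inner (r *\<^sub>R x) y = r * inner x y"
    by (auto simp: inner_quat_def scaleR_quat_def plus_quat_def algebra_simps)
  show "0 \<le> inner x x" by (auto simp: inner_quat_def)
  show "inner x x = 0 \<longleftrightarrow> x = 0"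
    using quat_sumsq_pos[of x] by (auto simp: inner_quat_def quat_eq_iff zero_quat_def power2_eq_square)
qed (simp_all add: norm_quat_def sgn_quat_def dist_quat_def uniformity_quat_def open_quat_def)
end

lemma norm_sq_quat: "(norm (q::quat))\<^sup>2 = (qre q)\<^sup>2 + (qim_i q)\<^sup>2 + (qim_j q)\<^sup>2 + (qim_k q)\<^sup>2"
  by (simp add: norm_eq_sqrt_inner inner_quat_def power2_eq_square)

instance quat :: real_normed_div_algebra
proof
  fix x y :: quat and r :: real
  show "r *\<^sub>R x * y = r *\<^sub>R (x * y)" "x * r *\<^sub>R y = r *\<^sub>R (x * y)"
    by (auto simp: quat_eq_iff scaleR_quat_def times_quat_def algebra_simps)
  \<comment> \<open>Euler's four-square identity, with the components of the quaternion product on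
    the left.\<close>
  have *: "(a*e-b*f-c*g-d*h)\<^sup>2 + (a*f+b*e+c*h-d*g)\<^sup>2 + (a*g-b*h+c*e+d*f)\<^sup>2 + (a*h+b*g-c*f+d*e)\<^sup>2
      = (a\<^sup>2 + b\<^sup>2 + c\<^sup>2 + d\<^sup>2) * (e\<^sup>2 + f\<^sup>2 + g\<^sup>2 + h\<^sup>2)" for a b c d e f g h :: real
    by (simp add: power2_eq_square algebra_simps)
  have "(norm (x * y))\<^sup>2 = (norm x * norm y)\<^sup>2"
    unfolding power_mult_distrib norm_sq_quat times_quat_def quat.sel by (rule *)
  then show "norm (x * y) = norm x * norm y"
    by (metis norm_ge_zero mult_nonneg_nonneg power2_eq_imp_eq)
qed

instantiation quat :: euclidean_space
begin
definition "Basis = {Quat 1 0 0 0, Quat 0 1 0 0, Quat 0 0 1 0, Quat 0 0 0 1}"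
instance
proof
  fix u v x :: quat
  show "(Basis::quat set) \<noteq> {}" "finite (Basis::quat set)" by (auto simp: Basis_quat_def)
  assume "u \<in> Basis" "v \<in> Basis"
  then show "inner u v = (if u = v then 1 else 0)"
    unfolding Basis_quat_def by (elim insertE emptyE) (simp_all add: inner_quat_def)
next
  fix x :: quat
  show "(\<forall>u\<in>Basis. inner x u = 0) \<longleftrightarrow> x = 0"
    by (cases x) (simp add: Basis_quat_def inner_quat_def zero_quat_def conj_ac)
qed
end

instance quat :: hyp_scalar
proof
  fix x a :: quat
  show "eabs x = norm x" by (simp add: eabs_quat_def norm_eq_sqrt_inner inner_quat_def power2_eq_square)
  have "Quat a b c d * ((2 * inner (Quat a b c d) 1) *\<^sub>R 1 - Quat a b c d)
      = ((norm (Quat a b c d))\<^sup>2) *\<^sub>R 1" for a b c d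
    unfolding norm_sq_quat inner_quat_def one_quat_def minus_quat_def scaleR_quat_def times_quat_def quat.sel
    by (simp add: power2_eq_square)
  then show "x * ((2 * inner x 1) *\<^sub>R 1 - x) = ((norm x)\<^sup>2) *\<^sub>R 1" by (cases x) simp
  assume com: "x * a = a * x" and a: "inner a 1 = 0" "a \<noteq> 0"
  obtain x0 x1 x2 x3 where x: "x = Quat x0 x1 x2 x3" by (cases x)
  obtain a1 a2 a3 where a': "a = Quat 0 a1 a2 a3" 
    using a by (cases a) (auto simp: inner_quat_def one_quat_def)
  \<comment> \<open>Real parts commute with everything, so \<open>com\<close> says that the cross
    product of the imaginary parts vanishes: they are parallel, and the quotient at any nonzero
    coordinate of \<open>a\<close> is the factor.\<close>
  have e: "x2 * a3 = x3 * a2" "x3 * a1 = x1 * a3" "x1 * a2 = x2 * a1"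
    using com by (simp_all add: x a' quat_eq_iff times_quat_def mult.commute)
  have nz: "a1 \<noteq> 0 \<or> a2 \<noteq> 0 \<or> a3 \<noteq> 0" using a by (auto simp: a' zero_quat_def)
  have "\<exists>s. x1 = s * a1 \<and> x2 = s * a2 \<and> x3 = s * a3"
  proof -
    consider "a1 \<noteq> 0" | "a2 \<noteq> 0" | "a3 \<noteq> 0" using nz by blast
    then show ?thesis
    proof cases
      case 1 then show ?thesis using e by (intro exI[of _ "x1/a1"]) (simp add: field_simps)
    next
      case 2 then show ?thesis using e by (intro exI[of _ "x2/a2"]) (simp add: field_simps)
    next
      case 3 then show ?thesis using e by (intro exI[of _ "x3/a3"]) (simp add: field_simps)
    qed
  qed
  then obtain s where "x1 = s * a1 \<and> x2 = s * a2 \<and> x3 = s * a3" by blast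
  then show "\<exists>r s. x = r *\<^sub>R 1 + s *\<^sub>R a"
    by (intro exI[of _ x0] exI[of _ s]) (simp add: x a' quat_eq_iff one_quat_def scaleR_quat_def plus_quat_def)
qed

text \<open>Conjugation as reflection in the real axis, written with the inner product alone, so
  that the complex and the quaternionic group share every later argument. The class axiom
  \<open>mult_reflect\<close> is x * cj x = |x|^2.\<close>

definition cj :: "'a::hyp_scalar \<Rightarrow> 'a" where "cj x = (2 * inner x 1) *\<^sub>R 1 - x"

lemma cj_complex: "cj = cnj"
  by (rule ext) (simp add: cj_def complex_eq_iff inner_complex_def)

lemma cj_quat: "cj = qcnj"
  by (rule ext) (simp add: cj_def qcnj_def quat_eq_iff inner_quat_def scaleR_quat_def minus_quat_def one_quat_def)

lemma real_quat_of_real: "real_quat = of_real"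
  by (rule ext) (simp add: of_real_def real_quat_def scaleR_quat_def one_quat_def)

lemma mult_cj: "x * cj x = (of_real ((norm x)\<^sup>2) :: 'a::hyp_scalar)"
  using mult_reflect[of x] by (simp add: cj_def of_real_def)

lemma cj_0 [simp]: "cj 0 = (0::'a::hyp_scalar)"
  by (simp add: cj_def)

text \<open>Reduces conjugation to inversion; \<open>cj_mult\<close> then reverses products because
  \<open>inverse\<close> does.\<close>

lemma cj_conv_inverse: "cj x = (norm x)\<^sup>2 *\<^sub>R inverse (x::'a::hyp_scalar)"
proof (cases "x = 0")
  case False
  then have "x * cj x = x * ((norm x)\<^sup>2 *\<^sub>R inverse x)"
    by (simp add: mult_cj of_real_def)
  with False show ?thesis using mult_left_cancel by blast
qed simp

lemma cj_add: "cj (x + y) = cj x + cj (y::'a::hyp_scalar)"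
  by (simp add: cj_def inner_add_left scaleR_add_left distrib_left)

lemma cj_diff: "cj (x - y) = cj x - cj (y::'a::hyp_scalar)"
  by (simp add: cj_def inner_diff_left scaleR_diff_left right_diff_distrib)

lemma cj_scaleR: "cj (r *\<^sub>R x) = r *\<^sub>R cj (x::'a::hyp_scalar)"
  by (simp add: cj_def scaleR_diff_right mult.left_commute)

lemma cj_1 [simp]: "cj 1 = (1::'a::hyp_scalar)"
  by (simp add: cj_conv_inverse)

lemma inner_1_1 [simp]: "inner 1 (1::'a::hyp_scalar) = 1"
  by (simp add: dot_square_norm)

lemma cj_cj [simp]: "cj (cj x) = (x::'a::hyp_scalar)"
  by (simp add: cj_def inner_diff_left)

lemma cj_of_real [simp]: "cj (of_real r) = (of_real r :: 'a::hyp_scalar)"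
  by (simp add: of_real_def cj_scaleR)

lemma norm_cj [simp]: "norm (cj x) = norm (x::'a::hyp_scalar)"
proof (cases "x = 0")
  case False
  then show ?thesis by (simp add: cj_conv_inverse norm_inverse power2_eq_square)
qed simp

lemma cj_eq_0_iff [simp]: "cj x = 0 \<longleftrightarrow> x = (0::'a::hyp_scalar)"
  by (metis norm_cj norm_eq_zero)

lemma mult_cj': "cj x * x = (of_real ((norm x)\<^sup>2) :: 'a::hyp_scalar)"
  using mult_cj[of "cj x"] by simp

lemma inner_1_cj [simp]: "inner (cj x) 1 = inner x (1::'a::hyp_scalar)"
  by (simp add: cj_def inner_diff_left)

lemma cj_fixed_iff: "cj x = x \<longleftrightarrow> x \<in> (\<real> :: 'a::hyp_scalar set)"
proof
  assume "cj x = x"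
  then have "2 *\<^sub>R x = 2 *\<^sub>R of_real (inner x 1)"
    by (simp add: cj_def of_real_def scaleR_2 diff_eq_eq)
  then have "x = of_real (inner x 1)" by (metis scaleR_cancel_left zero_neq_numeral)
  then show "x \<in> \<real>" by (metis Reals_of_real)
qed (auto elim!: Reals_cases)

lemma cj_mult: "cj (x * y) = cj y * cj (x::'a::hyp_scalar)"
proof (cases "x = 0 \<or> y = 0")
  case False
  then show ?thesis
    by (simp add: cj_conv_inverse nonzero_inverse_mult_distrib norm_mult power_mult_distrib mult.commute)
qed (auto simp: cj_0)

lemma cj_sum: "cj (sum f A) = (\<Sum>i\<in>A. cj (f i :: 'a::hyp_scalar))"
  by (induct A rule: infinite_finite_induct) (simp_all add: cj_0 cj_add)

lemma tendsto_cj [tendsto_intros]: "(f \<longlongrightarrow> l) F \<Longrightarrow> ((\<lambda>x. cj (f x :: 'a::hyp_scalar)) \<longlongrightarrow> cj l) F"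
  unfolding cj_def by (intro tendsto_intros)

text \<open>Polarization of |z|^2 = Re (z * cj z), where \<open>inner z 1\<close> is the real part
  of z.\<close>

lemma inner_conv_cj: "inner x y = inner (x * cj y) (1::'a::hyp_scalar)"
proof -
  have *: "(norm z)\<^sup>2 = inner (z * cj z) (1::'a)" for z :: 'a
    by (simp add: mult_cj of_real_def dot_square_norm)
  have c: "inner (y * cj x) 1 = inner (x * cj y) 1"
    by (metis inner_1_cj cj_mult cj_cj)
  have "(norm (x + y))\<^sup>2 = (norm x)\<^sup>2 + (norm y)\<^sup>2 + 2 * inner (x * cj y) 1"
    unfolding * by (simp add: cj_add algebra_simps inner_add_left c)
  moreover have "(norm (x + y))\<^sup>2 = (norm x)\<^sup>2 + (norm y)\<^sup>2 + 2 * inner x y"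
    by (simp add: power2_norm_eq_inner inner_add_left inner_add_right inner_commute)
  ultimately show ?thesis by simp
qed

lemma inner_cj_cj: "inner (cj x) (cj y) = inner x (y::'a::hyp_scalar)"
  by (simp add: cj_def inner_diff_left inner_diff_right inner_commute[of 1] dot_square_norm)

text \<open>This is what remains of the cyclicity of the trace over the quaternions: it holds for
  real parts.\<close>

lemma inner_1_commute: "inner (x * y) 1 = inner (y * x) (1::'a::hyp_scalar)"
  using inner_conv_cj[of x "cj y"] inner_conv_cj[of y "cj x"] inner_cj_cj[of x "cj y"]
  by (simp add: cj_cj inner_commute)

lemma inner_mult_right_cj: "inner (x * y) z = inner x (z * cj (y::'a::hyp_scalar))"
  by (simp add: inner_conv_cj[of "x * y"] inner_conv_cj[of x] cj_mult cj_cj mult.assoc)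

section \<open>The Hermitian form of signature (n,1)\<close>

definition sg :: "nat \<Rightarrow> nat \<Rightarrow> real" where "sg n i = (if i = n then -1 else 1)"

text \<open>Vectors are functions of which only the indices up to \<open>n\<close> count. Scalars
  multiply vectors on the right, because matrices act on the left; so the form is right linear in
  its second argument and conjugate linear in its first.\<close>

definition hf :: "nat \<Rightarrow> (nat \<Rightarrow> 'a) \<Rightarrow> (nat \<Rightarrow> 'a) \<Rightarrow> 'a::hyp_scalar" where
  "hf n v w = (\<Sum>i\<le>n. sg n i *\<^sub>R (cj (v i) * w i))"

text \<open>The value 0 beyond \<open>n\<close> makes the image depend, as a function, only on the
  coordinates that count; hence \<open>app_cong\<close> gives equality of functions.\<close>

definition app :: "nat \<Rightarrow> 'a mat \<Rightarrow> (nat \<Rightarrow> 'a) \<Rightarrow> nat \<Rightarrow> 'a::hyp_scalar" where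
  "app n A v i = (if i \<le> n then \<Sum>j\<le>n. A $$ (i,j) * v j else 0)"

definition std :: "nat \<Rightarrow> nat \<Rightarrow> 'a::hyp_scalar" where "std j i = (if i = j then 1 else 0)"

definition null_vec :: "nat \<Rightarrow> (nat \<Rightarrow> 'a::hyp_scalar) \<Rightarrow> bool" where
  "null_vec n v \<longleftrightarrow> hf n v v = 0 \<and> (\<exists>i\<le>n. v i \<noteq> 0)"

definition U_n1 :: "nat \<Rightarrow> 'a::hyp_scalar mat set" where
  "U_n1 n = {A \<in> carrier_mat (Suc n) (Suc n). conj_trans cj A * I_n1 n * A = I_n1 n}"

lemma sg_sq [simp]: "sg n i * sg n i = 1" and sg_sq' [simp]: "sg n i * (sg n i * r) = r"
  and sg_self [simp]: "sg n n = -1" and sg_less [simp]: "i < n \<Longrightarrow> sg n i = 1"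
  and abs_sg [simp]: "\<bar>sg n i\<bar> = 1" and sg_nz [simp]: "sg n i \<noteq> 0"
  by (auto simp: sg_def)

lemma hf_cong: "(\<And>i. i \<le> n \<Longrightarrow> v i = v' i) \<Longrightarrow> (\<And>i. i \<le> n \<Longrightarrow> w i = w' i) \<Longrightarrow> hf n v w = hf n v' w'"
  by (auto simp: hf_def intro!: sum.cong)

lemma hf_split: "hf n v w = (\<Sum>i<n. cj (v i) * w i) - cj (v n) * w n"
  by (simp add: hf_def lessThan_Suc_atMost[symmetric])

lemma hf_add_right: "hf n v (\<lambda>i. w i + u i) = hf n v w + hf n v u"
  by (simp add: hf_def distrib_left scaleR_add_right sum.distrib)

lemma hf_add_left: "hf n (\<lambda>i. w i + u i) v = hf n w v + hf n u v"
  by (simp add: hf_def cj_add distrib_right scaleR_add_right sum.distrib)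

lemma hf_diff_right: "hf n v (\<lambda>i. w i - u i) = hf n v w - hf n v u"
  by (simp add: hf_def right_diff_distrib scaleR_diff_right sum_subtractf)

lemma hf_diff_left: "hf n (\<lambda>i. w i - u i) v = hf n w v - hf n u v"
  by (simp add: hf_def cj_diff left_diff_distrib scaleR_diff_right sum_subtractf)

lemma hf_mult_right: "hf n v (\<lambda>i. w i * q) = hf n v w * q"
  by (simp add: hf_def sum_distrib_right mult.assoc)

lemma hf_mult_left: "hf n (\<lambda>i. v i * q) w = cj q * hf n v w"
  by (simp add: hf_def cj_mult sum_distrib_left mult.assoc)

lemma hf_scaleR_right: "hf n v (\<lambda>i. r *\<^sub>R w i) = r *\<^sub>R hf n v w"
  by (simp add: hf_def scaleR_sum_right mult.commute)

lemma hf_scaleR_left: "hf n (\<lambda>i. r *\<^sub>R v i) w = r *\<^sub>R hf n v w"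
  by (simp add: hf_def scaleR_sum_right cj_scaleR mult.commute)

lemma hf_sum_right: "hf n v (\<lambda>i. \<Sum>k\<in>K. w k i) = (\<Sum>k\<in>K. hf n v (w k))"
  unfolding hf_def sum_distrib_left scaleR_sum_right by (rule sum.swap)

lemma hf_sum_left: "hf n (\<lambda>i. \<Sum>k\<in>K. w k i) v = (\<Sum>k\<in>K. hf n (w k) v)"
  unfolding hf_def cj_sum sum_distrib_right scaleR_sum_right by (rule sum.swap)

lemma cj_hf: "cj (hf n v w) = hf n w v"
  by (simp add: hf_def cj_sum cj_scaleR cj_mult)

lemma hf_eq_0_commute: "hf n v w = 0 \<longleftrightarrow> hf n w v = 0"
  by (metis cj_hf cj_eq_0_iff)

lemma hf_self: "hf n v v = of_real ((\<Sum>i<n. (norm (v i))\<^sup>2) - (norm (v n))\<^sup>2)"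
  by (simp add: hf_split mult_cj')

lemma hf_std_left: "j \<le> n \<Longrightarrow> hf n (std j) v = sg n j *\<^sub>R v j"
proof -
  assume "j \<le> n"
  then have "hf n (std j) v = (\<Sum>i\<in>{..n} \<inter> {j}. sg n i *\<^sub>R v i)"
    unfolding hf_def by (intro sum.mono_neutral_cong_right) (auto simp: std_def)
  with \<open>j \<le> n\<close> show ?thesis by simp
qed

lemma hf_std_right: "j \<le> n \<Longrightarrow> hf n v (std j) = sg n j *\<^sub>R cj (v j)"
  using cj_hf[of n "std j" v] by (simp add: hf_std_left cj_scaleR)

lemma tendsto_hf:
  assumes "\<And>i. i \<le> n \<Longrightarrow> ((\<lambda>k. v k i) \<longlongrightarrow> v' i) F" "\<And>i. i \<le> n \<Longrightarrow> ((\<lambda>k. w k i) \<longlongrightarrow> w' i) F"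
  shows "((\<lambda>k. hf n (v k) (w k)) \<longlongrightarrow> hf n v' w') F"
  unfolding hf_def by (intro tendsto_intros assms) auto

lemma app_std: "j \<le> n \<Longrightarrow> i \<le> n \<Longrightarrow> app n A (std j) i = A $$ (i,j)"
proof -
  assume "j \<le> n" "i \<le> n"
  then have "app n A (std j) i = (\<Sum>l\<in>{..n} \<inter> {j}. A $$ (i,l))"
    unfolding app_def if_P[OF \<open>i \<le> n\<close>] by (intro sum.mono_neutral_cong_right) (auto simp: std_def)
  with \<open>j \<le> n\<close> show ?thesis by simp
qed

lemma app_cong: "(\<And>i. i \<le> n \<Longrightarrow> v i = v' i) \<Longrightarrow> app n A v = app n A v'"
  by (auto simp: app_def intro!: sum.cong)

lemma app_mult_right: "app n A (\<lambda>i. v i * q) = (\<lambda>i. app n A v i * q)"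
  by (auto simp: app_def sum_distrib_right mult.assoc)

lemma app_scaleR: "app n A (\<lambda>i. r *\<^sub>R v i) = (\<lambda>i. r *\<^sub>R app n A v i)"
  by (auto simp: app_def scaleR_sum_right)

lemma app_add: "app n A (\<lambda>i. v i + w i) = (\<lambda>i. app n A v i + app n A w i)"
  by (auto simp: app_def distrib_left sum.distrib)

lemma app_diff: "app n A (\<lambda>i. v i - w i) = (\<lambda>i. app n A v i - app n A w i)"
  by (auto simp: app_def right_diff_distrib sum_subtractf)

lemma app_sum: "app n A (\<lambda>i. \<Sum>k\<in>K. v k i) = (\<lambda>i. \<Sum>k\<in>K. app n A (v k) i)"
  by (rule ext) (auto simp: app_def sum_distrib_left intro: sum.swap)

lemma mult_mat_index:
  assumes "A \<in> carrier_mat (Suc n) (Suc n)" "B \<in> carrier_mat (Suc n) (Suc n)" "i \<le> n" "j \<le> n"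
  shows "(A * B) $$ (i,j) = (\<Sum>l\<le>n. A $$ (i,l) * B $$ (l,j))"
proof -
  have "(A * B) $$ (i,j) = (\<Sum>l = 0..<Suc n. A $$ (i,l) * B $$ (l,j))"
    using assms by (auto simp: scalar_prod_def intro!: sum.cong)
  also have "{0..<Suc n} = {..n}" by auto
  finally show ?thesis .
qed

lemma app_mult:
  assumes "A \<in> carrier_mat (Suc n) (Suc n)" "B \<in> carrier_mat (Suc n) (Suc n)"
  shows "app n (A * B) v = app n A (app n B v)"
proof
  fix i
  show "app n (A * B) v i = app n A (app n B v) i"
  proof (cases "i \<le> n")
    case True
    then have "app n (A * B) v i = (\<Sum>j\<le>n. \<Sum>l\<le>n. A $$ (i,l) * B $$ (l,j) * v j)"
      by (simp add: app_def mult_mat_index[OF assms] sum_distrib_right)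
    also have "\<dots> = (\<Sum>l\<le>n. \<Sum>j\<le>n. A $$ (i,l) * B $$ (l,j) * v j)" by (rule sum.swap)
    also have "\<dots> = app n A (app n B v) i"
      using True by (simp add: app_def sum_distrib_left mult.assoc)
    finally show ?thesis .
  qed (simp add: app_def)
qed

lemma app_one: "i \<le> n \<Longrightarrow> app n (1\<^sub>m (Suc n)) v i = v i"
proof -
  assume i: "i \<le> n"
  then have "app n (1\<^sub>m (Suc n)) v i = (\<Sum>l\<in>{..n} \<inter> {i}. v l)"
    unfolding app_def if_P[OF i] by (intro sum.mono_neutral_cong_right) auto
  with i show ?thesis by simp
qed

lemma form_entry:
  assumes A: "A \<in> carrier_mat (Suc n) (Suc n)" and "i \<le> n" "j \<le> n"
  shows "(conj_trans cj A * I_n1 n * A) $$ (i,j) = (\<Sum>l\<le>n. sg n l *\<^sub>R (cj (A $$ (l,i)) * A $$ (l,j)))"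
proof -
  have c: "conj_trans cj A \<in> carrier_mat (Suc n) (Suc n)" "(I_n1 n :: 'a mat) \<in> carrier_mat (Suc n) (Suc n)"
    using A by (auto simp: conj_trans_def I_n1_def)
  have I: "(\<Sum>l\<le>n. x l * I_n1 n $$ (l,k)) = sg n k *\<^sub>R x k" if "k \<le> n" for x :: "nat \<Rightarrow> 'a" and k
  proof -
    have "(\<Sum>l\<le>n. x l * I_n1 n $$ (l,k)) = (\<Sum>l\<in>{..n} \<inter> {k}. sg n l *\<^sub>R x l)"
      using that by (intro sum.mono_neutral_cong_right) (auto simp: I_n1_def sg_def)
    with that show ?thesis by simp
  qed
  have "(conj_trans cj A * I_n1 n * A) $$ (i,j)
      = (\<Sum>k\<le>n. (\<Sum>l\<le>n. cj (A $$ (l,i)) * I_n1 n $$ (l,k)) * A $$ (k,j))"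
    using assms c
    by (subst mult_mat_index[of _ n], force, force, force, force)
       (rule sum.cong, simp, subst mult_mat_index[of _ n], auto simp: conj_trans_def)
  also have "\<dots> = (\<Sum>l\<le>n. sg n l *\<^sub>R (cj (A $$ (l,i)) * A $$ (l,j)))"
    by (rule sum.cong) (auto simp: I)
  finally show ?thesis .
qed

lemma U_n1_iff:
  "A \<in> U_n1 n \<longleftrightarrow> A \<in> carrier_mat (Suc n) (Suc n) \<and>
    (\<forall>i\<le>n. \<forall>j\<le>n. (\<Sum>l\<le>n. sg n l *\<^sub>R (cj (A $$ (l,i)) * A $$ (l,j))) = (if i = j then of_real (sg n i) else 0))"
  (is "_ \<longleftrightarrow> _ \<and> ?P")
proof (cases "A \<in> carrier_mat (Suc n) (Suc n)")
  case A: True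
  have I: "I_n1 n $$ (i,j) = (if i = j then of_real (sg n i) else (0::'a))" if "i \<le> n" "j \<le> n" for i j
    using that by (auto simp: I_n1_def sg_def)
  have "conj_trans cj A * I_n1 n * A = I_n1 n \<longleftrightarrow>
      (\<forall>i\<le>n. \<forall>j\<le>n. (conj_trans cj A * I_n1 n * A) $$ (i,j) = I_n1 n $$ (i,j))"
  proof (intro iffI eq_matI)
    show "dim_row (conj_trans cj A * I_n1 n * A) = dim_row (I_n1 n :: 'a mat)"
      "dim_col (conj_trans cj A * I_n1 n * A) = dim_col (I_n1 n :: 'a mat)"
      using A by (auto simp: conj_trans_def I_n1_def)
  qed (auto simp: I_n1_def)
  also have "\<dots> \<longleftrightarrow> ?P" using A by (simp add: form_entry I)
  finally show ?thesis using A by (simp add: U_n1_def)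
qed (simp add: U_n1_def)

lemma hf_app_app:
  assumes A: "A \<in> U_n1 n"
  shows "hf n (app n A v) (app n A w) = hf n v w"
proof -
  have "hf n (app n A v) (app n A w)
      = (\<Sum>l\<le>n. \<Sum>i\<le>n. \<Sum>j\<le>n. cj (v i) * (sg n l *\<^sub>R (cj (A $$ (l,i)) * A $$ (l,j))) * w j)"
    unfolding hf_def
    by (rule sum.cong) (simp_all add: app_def cj_sum cj_mult sum_product scaleR_sum_right mult.assoc)
  also have "\<dots> = (\<Sum>i\<le>n. \<Sum>l\<le>n. \<Sum>j\<le>n. cj (v i) * (sg n l *\<^sub>R (cj (A $$ (l,i)) * A $$ (l,j))) * w j)"
    by (rule sum.swap)
  also have "\<dots> = (\<Sum>i\<le>n. \<Sum>j\<le>n. \<Sum>l\<le>n. cj (v i) * (sg n l *\<^sub>R (cj (A $$ (l,i)) * A $$ (l,j))) * w j)"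
    by (intro sum.cong refl sum.swap)
  also have "\<dots> = (\<Sum>i\<le>n. \<Sum>j\<le>n. cj (v i) * (\<Sum>l\<le>n. sg n l *\<^sub>R (cj (A $$ (l,i)) * A $$ (l,j))) * w j)"
    by (simp add: sum_distrib_left sum_distrib_right)
  also have "\<dots> = (\<Sum>i\<le>n. \<Sum>j\<le>n. cj (v i) * (if i = j then of_real (sg n i) else 0) * w j)"
    using A by (intro sum.cong refl) (simp add: U_n1_iff)
  also have "\<dots> = (\<Sum>i\<le>n. \<Sum>j\<in>{..n} \<inter> {i}. cj (v i) * of_real (sg n i) * w j)"
    by (intro sum.cong refl sum.mono_neutral_cong_right) auto
  also have "\<dots> = hf n v w" by (simp add: hf_def of_real_def)
  finally show ?thesis .
qed

section \<open>Null vectors and the equality case of the Cauchy-Schwarz inequality\<close>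

lemma null_vec_norm:
  assumes "null_vec n v"
  shows "v n \<noteq> 0" "(\<Sum>i<n. (norm (v i))\<^sup>2) = (norm (v n))\<^sup>2"
proof -
  have "of_real ((\<Sum>i<n. (norm (v i))\<^sup>2) - (norm (v n))\<^sup>2) = (0::'a)"
    using assms hf_self[of n v] by (simp add: null_vec_def)
  then show s: "(\<Sum>i<n. (norm (v i))\<^sup>2) = (norm (v n))\<^sup>2" by (simp only: of_real_eq_0_iff)
  show "v n \<noteq> 0"
  proof
    assume 0: "v n = 0"
    then have "(\<Sum>i<n. (norm (v i))\<^sup>2) = 0" using s by simp
    then have "\<forall>i\<in>{..<n}. (norm (v i))\<^sup>2 = 0" by (subst (asm) sum_nonneg_eq_0_iff) auto
    with 0 have "\<forall>i\<le>n. v i = 0" by (auto simp: le_less)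
    with assms show False by (auto simp: null_vec_def)
  qed
qed

lemma null_vecI: "v n \<noteq> 0 \<Longrightarrow> hf n v v = 0 \<Longrightarrow> null_vec n v"
  by (auto simp: null_vec_def)

lemma null_vec_mult: "null_vec n v \<Longrightarrow> q \<noteq> 0 \<Longrightarrow> null_vec n (\<lambda>i. v i * q)"
  by (auto simp: null_vec_def hf_mult_left hf_mult_right)

lemma norm_diff_sq: "(norm (p - q))\<^sup>2 = (norm p)\<^sup>2 + (norm q)\<^sup>2 - 2 * inner p (q::'a::real_inner)"
  by (simp add: power2_norm_eq_inner inner_diff_left inner_diff_right inner_commute)

text \<open>For null vectors \<open>x\<close>, \<open>y\<close> scaled to last coordinate \<open>1\<close>, the sum below is
  \<open>\<Sum>\<bar>x\<^sub>i W - W y\<^sub>i\<bar>\<^sup>2\<close>, which vanishes by expanding the square.\<close>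

lemma null_cauchy_eq:
  assumes x: "null_vec n x" "x n = 1" and y: "null_vec n y" "y n = 1"
    and W: "(\<Sum>i<n. x i * W * cj (y i)) = W" and i: "i \<le> n"
  shows "x i * W = W * y i"
proof (cases "i = n")
  case False
  with i have "i < n" by simp
  have sx: "(\<Sum>i<n. (norm (x i))\<^sup>2) = 1" and sy: "(\<Sum>i<n. (norm (y i))\<^sup>2) = 1"
    using null_vec_norm[OF x(1)] null_vec_norm[OF y(1)] x(2) y(2) by simp_all
  have "(norm (x i * W - W * y i))\<^sup>2
      = (norm (x i))\<^sup>2 * (norm W)\<^sup>2 + (norm W)\<^sup>2 * (norm (y i))\<^sup>2 - 2 * inner (x i * W * cj (y i)) W" for i
  proof -
    have "inner (x i * W * cj (y i)) W = inner (x i * W) (W * y i)"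
      using inner_mult_right_cj[of "x i * W" "cj (y i)" W] by simp
    moreover have "(norm (x i * W))\<^sup>2 = (norm (x i))\<^sup>2 * (norm W)\<^sup>2" "(norm (W * y i))\<^sup>2 = (norm W)\<^sup>2 * (norm (y i))\<^sup>2"
      by (simp_all add: norm_mult power_mult_distrib)
    ultimately show ?thesis by (simp add: norm_diff_sq)
  qed
  then have "(\<Sum>i<n. (norm (x i * W - W * y i))\<^sup>2)
      = (\<Sum>i<n. (norm (x i))\<^sup>2) * (norm W)\<^sup>2 + (norm W)\<^sup>2 * (\<Sum>i<n. (norm (y i))\<^sup>2)
        - 2 * inner (\<Sum>i<n. x i * W * cj (y i)) W"
    by (simp only: sum.distrib sum_subtractf sum_distrib_left sum_distrib_right inner_sum_left)
  also have "\<dots> = 0" unfolding W sx sy by (simp add: power2_norm_eq_inner)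
  finally have "(norm (x i * W - W * y i))\<^sup>2 = 0"
    using \<open>i < n\<close> by (subst (asm) sum_nonneg_eq_0_iff) auto
  then show ?thesis by simp
qed (use x y in simp)

lemma null_vec_normalize:
  assumes "null_vec n x"
  shows "null_vec n (\<lambda>i. x i * inverse (x n))" "(\<lambda>i. x i * inverse (x n)) n = 1"
  using null_vec_norm(1)[OF assms] by (auto intro: null_vec_mult assms)

text \<open>With last coordinates scaled to 1, both vectors give points of the unit sphere whose
  real inner product is 1, so their distance is 0. Thus a vanishing form value is the way to say
  that two null vectors define the same boundary point.\<close>

lemma null_vec_orthogonal:
  assumes x: "null_vec n x" and y: "null_vec n y" and 0: "hf n x y = 0" and i: "i \<le> n"
  shows "y i = x i * (inverse (x n) * y n)"
proof -
  define x' y' where "x' = (\<lambda>i. x i * inverse (x n))" and "y' = (\<lambda>i. y i * inverse (y n))"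
  have n: "null_vec n x'" "x' n = 1" "null_vec n y'" "y' n = 1"
    using null_vec_normalize[OF x] null_vec_normalize[OF y] by (simp_all add: x'_def y'_def)
  have "hf n y' x' = 0"
    using 0 hf_eq_0_commute[of n x y] by (simp add: x'_def y'_def hf_mult_left hf_mult_right)
  then have s: "(\<Sum>i<n. cj (y' i) * x' i) = 1" using n by (simp add: hf_split)
  have sx: "(\<Sum>i<n. (norm (x' i))\<^sup>2) = 1" and sy: "(\<Sum>i<n. (norm (y' i))\<^sup>2) = 1"
    using null_vec_norm[OF n(1)] null_vec_norm[OF n(3)] n by simp_all
  have "inner (\<Sum>i<n. cj (y' i) * x' i) 1 = (\<Sum>i<n. inner (x' i * cj (y' i)) 1)"
    unfolding inner_sum_left by (intro sum.cong refl inner_1_commute)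
  also have "\<dots> = (\<Sum>i<n. inner (x' i) (y' i))" by (simp only: inner_conv_cj[symmetric])
  finally have s': "(\<Sum>i<n. inner (x' i) (y' i)) = 1" by (simp add: s)
  have "(\<Sum>i<n. (norm (x' i - y' i))\<^sup>2)
      = (\<Sum>i<n. (norm (x' i))\<^sup>2) + (\<Sum>i<n. (norm (y' i))\<^sup>2) - 2 * (\<Sum>i<n. inner (x' i) (y' i))"
    by (simp only: norm_diff_sq sum.distrib sum_subtractf sum_distrib_left)
  also have "\<dots> = 0" by (simp add: sx sy s')
  finally have "\<forall>i\<in>{..<n}. (norm (x' i - y' i))\<^sup>2 = 0"
    by (subst (asm) sum_nonneg_eq_0_iff) auto
  then have "x' i = y' i" using i n by (cases "i = n") auto
  then show ?thesis
    using null_vec_norm(1)[OF y] by (simp add: x'_def y'_def mult.assoc[symmetric]) (simp add: mult.assoc)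
qed

text \<open>Equality of boundary points is transitive.\<close>

lemma null_vec_orthogonal_trans:
  assumes "null_vec n x" "null_vec n y" "null_vec n z" "hf n x y = 0" "hf n y z = 0"
  shows "hf n x z = 0"
proof -
  have "hf n x z = hf n x (\<lambda>i. y i * (inverse (y n) * z n))"
    by (intro hf_cong null_vec_orthogonal[OF assms(2,3,5)] refl)
  then show ?thesis by (simp add: hf_mult_right assms)
qed

lemma null_vec_app: 
  assumes "A \<in> U_n1 n" "B * A = 1\<^sub>m (Suc n)" "B \<in> carrier_mat (Suc n) (Suc n)" "null_vec n v"
  shows "null_vec n (app n A v)"
proof -
  have "\<exists>i\<le>n. app n A v i \<noteq> 0"
  proof (rule ccontr)
    assume "\<not> ?thesis"
    then have "app n B (app n A v) i = app n B (\<lambda>_. 0) i" for i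
      by (intro fun_cong[OF app_cong]) auto
    then have "app n (B * A) v i = 0" for i
      using assms by (subst app_mult) (auto simp: U_n1_def app_def)
    then have "\<forall>i\<le>n. v i = 0" using assms app_one[of _ n v] by metis
    with assms(4) show False by (auto simp: null_vec_def)
  qed
  with assms show ?thesis by (auto simp: null_vec_def hf_app_app)
qed

section \<open>Discrete groups and rank-one limits\<close>

lemma finite_index_subseq:
  fixes f :: "nat \<Rightarrow> 'i \<Rightarrow> 'a::heine_borel"
  assumes "finite I" "\<And>i. i \<in> I \<Longrightarrow> bounded (range (\<lambda>k. f k i))"
  shows "\<exists>r l. strict_mono (r :: nat \<Rightarrow> nat) \<and> (\<forall>i\<in>I. (\<lambda>k. f (r k) i) \<longlonglongrightarrow> l i)"
  using assms
proof (induction I)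
  case empty
  then show ?case by (intro exI[of _ id]) (simp add: strict_mono_def)
next
  case (insert x I)
  then obtain r l where r: "strict_mono (r :: nat \<Rightarrow> nat)" and l: "\<And>i. i \<in> I \<Longrightarrow> (\<lambda>k. f (r k) i) \<longlonglongrightarrow> l i"
    by auto
  have "bounded (range (\<lambda>k. f (r k) x))"
    by (rule bounded_subset[OF insert.prems[of x]]) auto
  then obtain y s where s: "strict_mono (s :: nat \<Rightarrow> nat)" and y: "((\<lambda>k. f (r k) x) \<circ> s) \<longlonglongrightarrow> y"
    using bounded_imp_convergent_subsequence by blast
  have "(\<lambda>k. f ((r \<circ> s) k) i) \<longlonglongrightarrow> (l(x := y)) i" if "i \<in> insert x I" for i
  proof (cases "i = x")
    case True
    then show ?thesis using y by (simp add: o_def)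
  next
    case False
    then have "i \<in> I" using that by auto
    from LIMSEQ_subseq_LIMSEQ[OF l[OF this] s] False show ?thesis by (simp add: o_def)
  qed
  moreover have "strict_mono (r \<circ> s)" using r s by (rule strict_mono_o)
  ultimately show ?case by blast
qed

locale hyp_group =
  fixes n :: nat and G :: "'a::hyp_scalar mat set"
  assumes subgroup: "is_mat_subgroup (Suc n) G (U_n1 n)"
    and discrete: "discrete_mats G"
begin

definition iv :: "'a mat \<Rightarrow> 'a mat" where
  "iv A = (SOME B. B \<in> G \<and> A * B = 1\<^sub>m (Suc n) \<and> B * A = 1\<^sub>m (Suc n))"

text \<open>Up to normalization of the metric this is the hyperbolic cosine of the distance by which
  \<open>A\<close> moves the centre of the ball; it serves as the size of \<open>A\<close>.\<close>

definition nn :: "'a mat \<Rightarrow> real" where "nn A = norm (A $$ (n,n))"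

lemma U: "A \<in> G \<Longrightarrow> A \<in> U_n1 n"
  and one_in [simp]: "1\<^sub>m (Suc n) \<in> G"
  and mult_in [simp]: "A \<in> G \<Longrightarrow> B \<in> G \<Longrightarrow> A * B \<in> G"
  using subgroup by (auto simp: is_mat_subgroup_def)

lemma carr [simp]: "A \<in> G \<Longrightarrow> A \<in> carrier_mat (Suc n) (Suc n)"
  using U by (auto simp: U_n1_def)

lemma
  assumes "A \<in> G"
  shows iv_in [simp]: "iv A \<in> G" and iv_right: "A * iv A = 1\<^sub>m (Suc n)" and iv_left: "iv A * A = 1\<^sub>m (Suc n)"
proof -
  have "\<exists>B. B \<in> G \<and> A * B = 1\<^sub>m (Suc n) \<and> B * A = 1\<^sub>m (Suc n)"
    using subgroup assms by (auto simp: is_mat_subgroup_def)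
  from someI_ex[OF this] show "iv A \<in> G" "A * iv A = 1\<^sub>m (Suc n)" "iv A * A = 1\<^sub>m (Suc n)"
    by (auto simp: iv_def)
qed

lemma mult_one_right [simp]: "A \<in> G \<Longrightarrow> A * 1\<^sub>m (Suc n) = A"
  and mult_one_left [simp]: "A \<in> G \<Longrightarrow> 1\<^sub>m (Suc n) * A = A"
  using carr by (metis right_mult_one_mat left_mult_one_mat)+

lemma assoc: "A \<in> G \<Longrightarrow> B \<in> G \<Longrightarrow> C \<in> G \<Longrightarrow> A * B * C = A * (B * C)"
  using carr by (metis assoc_mult_mat)

lemma iv_cancel [simp]: "A \<in> G \<Longrightarrow> B \<in> G \<Longrightarrow> iv A * (A * B) = B" "A \<in> G \<Longrightarrow> B \<in> G \<Longrightarrow> A * (iv A * B) = B"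
  by (simp_all add: assoc[symmetric] iv_left iv_right)

lemma left_cancel: "A \<in> G \<Longrightarrow> B \<in> G \<Longrightarrow> C \<in> G \<Longrightarrow> A * B = A * C \<Longrightarrow> B = C"
  by (metis iv_cancel(1))

lemma app_mult_G: "A \<in> G \<Longrightarrow> B \<in> G \<Longrightarrow> app n (A * B) v = app n A (app n B v)"
  by (intro app_mult carr)

lemma app_iv: "A \<in> G \<Longrightarrow> i \<le> n \<Longrightarrow> app n (iv A) (app n A v) i = v i"
  and app_iv': "A \<in> G \<Longrightarrow> i \<le> n \<Longrightarrow> app n A (app n (iv A) v) i = v i"
  by (simp_all add: app_mult_G[symmetric] iv_left iv_right app_one)

lemma hf_app [simp]: "A \<in> G \<Longrightarrow> hf n (app n A v) (app n A w) = hf n v w"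
  by (intro hf_app_app U)

lemma hf_app_right:
  assumes "A \<in> G"
  shows "hf n v (app n A w) = hf n (app n (iv A) v) w"
proof -
  have "hf n v (app n A w) = hf n (app n (iv A) v) (app n (iv A) (app n A w))" using assms by simp
  also have "\<dots> = hf n (app n (iv A) v) w" using assms by (intro hf_cong) (simp_all add: app_iv)
  finally show ?thesis .
qed

lemma hf_app_left: "A \<in> G \<Longrightarrow> hf n (app n A v) w = hf n v (app n (iv A) w)"
  by (metis cj_hf hf_app_right)

lemma null_app: "A \<in> G \<Longrightarrow> null_vec n v \<Longrightarrow> null_vec n (app n A v)"
  using null_vec_app[OF U iv_left carr[OF iv_in]] by blast

text \<open>The inverse is J A* J. This is read off by pairing \<open>iv A\<close> with standard
  basis vectors and moving it across the form.\<close>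

lemma iv_entry:
  assumes "A \<in> G" "i \<le> n" "j \<le> n"
  shows "iv A $$ (i,j) = (sg n i * sg n j) *\<^sub>R cj (A $$ (j,i))"
proof -
  have "sg n i *\<^sub>R (iv A $$ (i,j)) = hf n (std i) (app n (iv A) (std j))"
    using assms by (simp add: hf_std_left app_std)
  also have "\<dots> = cj (hf n (std j) (app n A (std i)))"
    using assms by (simp add: cj_hf hf_app_left)
  also have "\<dots> = sg n j *\<^sub>R cj (A $$ (j,i))"
    using assms by (simp add: hf_std_left app_std cj_scaleR)
  finally have "sg n i *\<^sub>R (sg n i *\<^sub>R (iv A $$ (i,j))) = sg n i *\<^sub>R (sg n j *\<^sub>R cj (A $$ (j,i)))" by simp
  then show ?thesis by simp
qed

lemma nn_iv [simp]: "A \<in> G \<Longrightarrow> nn (iv A) = nn A"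
  by (simp add: nn_def iv_entry)

lemma col_norm:
  assumes "A \<in> G" "j \<le> n"
  shows "(\<Sum>l<n. (norm (A $$ (l,j)))\<^sup>2) = (norm (A $$ (n,j)))\<^sup>2 + sg n j"
proof -
  have "hf n (app n A (std j)) (app n A (std j)) = hf n (std j) (std j)" using assms by simp
  then have "of_real ((\<Sum>l<n. (norm (A $$ (l,j)))\<^sup>2) - (norm (A $$ (n,j)))\<^sup>2) = (of_real (sg n j) :: 'a)"
    using assms by (subst (asm) hf_self) (simp add: hf_std_left app_std std_def of_real_def)
  then show ?thesis by (simp only: of_real_eq_iff)
qed

lemma row_norm:
  assumes "A \<in> G" "j \<le> n"
  shows "(\<Sum>l<n. (norm (A $$ (j,l)))\<^sup>2) = (norm (A $$ (j,n)))\<^sup>2 + sg n j"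
  using col_norm[of "iv A" j] assms by (simp add: iv_entry)

lemma nn_ge1: assumes "A \<in> G" shows "1 \<le> nn A"
proof -
  have "0 \<le> (\<Sum>l<n. (norm (A $$ (l,n)))\<^sup>2)" by (intro sum_nonneg) simp
  then have "1\<^sup>2 \<le> (nn A)\<^sup>2" using col_norm[OF assms, of n] by (simp add: nn_def)
  then show ?thesis by (rule power2_le_imp_le) (simp add: nn_def)
qed

text \<open>A row has form norm 1 or -1, so any entry is controlled by the last entry of its row,
  and that one by the last entry of the last column. For \<open>i < n\<close> the first estimate
  loses 1 and the second gains it back.\<close>

lemma entry_le_nn:
  assumes A: "A \<in> G" and ij: "i \<le> n" "j \<le> n"
  shows "norm (A $$ (i,j)) \<le> nn A"
proof -
  have le: "x k \<le> (\<Sum>l<n. x l)" if "k < n" "\<And>l. 0 \<le> x l" for k and x :: "nat \<Rightarrow> real"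
    using that by (intro member_le_sum) auto
  have row: "(norm (A $$ (k,j)))\<^sup>2 \<le> (norm (A $$ (k,n)))\<^sup>2 + sg n k" if "j < n" "k \<le> n" for k
    using le[of j "\<lambda>l. (norm (A $$ (k,l)))\<^sup>2", OF that(1)] row_norm[OF A that(2)] by simp
  have col: "(norm (A $$ (i,n)))\<^sup>2 \<le> (nn A)\<^sup>2 + sg n n" if "i < n"
    using le[of i "\<lambda>l. (norm (A $$ (l,n)))\<^sup>2", OF that] col_norm[OF A order_refl] by (simp add: nn_def)
  have "(norm (A $$ (i,j)))\<^sup>2 \<le> (nn A)\<^sup>2"
  proof (cases "i = n"; cases "j = n")
    assume "i = n" "j \<noteq> n"
    then show ?thesis using row[of n] ij sg_self[of n] by (simp add: nn_def del: power_mono_iff abs_le_square_iff)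
  next
    assume "i \<noteq> n" "j = n"
    then show ?thesis using col ij sg_self[of n] by simp
  next
    assume "i \<noteq> n" "j \<noteq> n"
    then show ?thesis using row[of i] col ij sg_self[of n] sg_less[of i n] by linarith
  qed (simp add: nn_def)
  then show ?thesis by (rule power2_le_imp_le) (simp add: nn_def)
qed

lemma isolated_one: "\<exists>e>0. \<forall>B\<in>G. B \<noteq> 1\<^sub>m (Suc n) \<longrightarrow>
    (\<exists>i\<le>n. \<exists>j\<le>n. e \<le> norm (1\<^sub>m (Suc n) $$ (i,j) - B $$ (i,j)))"
  using discrete[unfolded discrete_mats_def, rule_format, OF one_in]
  by (auto simp: eabs_norm less_Suc_eq_le)

text \<open>Distinct elements with entries at most \<open>R\<close> differ by at least a multiple of \<open>1/R\<close> in some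
  entry, so rounding the real coordinates of the entries separates them.\<close>

lemma polynomial_count:
  "\<exists>K D. \<forall>R\<ge>1. finite {A \<in> G. nn A \<le> R} \<and> real (card {A \<in> G. nn A \<le> R}) \<le> (K * R\<^sup>2) ^ D"
proof -
  obtain e where e: "e > 0" and iso: "\<And>B. B \<in> G \<Longrightarrow> B \<noteq> 1\<^sub>m (Suc n) \<Longrightarrow>
      \<exists>i\<le>n. \<exists>j\<le>n. e \<le> norm (1\<^sub>m (Suc n) $$ (i,j) - B $$ (i,j))"
    using isolated_one by blast
  \<comment> \<open>Chosen so that, with mesh \<open>d = 1 / (c * R)\<close>, two elements in the
    same cell satisfy |1 - iv A * B| <= R * d * (n+1) * DIM = e/2, which contradicts the isolation
    radius \<open>e\<close> of the identity.\<close>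
  define c where "c = 2 * ((real n + 1) * real DIM('a)) / e"
  define I where "I = {..n} \<times> {..n} \<times> (Basis :: 'a set)"
  have half: "1 / (2 * P / e) * P = e / 2" if "P > 0" for P using that by simp
  have c: "c > 0" using e by (simp add: c_def)
  have I: "finite I" by (simp add: I_def)
  have "finite S \<and> real (card S) \<le> ((2 * c + 5) * R\<^sup>2) ^ card I"
    if R: "R \<ge> 1" and S: "S = {A \<in> G. nn A \<le> R}" for R S
  proof -
    define d where "d = 1 / (c * R)"
    have d: "d > 0" using c R by (simp add: d_def)
    define M where "M = \<lceil>R / d\<rceil> + 1"
    define F where "F A = (\<lambda>(i,j,b)\<in>I. \<lfloor>inner (A $$ (i,j)) b / d\<rfloor>)" for A :: "'a mat"
    have "F ` S \<subseteq> PiE I (\<lambda>_. {-M..M})"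
    proof (intro image_subsetI PiE_I)
      fix A p assume A: "A \<in> S" and p: "p \<in> I"
      obtain i j b where ijb: "p = (i,j,b)" "i \<le> n" "j \<le> n" "b \<in> Basis"
        using p by (auto simp: I_def)
      have "\<bar>inner (A $$ (i,j)) b\<bar> \<le> R"
        using Basis_le_norm[OF ijb(4), of "A $$ (i,j)"] entry_le_nn[of A i j] A ijb by (simp add: S)
      then have "\<bar>inner (A $$ (i,j)) b / d\<bar> \<le> R / d" using d by (simp add: divide_right_mono)
      then have "- M \<le> \<lfloor>inner (A $$ (i,j)) b / d\<rfloor> \<and> \<lfloor>inner (A $$ (i,j)) b / d\<rfloor> \<le> M"
        unfolding M_def by linarith
      then show "F A p \<in> {-M..M}" using p ijb by (simp add: F_def)
    qed (auto simp: F_def)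
    moreover have "inj_on F S"
    proof (rule inj_onI, rule ccontr)
      fix A B assume A: "A \<in> S" and B: "B \<in> S" and eq: "F A = F B" and neq: "A \<noteq> B"
      have AB: "A \<in> G" "B \<in> G" using A B by (auto simp: S)
      have "iv A * B \<noteq> 1\<^sub>m (Suc n)"
        using neq AB by (metis iv_cancel(2) mult_one_right)
      then obtain i j where ij: "i \<le> n" "j \<le> n" and e': "e \<le> norm (1\<^sub>m (Suc n) $$ (i,j) - (iv A * B) $$ (i,j))"
        using iso[of "iv A * B"] AB by auto
      have small: "norm (A $$ (l,j) - B $$ (l,j)) \<le> real DIM('a) * d" if l: "l \<le> n" for l
      proof -
        have "\<bar>inner (A $$ (l,j) - B $$ (l,j)) b\<bar> \<le> d" if b: "b \<in> Basis" for b
        proof -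
          have "\<lfloor>inner (A $$ (l,j)) b / d\<rfloor> = \<lfloor>inner (B $$ (l,j)) b / d\<rfloor>"
            using fun_cong[OF eq, of "(l,j,b)"] l ij b by (simp add: F_def I_def)
          then have "\<bar>inner (A $$ (l,j)) b / d - inner (B $$ (l,j)) b / d\<bar> \<le> 1" by linarith
          then have "\<bar>(inner (A $$ (l,j)) b - inner (B $$ (l,j)) b) / d\<bar> \<le> 1" by (simp add: diff_divide_distrib)
          with d show ?thesis by (simp add: inner_diff_left)
        qed
        then have "(\<Sum>b\<in>Basis. \<bar>inner (A $$ (l,j) - B $$ (l,j)) b\<bar>) \<le> real DIM('a) * d"
          using sum_bounded_above[of Basis "\<lambda>b. \<bar>inner (A $$ (l,j) - B $$ (l,j)) b\<bar>" d] by simp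
        with norm_le_l1 show ?thesis by (rule order_trans)
      qed
      \<comment> \<open>The difference is iv A * (A - B), and the entries of \<open>iv A\<close> are
        bounded by the same \<open>R\<close> because \<open>nn (iv A) = nn A\<close>.\<close>
      have "1\<^sub>m (Suc n) $$ (i,j) - (iv A * B) $$ (i,j) = (iv A * A) $$ (i,j) - (iv A * B) $$ (i,j)"
        using AB by (simp add: iv_left)
      also have "\<dots> = (\<Sum>l\<le>n. iv A $$ (i,l) * (A $$ (l,j) - B $$ (l,j)))"
        using AB ij by (simp add: mult_mat_index[OF carr carr] right_diff_distrib sum_subtractf)
      finally have "norm (1\<^sub>m (Suc n) $$ (i,j) - (iv A * B) $$ (i,j))
          \<le> (\<Sum>l\<le>n. norm (iv A $$ (i,l)) * norm (A $$ (l,j) - B $$ (l,j)))"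
        by (simp add: norm_mult[symmetric] norm_sum)
      also have "\<dots> \<le> (\<Sum>l\<le>n. R * (real DIM('a) * d))"
      proof (intro sum_mono mult_mono small)
        fix l assume "l \<in> {..n}"
        then show "norm (iv A $$ (i,l)) \<le> R" "l \<le> n"
          using entry_le_nn[of "iv A" i l] A AB ij by (auto simp: S)
      qed (use R in auto)
      also have "\<dots> = (R * d) * ((real n + 1) * real DIM('a))" by (simp add: algebra_simps)
      also have "R * d = 1 / c" using R by (simp add: d_def)
      also have "1 / c * ((real n + 1) * real DIM('a)) = e / 2"
        unfolding c_def by (rule half) simp
      finally show False using e e' by simp
    qed
    moreover have "finite (PiE I (\<lambda>_. {-M..M}))" using I by (intro finite_PiE) auto
    ultimately have fin: "finite S" and "card S \<le> card (PiE I (\<lambda>_. {-M..M}))"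
      using inj_on_finite card_inj_on_le by blast+
    then have "real (card S) \<le> real (nat (2 * M + 1) ^ card I)"
      using I by (simp add: card_PiE)
    also have "\<dots> = real (nat (2 * M + 1)) ^ card I" by simp
    also have "\<dots> \<le> ((2 * c + 5) * R\<^sup>2) ^ card I"
    proof (rule power_mono)
      have Rd: "R / d = c * R\<^sup>2" using R c by (simp add: d_def power2_eq_square)
      have "0 \<le> \<lceil>R / d\<rceil>" using R d by (simp add: order.strict_trans2[of "-1" 0])
      then have "real (nat (2 * M + 1)) = 2 * real_of_int \<lceil>R / d\<rceil> + 3" by (simp add: M_def)
      also have "\<dots> \<le> 2 * (R / d) + 5" by linarith
      also have "\<dots> = 2 * (c * R\<^sup>2) + 5" by (simp only: Rd)
      also have "\<dots> \<le> (2 * c + 5) * R\<^sup>2" using R by (simp add: distrib_right)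
      finally show "real (nat (2 * M + 1)) \<le> (2 * c + 5) * R\<^sup>2" .
    qed simp
    finally show ?thesis using fin by simp
  qed
  then show ?thesis by blast
qed

lemma finite_bounded: "finite {A \<in> G. nn A \<le> R}"
proof -
  obtain K D where "\<forall>R\<ge>1. finite {A \<in> G. nn A \<le> R} \<and> real (card {A \<in> G. nn A \<le> R}) \<le> (K * R\<^sup>2) ^ D"
    using polynomial_count by blast
  then have "finite {A \<in> G. nn A \<le> max R 1}" by simp
  then show ?thesis by (rule rev_finite_subset) auto
qed

lemma infinite_unbounded_seq:
  assumes "infinite S" "S \<subseteq> G"
  shows "\<exists>g. (\<forall>k. g k \<in> S) \<and> filterlim (\<lambda>k. nn (g k)) at_top sequentially"
proof -
  have "\<exists>A\<in>S. real k < nn A" for k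
  proof (rule ccontr)
    assume "\<not> ?thesis"
    then have "S \<subseteq> {A \<in> G. nn A \<le> real k}" using assms(2) by force
    with assms(1) finite_bounded show False using finite_subset by blast
  qed
  then obtain g where g: "\<And>k. g k \<in> S" "\<And>k. real k < nn (g k)" by metis
  have "filterlim (\<lambda>k. nn (g k)) at_top sequentially"
    by (rule filterlim_at_top_mono[OF filterlim_real_sequentially]) (auto intro: always_eventually less_imp_le g)
  with g show ?thesis by blast
qed

text \<open>The limit matrix is \<open>\<xi>\<close> times the row \<open>\<eta>\<close>* J, the
  factor \<open>sg n j\<close> being the entry of J; it sends v to
  \<open>\<xi> * hf n \<eta> v\<close>. So \<open>\<xi>\<close> spans the attracting line and the
  orthogonal complement of \<open>\<eta>\<close> is the kernel. Since \<open>c\<close> tends to 0,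
  the matrices leave every bounded set when the limit is nonzero.\<close>

definition conv :: "(nat \<Rightarrow> 'a mat) \<Rightarrow> (nat \<Rightarrow> real) \<Rightarrow> (nat \<Rightarrow> 'a) \<Rightarrow> (nat \<Rightarrow> 'a) \<Rightarrow> bool" where
  "conv g c \<xi> \<eta> \<longleftrightarrow> (\<forall>k. g k \<in> G) \<and> (\<forall>k. 0 < c k) \<and> c \<longlonglongrightarrow> 0 \<and>
     (\<forall>i\<le>n. \<forall>j\<le>n. (\<lambda>k. c k *\<^sub>R (g k $$ (i,j))) \<longlonglongrightarrow> sg n j *\<^sub>R (\<xi> i * cj (\<eta> j)))"

lemma conv_G: "conv g c \<xi> \<eta> \<Longrightarrow> g k \<in> G"
  and conv_pos: "conv g c \<xi> \<eta> \<Longrightarrow> 0 < c k"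
  and conv_0: "conv g c \<xi> \<eta> \<Longrightarrow> c \<longlonglongrightarrow> 0"
  by (simp_all add: conv_def)

text \<open>The vectors may vary with \<open>k\<close>; this is what later turns pointwise
  attraction into uniform attraction.\<close>

lemma conv_app:
  assumes "conv g c \<xi> \<eta>" "\<And>i. i \<le> n \<Longrightarrow> (\<lambda>k. v k i) \<longlonglongrightarrow> w i" "i \<le> n"
  shows "(\<lambda>k. c k *\<^sub>R app n (g k) (v k) i) \<longlonglongrightarrow> \<xi> i * hf n \<eta> w"
proof -
  have "(\<lambda>k. \<Sum>j\<le>n. (c k *\<^sub>R (g k $$ (i,j))) * v k j) \<longlonglongrightarrow> (\<Sum>j\<le>n. (sg n j *\<^sub>R (\<xi> i * cj (\<eta> j))) * w j)"
    using assms by (intro tendsto_sum tendsto_mult) (auto simp: conv_def)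
  moreover have "(\<Sum>j\<le>n. (c k *\<^sub>R (g k $$ (i,j))) * v k j) = c k *\<^sub>R app n (g k) (v k) i" for k
    using assms(3) by (simp add: app_def scaleR_sum_right)
  moreover have "(\<Sum>j\<le>n. (sg n j *\<^sub>R (\<xi> i * cj (\<eta> j))) * w j) = \<xi> i * hf n \<eta> w"
    by (simp add: hf_def sum_distrib_left mult.assoc)
  ultimately show ?thesis by simp
qed

lemma conv_subseq:
  assumes g: "conv g c \<xi> \<eta>" and r: "strict_mono r"
  shows "conv (\<lambda>k. g (r k)) (\<lambda>k. c (r k)) \<xi> \<eta>"
  unfolding conv_def
proof (intro conjI allI impI)
  show "(\<lambda>k. c (r k)) \<longlonglongrightarrow> 0"
    using LIMSEQ_subseq_LIMSEQ[OF conv_0[OF g] r] by (simp add: o_def)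
  fix i j assume "i \<le> n" "j \<le> n"
  then have "(\<lambda>k. c k *\<^sub>R (g k $$ (i,j))) \<longlonglongrightarrow> sg n j *\<^sub>R (\<xi> i * cj (\<eta> j))"
    using g by (simp add: conv_def)
  from LIMSEQ_subseq_LIMSEQ[OF this r]
  show "(\<lambda>k. c (r k) *\<^sub>R (g (r k) $$ (i,j))) \<longlonglongrightarrow> sg n j *\<^sub>R (\<xi> i * cj (\<eta> j))"
    by (simp add: o_def)
qed (use g in \<open>auto simp: conv_def\<close>)

text \<open>The limit matrix determines its two factors only up to a scalar between them, which
  passes to the other side conjugated.\<close>

lemma conv_move_scalar: "conv g c (\<lambda>i. \<xi> i * q) \<eta> \<longleftrightarrow> conv g c \<xi> (\<lambda>i. \<eta> i * cj q)"
  by (simp add: conv_def cj_mult mult.assoc)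

lemma conv_cong:
  "conv g c \<xi> \<eta> \<Longrightarrow> (\<And>i. i \<le> n \<Longrightarrow> \<xi> i = \<xi>' i) \<Longrightarrow> (\<And>i. i \<le> n \<Longrightarrow> \<eta> i = \<eta>' i) \<Longrightarrow> conv g c \<xi>' \<eta>'"
  by (auto simp: conv_def)

text \<open>Inversion is A -> J A* J, and the adjoint exchanges the two factors of a rank-one
  matrix.\<close>

lemma conv_iv:
  assumes "conv g c \<xi> \<eta>"
  shows "conv (\<lambda>k. iv (g k)) c \<eta> \<xi>"
  unfolding conv_def
proof (intro conjI allI impI)
  fix i j assume ij: "i \<le> n" "j \<le> n"
  have "(\<lambda>k. (sg n i * sg n j) *\<^sub>R cj (c k *\<^sub>R (g k $$ (j,i))))
      \<longlonglongrightarrow> (sg n i * sg n j) *\<^sub>R cj (sg n i *\<^sub>R (\<xi> j * cj (\<eta> i)))"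
    using assms ij by (intro tendsto_scaleR[OF tendsto_const] tendsto_cj) (auto simp: conv_def)
  then show "(\<lambda>k. c k *\<^sub>R (iv (g k) $$ (i,j))) \<longlonglongrightarrow> sg n j *\<^sub>R (\<eta> i * cj (\<xi> j))"
    using ij conv_G[OF assms] by (simp add: iv_entry cj_scaleR cj_mult mult.commute mult.left_commute)
qed (use assms in \<open>auto simp: conv_def\<close>)

text \<open>Rank-one matrices multiply by pairing the inner factors. The limit is 0 if
  \<open>hf n \<eta> \<xi>'\<close> vanishes, so each application must secure a nonzero pairing to
  get information.\<close>

lemma conv_mult:
  assumes g: "conv g c \<xi> \<eta>" and h: "conv h d \<xi>' \<eta>'"
  shows "conv (\<lambda>k. g k * h k) (\<lambda>k. c k * d k) (\<lambda>i. \<xi> i * hf n \<eta> \<xi>') \<eta>'"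
  unfolding conv_def
proof (intro conjI allI impI)
  fix i j assume ij: "i \<le> n" "j \<le> n"
  have "(\<lambda>k. c k *\<^sub>R app n (g k) (\<lambda>l. d k *\<^sub>R (h k $$ (l,j))) i)
      \<longlonglongrightarrow> \<xi> i * hf n \<eta> (\<lambda>l. sg n j *\<^sub>R (\<xi>' l * cj (\<eta>' j)))"
    using h ij by (intro conv_app[OF g]) (auto simp: conv_def)
  moreover have "c k *\<^sub>R app n (g k) (\<lambda>l. d k *\<^sub>R (h k $$ (l,j))) i = (c k * d k) *\<^sub>R ((g k * h k) $$ (i,j))" for k
    using conv_G[OF g] conv_G[OF h] ij by (simp add: app_scaleR) (simp add: app_def mult_mat_index[OF carr carr])
  ultimately show "(\<lambda>k. (c k * d k) *\<^sub>R ((g k * h k) $$ (i,j))) \<longlonglongrightarrow> sg n j *\<^sub>R (\<xi> i * hf n \<eta> \<xi>' * cj (\<eta>' j))"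
    by (simp add: hf_scaleR_right hf_mult_right mult.assoc)
next
  show "(\<lambda>k. c k * d k) \<longlonglongrightarrow> 0"
    using tendsto_mult[OF conv_0[OF g] conv_0[OF h]] by simp
qed (use g h in \<open>auto simp: conv_def\<close>)

lemma conv_left:
  assumes g: "conv g c \<xi> \<eta>" and A: "A \<in> G"
  shows "conv (\<lambda>k. A * g k) c (app n A \<xi>) \<eta>"
  unfolding conv_def
proof (intro conjI allI impI)
  fix i j assume ij: "i \<le> n" "j \<le> n"
  have "(\<lambda>k. \<Sum>l\<le>n. A $$ (i,l) * (c k *\<^sub>R (g k $$ (l,j))))
      \<longlonglongrightarrow> (\<Sum>l\<le>n. A $$ (i,l) * (sg n j *\<^sub>R (\<xi> l * cj (\<eta> j))))"
    using g ij by (intro tendsto_sum tendsto_mult[OF tendsto_const]) (auto simp: conv_def)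
  then show "(\<lambda>k. c k *\<^sub>R ((A * g k) $$ (i,j))) \<longlonglongrightarrow> sg n j *\<^sub>R (app n A \<xi> i * cj (\<eta> j))"
    using A ij conv_G[OF g]
    by (simp add: mult_mat_index[OF carr carr] app_def scaleR_sum_right sum_distrib_right mult.assoc)
qed (use g A in \<open>auto simp: conv_def\<close>)

lemma iv_iv: assumes "A \<in> G" shows "iv (iv A) = A"
proof -
  have "iv A * iv (iv A) = iv A * A" using assms by (simp add: iv_left iv_right)
  then show ?thesis using assms left_cancel[of "iv A"] by simp
qed

text \<open>Right translation is obtained as the inverse of a left translation; the sequence is kept
  in this form instead of expanding the inverse of the product.\<close>

lemma conv_right:
  assumes g: "conv g c \<xi> \<eta>" and A: "A \<in> G"
  shows "conv (\<lambda>k. iv (A * g k)) c \<eta> (app n A \<xi>)"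
  by (rule conv_iv[OF conv_left[OF g A]])

text \<open>Dividing by \<open>nn\<close> bounds all entries and keeps the corner entry at norm 1,
  so a nonzero limit P exists. Dividing g* J g = J by \<open>nn\<close>^2 gives P* J P = 0: the
  columns of P are isotropic and mutually orthogonal, hence all multiples of the last one, and P has
  rank one.\<close>

lemma conv_exists:
  assumes g: "\<And>k. g k \<in> G" and inf: "filterlim (\<lambda>k. nn (g k)) at_top sequentially"
  shows "\<exists>r \<xi> \<eta>. strict_mono (r :: nat \<Rightarrow> nat) \<and> null_vec n \<xi> \<and> \<xi> n = 1 \<and> null_vec n \<eta> \<and>
    conv (\<lambda>k. g (r k)) (\<lambda>k. 1 / nn (g (r k))) \<xi> \<eta>"
proof -
  define f where "f k = (\<lambda>(i,j). (1 / nn (g k)) *\<^sub>R (g k $$ (i,j)))" for k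
  have pos: "0 < nn (g k)" for k using nn_ge1[OF g, of k] by simp
  have "bounded (range (\<lambda>k. f k p))" if "p \<in> {..n} \<times> {..n}" for p
  proof (rule boundedI[of _ 1])
    fix x assume "x \<in> range (\<lambda>k. f k p)"
    then obtain k where x: "x = f k p" by auto
    show "norm x \<le> 1"
      using entry_le_nn[OF g, of "fst p" "snd p" k] that pos[of k] by (auto simp: x f_def split: prod.splits)
  qed
  then obtain r P' where r: "strict_mono (r :: nat \<Rightarrow> nat)"
    and P': "\<And>p. p \<in> {..n} \<times> {..n} \<Longrightarrow> (\<lambda>k. f (r k) p) \<longlonglongrightarrow> P' p"
    using finite_index_subseq[of "{..n} \<times> {..n}" f, OF finite_cartesian_product[OF finite_atMost finite_atMost]] by blast
  define P where "P i j = P' (i,j)" for i j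
  define h where "h k = g (r k)" for k
  define c where "c k = 1 / nn (h k)" for k
  have hG: "h k \<in> G" for k by (simp add: h_def g)
  have cpos: "c k > 0" for k by (simp add: c_def h_def pos)
  have P: "(\<lambda>k. c k *\<^sub>R (h k $$ (i,j))) \<longlonglongrightarrow> P i j" if "i \<le> n" "j \<le> n" for i j
    using P'[of "(i,j)"] that by (simp add: f_def P_def c_def h_def)
  have "filterlim (\<lambda>k. nn (h k)) at_top sequentially"
    unfolding h_def by (rule filterlim_compose[OF inf filterlim_subseq[OF r]])
  then have c0: "c \<longlonglongrightarrow> 0"
    unfolding c_def by (intro tendsto_divide_0[OF tendsto_const] filterlim_at_top_imp_at_infinity)
  have c20: "(\<lambda>k. (c k)\<^sup>2 *\<^sub>R x) \<longlonglongrightarrow> 0" for x :: 'a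
    using tendsto_scaleR[OF tendsto_power[OF c0, of 2] tendsto_const[of x]] by simp
  have cols: "hf n (\<lambda>l. P l i) (\<lambda>l. P l j) = 0" if "i \<le> n" "j \<le> n" for i j
  proof (rule LIMSEQ_unique)
    show "(\<lambda>k. hf n (\<lambda>l. c k *\<^sub>R (h k $$ (l,i))) (\<lambda>l. c k *\<^sub>R (h k $$ (l,j)))) \<longlonglongrightarrow> hf n (\<lambda>l. P l i) (\<lambda>l. P l j)"
      using that by (intro tendsto_hf P)
    have "hf n (\<lambda>l. h k $$ (l,i)) (\<lambda>l. h k $$ (l,j)) = hf n (std i) (std j)" for k
    proof -
      have "hf n (\<lambda>l. h k $$ (l,i)) (\<lambda>l. h k $$ (l,j)) = hf n (app n (h k) (std i)) (app n (h k) (std j))"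
        using that by (intro hf_cong) (simp_all add: app_std)
      then show ?thesis by (simp add: hG)
    qed
    then show "(\<lambda>k. hf n (\<lambda>l. c k *\<^sub>R (h k $$ (l,i))) (\<lambda>l. c k *\<^sub>R (h k $$ (l,j)))) \<longlonglongrightarrow> 0"
      using c20 by (simp add: hf_scaleR_left hf_scaleR_right power2_eq_square)
  qed
  have normP: "norm (P n n) = 1"
  proof (rule LIMSEQ_unique[OF tendsto_norm[OF P]])
    have "norm (c k *\<^sub>R (h k $$ (n,n))) = 1" for k
      using pos[of "r k"] by (simp add: c_def nn_def h_def)
    then show "(\<lambda>k. norm (c k *\<^sub>R (h k $$ (n,n)))) \<longlonglongrightarrow> 1" by simp
  qed auto
  then have Pnn: "P n n \<noteq> 0" by auto
  define \<xi> where "\<xi> = (\<lambda>i. P i n * inverse (P n n))"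
  define \<eta> where "\<eta> = (\<lambda>j. sg n j *\<^sub>R cj (P n j))"
  have colnull: "null_vec n (\<lambda>i. P i n)" by (rule null_vecI[OF Pnn cols]) auto
  have fac: "P i j = \<xi> i * P n j" if ij: "i \<le> n" "j \<le> n" for i j
  proof (cases "\<exists>l\<le>n. P l j \<noteq> 0")
    case True
    then have "null_vec n (\<lambda>l. P l j)" using cols ij by (auto simp: null_vec_def)
    from null_vec_orthogonal[OF colnull this cols ij(1)] ij show ?thesis
      by (simp add: \<xi>_def mult.assoc)
  qed (use ij in auto)
  \<comment> \<open>The same limit for rows: the last row of \<open>h k\<close> has form norm -1,
    which disappears after scaling by \<open>c k\<close>^2.\<close>
  have "hf n \<eta> \<eta> = 0"
  proof (rule LIMSEQ_unique)
    show "(\<lambda>k. hf n (\<lambda>j. sg n j *\<^sub>R cj (c k *\<^sub>R (h k $$ (n,j)))) (\<lambda>j. sg n j *\<^sub>R cj (c k *\<^sub>R (h k $$ (n,j))))) \<longlonglongrightarrow> hf n \<eta> \<eta>"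
      unfolding \<eta>_def by (intro tendsto_hf tendsto_intros P) auto
    have row: "hf n (\<lambda>j. sg n j *\<^sub>R cj (h k $$ (n,j))) (\<lambda>j. sg n j *\<^sub>R cj (h k $$ (n,j))) = of_real (-1)" for k
      using row_norm[OF hG, of n k] by (subst hf_self) simp
    have pull: "sg n j *\<^sub>R cj (c k *\<^sub>R (h k $$ (n,j))) = c k *\<^sub>R (sg n j *\<^sub>R cj (h k $$ (n,j)))" for j k
      by (simp add: cj_scaleR mult.commute)
    have "hf n (\<lambda>j. sg n j *\<^sub>R cj (c k *\<^sub>R (h k $$ (n,j)))) (\<lambda>j. sg n j *\<^sub>R cj (c k *\<^sub>R (h k $$ (n,j))))
        = (c k)\<^sup>2 *\<^sub>R of_real (- 1)" for k
      unfolding pull hf_scaleR_left hf_scaleR_right row by (simp only: scaleR_scaleR power2_eq_square)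
    then show "(\<lambda>k. hf n (\<lambda>j. sg n j *\<^sub>R cj (c k *\<^sub>R (h k $$ (n,j)))) (\<lambda>j. sg n j *\<^sub>R cj (c k *\<^sub>R (h k $$ (n,j))))) \<longlonglongrightarrow> 0"
      by (simp only: c20)
  qed
  then have "null_vec n \<eta>" by (intro null_vecI) (auto simp: \<eta>_def Pnn)
  moreover have "null_vec n \<xi>" "\<xi> n = 1" using null_vec_normalize[OF colnull] by (simp_all add: \<xi>_def)
  moreover have "conv h c \<xi> \<eta>"
    unfolding conv_def
  proof (intro conjI allI impI)
    fix i j assume ij: "i \<le> n" "j \<le> n"
    have "sg n j *\<^sub>R (\<xi> i * cj (\<eta> j)) = \<xi> i * P n j" by (simp add: \<eta>_def cj_scaleR)
    then show "(\<lambda>k. c k *\<^sub>R (h k $$ (i,j))) \<longlonglongrightarrow> sg n j *\<^sub>R (\<xi> i * cj (\<eta> j))"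
      using P[OF ij] fac[OF ij] by simp
  qed (use hG cpos c0 in auto)
  ultimately show ?thesis using r unfolding h_def c_def by blast
qed

end

section \<open>Limit points and fixed lines\<close>

primrec word :: "nat \<Rightarrow> 'a::semiring_1 mat \<Rightarrow> 'a mat \<Rightarrow> bool list \<Rightarrow> 'a mat" where
  "word N A B [] = 1\<^sub>m N"
| "word N A B (x # w) = (if x then A else B) * word N A B w"

lemma LIMSEQ_norm_bound:
  assumes "X \<longlonglongrightarrow> (L :: 'a::real_normed_vector)"
  shows "\<exists>K. \<forall>k. norm (X k) \<le> K"
  using convergent_imp_Bseq[OF convergentI[OF assms]] unfolding Bseq_def by blast

lemma finite_range_constant_subseq:
  assumes "finite (range (f :: nat \<Rightarrow> 'b))"
  shows "\<exists>k0 r. strict_mono (r :: nat \<Rightarrow> nat) \<and> (\<forall>k. f (r k) = f k0)"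
proof -
  from pigeonhole_infinite[OF infinite_UNIV_nat assms] obtain k0 where inf: "infinite {k \<in> UNIV. f k = f k0}"
    by blast
  from enumerate_in_set[OF inf] have "f (enumerate {k \<in> UNIV. f k = f k0} k) = f k0" for k by blast
  with strict_mono_enumerate[OF inf] show ?thesis by blast
qed

lemma hf_0_sym: "hf n v w = 0 \<Longrightarrow> hf n w v = 0"
  by (simp add: hf_eq_0_commute[of n v w])

context hyp_group
begin

lemma conv_entry:
  "conv g c \<xi> \<eta> \<Longrightarrow> i \<le> n \<Longrightarrow> j \<le> n \<Longrightarrow> (\<lambda>k. c k *\<^sub>R (g k $$ (i,j))) \<longlonglongrightarrow> sg n j *\<^sub>R (\<xi> i * cj (\<eta> j))"
  by (simp add: conv_def)

text \<open>As the image of \<open>\<theta>\<close> is again null, orthogonality to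
  \<open>\<theta>\<close> means that it stays on the line of \<open>\<theta>\<close>: a common fixed
  point on the boundary.\<close>

definition fixes_line :: "(nat \<Rightarrow> 'a) \<Rightarrow> bool" where
  "fixes_line \<theta> \<longleftrightarrow> null_vec n \<theta> \<and> (\<forall>A\<in>G. hf n \<theta> (app n A \<theta>) = 0)"

text \<open>The limit set in terms of matrices: attracting lines of rank-one limits. This form is
  stable under the group and under products, which the definition by orbits in the ball does not
  show directly.\<close>

definition limit_pt :: "(nat \<Rightarrow> 'a) \<Rightarrow> bool" where
  "limit_pt \<zeta> \<longleftrightarrow> null_vec n \<zeta> \<and> (\<exists>g c \<eta>. null_vec n \<eta> \<and> conv g c \<zeta> \<eta>)"

definition three_limits :: bool where
  "three_limits \<longleftrightarrow> (\<exists>\<zeta>\<^sub>1 \<zeta>\<^sub>2 \<zeta>\<^sub>3. limit_pt \<zeta>\<^sub>1 \<and> limit_pt \<zeta>\<^sub>2 \<and> limit_pt \<zeta>\<^sub>3 \<and>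
     hf n \<zeta>\<^sub>1 \<zeta>\<^sub>2 \<noteq> 0 \<and> hf n \<zeta>\<^sub>1 \<zeta>\<^sub>3 \<noteq> 0 \<and> hf n \<zeta>\<^sub>2 \<zeta>\<^sub>3 \<noteq> 0)"

lemma ball_act_zero:
  assumes "A \<in> G" "i < n"
  shows "ball_act n A (0\<^sub>v n) $ i = A $$ (i,n) * inverse (A $$ (n,n))"
proof -
  have *: "(A *\<^sub>v lift_pt n (0\<^sub>v n)) $ j = A $$ (j,n)" if j: "j \<le> n" for j
  proof -
    have dims: "dim_row A = Suc n" "dim_col A = Suc n" using carr[OF assms(1)] by auto
    then have "(A *\<^sub>v lift_pt n (0\<^sub>v n)) $ j = (\<Sum>l\<in>{0..<Suc n}. A $$ (j,l) * (if l < n then 0 else 1))"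
      using j by (simp add: scalar_prod_def lift_pt_def)
    also have "\<dots> = (\<Sum>l\<in>{n}. A $$ (j,l))"
      by (intro sum.mono_neutral_cong_right) auto
    finally show ?thesis by simp
  qed
  show ?thesis using assms(2) by (simp add: ball_act_def proj_pt_def *)
qed

text \<open>The image of the centre of the ball has squared norm 1 - 1/\<open>nn\<close>^2, so
  convergence to the sphere forces \<open>nn\<close> to infinity. A rank-one limit then exists, and
  its attracting line is seen in the last column, whose quotients by the corner entry converge to
  \<open>x\<close>.\<close>

lemma limit_set_limit_pt:
  assumes x: "x \<in> limit_set n G"
  shows "limit_pt (\<lambda>i. if i < n then x $ i else 1)"
proof -
  obtain g where g: "\<And>k. g k \<in> G" and lim: "\<And>i. i < n \<Longrightarrow> (\<lambda>k. norm (ball_act n (g k) (0\<^sub>v n) $ i - x $ i)) \<longlonglongrightarrow> 0"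
    and sum1: "(\<Sum>i<n. (norm (x $ i))\<^sup>2) = 1"
    using x unfolding limit_set_def eabs_norm by blast
  have lim': "(\<lambda>k. g k $$ (i,n) * inverse (g k $$ (n,n))) \<longlonglongrightarrow> x $ i" if "i < n" for i
  proof -
    have "(\<lambda>k. ball_act n (g k) (0\<^sub>v n) $ i - x $ i) \<longlonglongrightarrow> 0" using lim[OF that] by (simp only: tendsto_norm_zero_iff)
    then show ?thesis by (simp only: ball_act_zero[OF g that] Lim_null[symmetric])
  qed
  have pos: "nn (g k) > 0" for k using nn_ge1[OF g, of k] by simp
  have "(\<lambda>k. \<Sum>i<n. (norm (g k $$ (i,n) * inverse (g k $$ (n,n))))\<^sup>2) \<longlonglongrightarrow> (\<Sum>i<n. (norm (x $ i))\<^sup>2)"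
    by (intro tendsto_sum tendsto_power tendsto_norm lim') simp
  moreover have "(\<Sum>i<n. (norm (g k $$ (i,n) * inverse (g k $$ (n,n))))\<^sup>2) = 1 - (inverse (nn (g k)))\<^sup>2" for k
  proof -
    have "(\<Sum>i<n. (norm (g k $$ (i,n) * inverse (g k $$ (n,n))))\<^sup>2) = (\<Sum>i<n. (norm (g k $$ (i,n)))\<^sup>2) * (inverse (nn (g k)))\<^sup>2"
      by (simp only: norm_mult norm_inverse power_mult_distrib nn_def sum_distrib_right)
    also have "\<dots> = ((nn (g k))\<^sup>2 - 1) * (inverse (nn (g k)))\<^sup>2"
      using col_norm[OF g, of n k] by (simp add: nn_def)
    also have "\<dots> = 1 - (inverse (nn (g k)))\<^sup>2"
      using pos[of k] by (simp only: left_diff_distrib power_mult_distrib[symmetric]) simp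
    finally show ?thesis .
  qed
  ultimately have "(\<lambda>k. 1 - (inverse (nn (g k)))\<^sup>2) \<longlonglongrightarrow> 1" by (simp only: sum1)
  from tendsto_diff[OF tendsto_const[of 1] this] have "(\<lambda>k. (inverse (nn (g k)))\<^sup>2) \<longlonglongrightarrow> 0" by simp
  from tendsto_real_sqrt[OF this] have "(\<lambda>k. inverse (nn (g k))) \<longlonglongrightarrow> 0"
    using pos by (simp add: less_imp_le del: power_inverse)
  then have "filterlim (\<lambda>k. inverse (inverse (nn (g k)))) at_top sequentially"
    by (intro filterlim_inverse_at_top) (simp_all add: pos)
  then have "filterlim (\<lambda>k. nn (g k)) at_top sequentially" by simp
  from conv_exists[OF g this] obtain r \<xi> \<eta> where r: "strict_mono (r :: nat \<Rightarrow> nat)" and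
    n: "null_vec n \<xi>" "\<xi> n = 1" "null_vec n \<eta>"
    and cv: "conv (\<lambda>k. g (r k)) (\<lambda>k. 1 / nn (g (r k))) \<xi> \<eta>" by blast
  have eq: "\<xi> i = x $ i" if i: "i < n" for i
  proof (rule LIMSEQ_unique)
    show "(\<lambda>k. g (r k) $$ (i,n) * inverse (g (r k) $$ (n,n))) \<longlonglongrightarrow> x $ i"
      using LIMSEQ_subseq_LIMSEQ[OF lim'[OF i] r] by (simp add: o_def)
    define z where "z = - cj (\<eta> n)"
    have z: "z \<noteq> 0" using null_vec_norm(1)[OF n(3)] by (simp add: z_def)
    have "(\<lambda>k. ((1 / nn (g (r k))) *\<^sub>R (g (r k) $$ (i,n))) * inverse ((1 / nn (g (r k))) *\<^sub>R (g (r k) $$ (n,n))))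
       \<longlonglongrightarrow> (\<xi> i * z) * inverse z"
      using conv_entry[OF cv, of i n] conv_entry[OF cv, of n n] i n(2) z
      by (intro tendsto_mult tendsto_inverse) (simp_all add: z_def)
    moreover have "((1 / nn (g (r k))) *\<^sub>R (g (r k) $$ (i,n))) * inverse ((1 / nn (g (r k))) *\<^sub>R (g (r k) $$ (n,n)))
       = g (r k) $$ (i,n) * inverse (g (r k) $$ (n,n))" for k
      using pos[of "r k"] by (simp add: inverse_scaleR_distrib)
    ultimately show "(\<lambda>k. g (r k) $$ (i,n) * inverse (g (r k) $$ (n,n))) \<longlonglongrightarrow> \<xi> i"
      using z by (simp add: mult.assoc)
  qed
  have eq': "i \<le> n \<Longrightarrow> \<xi> i = (if i < n then x $ i else 1)" for i using eq n(2) by auto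
  have "hf n (\<lambda>i. if i < n then x $ i else 1) (\<lambda>i. if i < n then x $ i else 1) = hf n \<xi> \<xi>"
    by (intro hf_cong) (simp_all add: eq')
  with n have "null_vec n (\<lambda>i. if i < n then x $ i else 1)" by (intro null_vecI) (auto simp: null_vec_def)
  moreover have "conv (\<lambda>k. g (r k)) (\<lambda>k. 1 / nn (g (r k))) (\<lambda>i. if i < n then x $ i else 1) \<eta>"
    by (rule conv_cong[OF cv]) (simp_all add: eq')
  ultimately show ?thesis using n(3) unfolding limit_pt_def by blast
qed

lemma nonelementary_three_limits:
  assumes "nonelementary n G"
  shows three_limits
proof -
  have "\<exists>T. T \<subseteq> limit_set n G \<and> card T = 3"
  proof (cases "finite (limit_set n G)")
    case True
    with assms have "3 \<le> card (limit_set n G)" by (simp add: nonelementary_def)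
    then show ?thesis using obtain_subset_with_card_n by metis
  next
    case False
    then show ?thesis using infinite_arbitrarily_large by blast
  qed
  then obtain x y z where xyz: "x \<in> limit_set n G" "y \<in> limit_set n G" "z \<in> limit_set n G" "x \<noteq> y" "x \<noteq> z" "y \<noteq> z"
    by (auto simp: card_3_iff)
  have ne: "hf n (\<lambda>i. if i < n then x $ i else 1) (\<lambda>i. if i < n then y $ i else 1) \<noteq> 0"
    if x: "x \<in> limit_set n G" and y: "y \<in> limit_set n G" and "x \<noteq> y" for x y
  proof
    let ?x = "\<lambda>i. if i < n then x $ i else 1" and ?y = "\<lambda>i. if i < n then y $ i else 1"
    assume 0: "hf n ?x ?y = 0"
    have nv: "null_vec n ?x" "null_vec n ?y"
      using limit_set_limit_pt[OF x] limit_set_limit_pt[OF y] by (simp_all add: limit_pt_def)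
    have "x = y"
    proof (rule eq_vecI)
      show "dim_vec x = dim_vec y" using x y by (auto simp: limit_set_def)
      fix i assume "i < dim_vec y"
      then have "i < n" using y by (auto simp: limit_set_def)
      then show "x $ i = y $ i" using null_vec_orthogonal[OF nv 0, of i] by simp
    qed
    with \<open>x \<noteq> y\<close> show False ..
  qed
  show ?thesis unfolding three_limits_def
    by (intro exI conjI) (rule xyz(1-3)[THEN limit_set_limit_pt] ne[OF xyz(1,2,4)] ne[OF xyz(1,3,5)] ne[OF xyz(2,3,6)])+
qed

lemma fixes_line_multiplier:
  assumes \<theta>: "fixes_line \<theta>" and A: "A \<in> G"
  shows "\<exists>q. q \<noteq> 0 \<and> (\<forall>i\<le>n. app n A \<theta> i = \<theta> i * q)"
proof -
  have nv: "null_vec n \<theta>" "null_vec n (app n A \<theta>)" using \<theta> null_app[OF A] by (auto simp: fixes_line_def)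
  have "hf n \<theta> (app n A \<theta>) = 0" using \<theta> A by (simp add: fixes_line_def)
  then have "\<forall>i\<le>n. app n A \<theta> i = \<theta> i * (inverse (\<theta> n) * app n A \<theta> n)"
    by (blast intro: null_vec_orthogonal[OF nv])
  moreover have "inverse (\<theta> n) * app n A \<theta> n \<noteq> 0"
    using null_vec_norm(1)[OF nv(1)] null_vec_norm(1)[OF nv(2)] by simp
  ultimately show ?thesis by blast
qed

text \<open>Each \<open>g k\<close> keeps \<open>\<theta>\<close> on its line, but the limit map
  sends it to a multiple of \<open>\<zeta>\<close>. If these lines differ, \<open>\<theta>\<close>
  lies in the kernel of the limit: a fixed point that does not attract must repel.\<close>

lemma fixes_line_conv:
  assumes \<theta>: "fixes_line \<theta>" and g: "conv g c \<zeta> \<eta>" and \<zeta>: "hf n \<theta> \<zeta> \<noteq> 0"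
  shows "hf n \<eta> \<theta> = 0"
proof -
  have "(\<lambda>k. hf n \<theta> (\<lambda>i. c k *\<^sub>R app n (g k) \<theta> i)) \<longlonglongrightarrow> hf n \<theta> (\<lambda>i. \<zeta> i * hf n \<eta> \<theta>)"
    by (intro tendsto_hf tendsto_const conv_app[OF g])
  moreover have "hf n \<theta> (\<lambda>i. c k *\<^sub>R app n (g k) \<theta> i) = 0" for k
    using \<theta> conv_G[OF g, of k] by (simp add: hf_scaleR_right fixes_line_def)
  ultimately have "hf n \<theta> \<zeta> * hf n \<eta> \<theta> = 0"
    by (simp add: hf_mult_right LIMSEQ_const_iff)
  with \<zeta> show ?thesis by simp
qed

text \<open>The bound \<open>K\<close> says that the point \<open>v\<close> of hyperbolic space
  stays close to a ray towards the fixed point \<open>\<theta>\<close>. There \<open>h\<close> moves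
  \<open>v\<close> by a bounded amount: writing v = \<open>\<theta>\<close> x + u and expanding the
  pairing of \<open>v\<close> with \<open>h v\<close>, the large term in \<open>\<theta>\<close>,
  \<open>\<theta>\<close> vanishes and the three others are bounded through
  \<open>K\<close>.\<close>

lemma fixed_displacement_bound:
  assumes h: "h \<in> G" and \<theta>: "null_vec n \<theta>" "\<theta> n = 1"
    and l: "\<And>i. i \<le> n \<Longrightarrow> app n h \<theta> i = \<theta> i * l" and l': "\<And>i. i \<le> n \<Longrightarrow> app n (iv h) \<theta> i = \<theta> i * l'"
    and v: "hf n v v = - 1" and K: "norm (v n) * norm (hf n \<theta> v) \<le> K"
  shows "norm (hf n v (app n h v)) \<le> K * norm l + K * norm l' + (\<Sum>i\<le>n. \<Sum>j\<le>n. norm (h $$ (i,j)) * (2 * K))"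
proof -
  define x where "x = v n"
  \<comment> \<open>Removing the multiple of \<open>\<theta>\<close> that clears the last coordinate
    puts \<open>u\<close> where the form is the Euclidean one, so the value -1 at \<open>v\<close>
    bounds its length.\<close>
  define u where "u = (\<lambda>i. v i - \<theta> i * x)"
  have un: "u n = 0" by (simp add: u_def x_def \<theta>)
  have t0: "hf n \<theta> \<theta> = 0" using \<theta> by (simp add: null_vec_def)
  have tu: "hf n \<theta> u = hf n \<theta> v" by (simp add: u_def hf_diff_right hf_mult_right t0)
  have K0: "0 \<le> K" using K by (meson mult_nonneg_nonneg norm_ge_zero order_trans)
  define s where "s = (\<Sum>i<n. (norm (u i))\<^sup>2)"
  have "of_real s = hf n u u" by (simp add: hf_self s_def un)
  also have "\<dots> = - 1 - (hf n v \<theta> * x + cj x * hf n \<theta> v)"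
    by (simp add: u_def hf_diff_right hf_diff_left hf_mult_right hf_mult_left t0 v)
  finally have "of_real (s + 1) = - (hf n v \<theta> * x + cj x * hf n \<theta> v)" by simp
  then have "norm (of_real (s + 1) :: 'a) \<le> norm (hf n v \<theta> * x) + norm (cj x * hf n \<theta> v)"
    by (metis norm_minus_cancel norm_triangle_ineq)
  also have "norm (hf n v \<theta> * x) = norm x * norm (hf n \<theta> v)"
    by (metis norm_mult norm_cj cj_hf mult.commute)
  also have "norm (cj x * hf n \<theta> v) = norm x * norm (hf n \<theta> v)" by (simp add: norm_mult)
  finally have "s \<le> 2 * K" using K by (simp add: x_def)
  have ui: "(norm (u i))\<^sup>2 \<le> 2 * K" if "i \<le> n" for i
  proof (cases "i = n")
    case False
    then have "(norm (u i))\<^sup>2 \<le> s" unfolding s_def using that by (intro member_le_sum) auto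
    with \<open>s \<le> 2 * K\<close> show ?thesis by simp
  qed (simp add: un K0)
  have uu: "norm (u i) * norm (u j) \<le> 2 * K" if "i \<le> n" "j \<le> n" for i j
    using ui[OF that(1)] ui[OF that(2)] sum_squares_bound[of "norm (u i)" "norm (u j)"] by linarith
  have v_eq: "v = (\<lambda>i. \<theta> i * x + u i)" by (auto simp: u_def)
  have "hf n v (app n h v) = hf n (\<lambda>i. \<theta> i * x) (app n h (\<lambda>i. \<theta> i * x)) + hf n (\<lambda>i. \<theta> i * x) (app n h u)
     + hf n u (app n h (\<lambda>i. \<theta> i * x)) + hf n u (app n h u)"
    unfolding v_eq app_add hf_add_left hf_add_right by simp
  moreover have "hf n (\<lambda>i. \<theta> i * x) (app n h (\<lambda>i. \<theta> i * x)) = 0"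
  proof -
    have "hf n \<theta> (app n h \<theta>) = hf n \<theta> (\<lambda>i. \<theta> i * l)" by (intro hf_cong) (simp_all add: l)
    then show ?thesis by (simp add: app_mult_right hf_mult_right hf_mult_left t0)
  qed
  moreover have "norm (hf n (\<lambda>i. \<theta> i * x) (app n h u)) \<le> K * norm l'"
  proof -
    have "hf n \<theta> (app n h u) = hf n (\<lambda>i. \<theta> i * l') u"
      unfolding hf_app_right[OF h] by (intro hf_cong) (simp_all add: l')
    then have "norm (hf n (\<lambda>i. \<theta> i * x) (app n h u)) = (norm x * norm (hf n \<theta> v)) * norm l'"
      by (simp add: hf_mult_left norm_mult tu)
    also have "\<dots> \<le> K * norm l'" using K by (intro mult_right_mono) (simp_all add: x_def)
    finally show ?thesis .
  qed
  moreover have "norm (hf n u (app n h (\<lambda>i. \<theta> i * x))) \<le> K * norm l"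
  proof -
    have "hf n u (app n h \<theta>) = hf n u (\<lambda>i. \<theta> i * l)" by (intro hf_cong) (simp_all add: l)
    moreover have "norm (hf n u \<theta>) = norm (hf n \<theta> v)" by (metis cj_hf norm_cj tu)
    ultimately have "norm (hf n u (app n h (\<lambda>i. \<theta> i * x))) = (norm x * norm (hf n \<theta> v)) * norm l"
      by (simp add: app_mult_right hf_mult_right norm_mult)
    also have "\<dots> \<le> K * norm l" using K by (intro mult_right_mono) (simp_all add: x_def)
    finally show ?thesis .
  qed
  moreover have "norm (hf n u (app n h u)) \<le> (\<Sum>i\<le>n. \<Sum>j\<le>n. norm (h $$ (i,j)) * (2 * K))"
  proof -
    have "hf n u (app n h u) = (\<Sum>i\<le>n. \<Sum>j\<le>n. sg n i *\<^sub>R (cj (u i) * (h $$ (i,j) * u j)))"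
      unfolding hf_def by (rule sum.cong) (auto simp: app_def sum_distrib_left scaleR_sum_right)
    also have "norm \<dots> \<le> (\<Sum>i\<le>n. \<Sum>j\<le>n. norm (sg n i *\<^sub>R (cj (u i) * (h $$ (i,j) * u j))))"
      by (intro order_trans[OF norm_sum] sum_mono norm_sum)
    also have "\<dots> \<le> (\<Sum>i\<le>n. \<Sum>j\<le>n. norm (h $$ (i,j)) * (2 * K))"
    proof (intro sum_mono)
      fix i j assume "i \<in> {..n}" "j \<in> {..n}"
      then have "norm (h $$ (i,j)) * (norm (u i) * norm (u j)) \<le> norm (h $$ (i,j)) * (2 * K)"
        by (intro mult_left_mono uu) auto
      then show "norm (sg n i *\<^sub>R (cj (u i) * (h $$ (i,j) * u j))) \<le> norm (h $$ (i,j)) * (2 * K)"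
        by (simp add: norm_mult mult.left_commute)
    qed
    finally show ?thesis .
  qed
  ultimately show ?thesis
    by (smt (verit) norm_triangle_ineq add.left_neutral)
qed

text \<open>Conjugating by a sequence that repels from the fixed point keeps every group element in a
  bounded, hence finite, set. So each element commutes with infinitely many quotients of the
  sequence and shares their second fixed point, which confines the limit set to two points.\<close>

lemma three_limits_no_fixed_line:
  assumes three: three_limits
  shows "\<not> fixes_line \<theta>"
proof
  assume "fixes_line \<theta>"
  define t where "t = (\<lambda>i. \<theta> i * inverse (\<theta> n))"
  have t: "null_vec n t" "t n = 1"
    using null_vec_normalize[of n \<theta>] \<open>fixes_line \<theta>\<close> by (simp_all add: t_def fixes_line_def)
  have ft: "fixes_line t"
    using \<open>fixes_line \<theta>\<close> t by (simp add: fixes_line_def t_def app_mult_right hf_mult_left hf_mult_right)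
  have t0: "hf n t t = 0" using t by (simp add: null_vec_def)
  have tn: "hf n t (std n) = - 1" by (simp add: hf_std_right t)
  from three obtain z1 z2 z3 where z: "limit_pt z1" "limit_pt z2" "limit_pt z3"
    "hf n z1 z2 \<noteq> 0" "hf n z1 z3 \<noteq> 0" "hf n z2 z3 \<noteq> 0" unfolding three_limits_def by blast
  have zn: "null_vec n z1" "null_vec n z2" "null_vec n z3" using z by (simp_all add: limit_pt_def)
  \<comment> \<open>At most one of three distinct boundary points coincides with
    \<open>t\<close>.\<close>
  have "\<exists>a b. limit_pt a \<and> limit_pt b \<and> hf n a b \<noteq> 0 \<and> hf n t a \<noteq> 0 \<and> hf n t b \<noteq> 0"
  proof -
    have *: "hf n t a \<noteq> 0 \<or> hf n t b \<noteq> 0" if "null_vec n a" "null_vec n b" "hf n a b \<noteq> 0" for a b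
      using null_vec_orthogonal_trans[OF that(1) t(1) that(2)] that(3) hf_eq_0_commute[of n t a] by auto
    show ?thesis
      using *[OF zn(1,2) z(4)] *[OF zn(1,3) z(5)] *[OF zn(2,3) z(6)] z by blast
  qed
  then obtain z1 z2 where z: "limit_pt z1" "limit_pt z2" "hf n z1 z2 \<noteq> 0" "hf n t z1 \<noteq> 0" "hf n t z2 \<noteq> 0" by blast
  have "\<forall>A\<in>G. \<exists>q. q \<noteq> 0 \<and> (\<forall>i\<le>n. app n A t i = t i * q)" using fixes_line_multiplier[OF ft] by blast
  from bchoice[OF this] obtain lam where lam': "\<forall>A\<in>G. lam A \<noteq> 0 \<and> (\<forall>i\<le>n. app n A t i = t i * lam A)" by blast
  then have lam0: "\<And>A. A \<in> G \<Longrightarrow> lam A \<noteq> 0"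
    and lam: "\<And>A i. A \<in> G \<Longrightarrow> i \<le> n \<Longrightarrow> app n A t i = t i * lam A" by blast+
  have lam_iv: "lam (iv A) * lam A = 1" if A: "A \<in> G" for A
  proof -
    have "app n (iv A) (app n A t) n = app n (iv A) (\<lambda>i. t i * lam A) n"
      by (intro fun_cong[OF app_cong]) (simp add: lam A)
    then show ?thesis using A by (simp add: app_iv app_mult_right lam t)
  qed
  \<comment> \<open>This sequence attracts to \<open>z1\<close>, which is not \<open>t\<close>, so
    its repelling line is \<open>t\<close>. Shifting the scalar between the factors makes the second
    factor \<open>t\<close> itself and turns \<open>z1\<close> into \<open>p\<close>.\<close>
  from z(1) obtain a c th where th: "null_vec n th" and a0: "conv a c z1 th" by (auto simp: limit_pt_def)
  have "hf n t th = 0" using fixes_line_conv[OF ft a0 z(4)] by (simp add: hf_eq_0_commute[of n t])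
  note th_eq = null_vec_orthogonal[OF t(1) th this]
  define q where "q = inverse (t n) * th n"
  have q: "q \<noteq> 0" using null_vec_norm(1)[OF th] by (simp add: q_def t)
  define p where "p = (\<lambda>i. z1 i * cj q)"
  have p: "null_vec n p" unfolding p_def using z q by (intro null_vec_mult) (auto simp: limit_pt_def)
  have tp: "hf n t p \<noteq> 0" using z q by (simp add: p_def hf_mult_right)
  have "conv a c z1 (\<lambda>i. t i * q)" unfolding q_def by (rule conv_cong[OF a0 refl th_eq])
  then have a: "conv a c p t" unfolding p_def conv_move_scalar by simp
  have aG: "a k \<in> G" and cpos: "c k > 0" for k using conv_G[OF a] conv_pos[OF a] by auto
  have a': "conv (\<lambda>k. iv (a k)) c t p" by (rule conv_iv[OF a])
  \<comment> \<open>The inverses attract to \<open>t\<close>, so these images of the base point run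
    towards the fixed point.\<close>
  define v where "v k = app n (iv (a k)) (std n)" for k
  have "(\<lambda>k. c k *\<^sub>R v k n) \<longlonglongrightarrow> t n * hf n p (std n)"
    unfolding v_def by (intro conv_app[OF a']) auto
  then obtain K1 where K1: "\<And>k. norm (c k *\<^sub>R v k n) \<le> K1"
    using LIMSEQ_norm_bound by blast
  have "(\<lambda>k. c k *\<^sub>R app n (iv (a k)) t n) \<longlonglongrightarrow> t n * hf n p t"
    by (intro conv_app[OF a']) auto
  then have "(\<lambda>k. c k *\<^sub>R lam (iv (a k))) \<longlonglongrightarrow> hf n p t" by (simp add: lam aG t)
  then have "(\<lambda>k. inverse (c k *\<^sub>R lam (iv (a k)))) \<longlonglongrightarrow> inverse (hf n p t)"
    using tp hf_eq_0_commute by (intro tendsto_inverse) auto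
  then obtain K2 where K2: "\<And>k. norm (inverse (c k *\<^sub>R lam (iv (a k)))) \<le> K2"
    using LIMSEQ_norm_bound by blast
  \<comment> \<open>The rescaled multipliers of the inverses have the nonzero limit
    \<open>hf n p t\<close>, so \<open>a k\<close> multiplies \<open>t\<close> by a factor of order
    \<open>c k\<close>.\<close>
  have lam_le: "norm (lam (a k)) \<le> K2 * c k" for k
  proof -
    have "norm (lam (iv (a k))) * norm (lam (a k)) = 1"
      using lam_iv[OF aG, of k] by (metis norm_mult norm_one)
    then have "norm (lam (a k)) = inverse (norm (lam (iv (a k))))" by (metis inverse_unique)
    then have "norm (lam (a k)) = norm (inverse (c k *\<^sub>R lam (iv (a k)))) * c k"
      using cpos[of k] by (simp add: inverse_scaleR_distrib norm_inverse)
    with K2[of k] cpos[of k] show ?thesis by simp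
  qed
  have prodK: "norm (v k n) * norm (hf n t (v k)) \<le> K1 * K2" for k
  proof -
    have "hf n t (v k) = hf n (app n (a k) t) (std n)" by (simp add: v_def hf_app_left aG)
    also have "\<dots> = hf n (\<lambda>i. t i * lam (a k)) (std n)" by (intro hf_cong) (simp_all add: lam aG)
    also have "norm \<dots> = norm (lam (a k))" by (simp add: hf_mult_left tn)
    finally have "norm (v k n) * norm (hf n t (v k)) \<le> norm (v k n) * (K2 * c k)"
      using lam_le[of k] by (simp add: mult_left_mono)
    also have "\<dots> = norm (c k *\<^sub>R v k n) * K2" using cpos[of k] by simp
    also have "\<dots> \<le> K1 * K2" using K1[of k] order_trans[OF norm_ge_zero K2] by (intro mult_right_mono)
    finally show ?thesis .
  qed
  \<comment> \<open>The size of the conjugate is the pairing of \<open>v k\<close> with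
    \<open>h\<close> applied to \<open>v k\<close>, to which \<open>fixed_displacement_bound\<close>
    applies with the constant \<open>K1 * K2\<close>.\<close>
  have fin: "finite (range (\<lambda>k. a k * (h * iv (a k))))" if h: "h \<in> G" for h
  proof -
    define F where "F = K1 * K2 * norm (lam h) + K1 * K2 * norm (lam (iv h)) + (\<Sum>i\<le>n. \<Sum>j\<le>n. norm (h $$ (i,j)) * (2 * (K1 * K2)))"
    have "nn (a k * (h * iv (a k))) \<le> F" for k
    proof -
      have "hf n (v k) (app n h (v k)) = hf n (std n) (app n (a k * (h * iv (a k))) (std n))"
        using h aG[of k] by (simp add: v_def hf_app_left iv_iv app_mult_G)
      also have "\<dots> = - ((a k * (h * iv (a k))) $$ (n,n))" by (simp add: hf_std_left app_std)
      finally have "nn (a k * (h * iv (a k))) = norm (hf n (v k) (app n h (v k)))" by (simp add: nn_def)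
      also have "\<dots> \<le> F"
        unfolding F_def
      proof (rule fixed_displacement_bound[where v = "v k" and \<theta> = t and l = "lam h" and l' = "lam (iv h)", OF h t _ _ _ prodK])
        show "hf n (v k) (v k) = - 1" using aG by (simp add: v_def hf_std_left std_def)
      qed (simp_all add: lam h)
      finally show ?thesis .
    qed
    then show ?thesis using h aG by (intro finite_subset[OF _ finite_bounded[of F]]) auto
  qed
  \<comment> \<open>Two elements are treated together so that they share a second fixed line; by
    pigeonhole along one subsequence both conjugates are constant, and the quotients
    \<open>b k\<close> commute with both.\<close>
  have common: "\<exists>\<phi>. null_vec n \<phi> \<and> hf n t \<phi> \<noteq> 0 \<and> hf n \<phi> (app n h0 \<phi>) = 0 \<and> hf n \<phi> (app n h \<phi>) = 0"
    if h0: "h0 \<in> G" and h: "h \<in> G" for h0 h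
  proof -
    have "finite (range (\<lambda>k. (a k * (h0 * iv (a k)), a k * (h * iv (a k)))))"
      by (rule finite_subset[OF _ finite_cartesian_product[OF fin[OF h0] fin[OF h]]]) auto
    from finite_range_constant_subseq[OF this] obtain k0 and r :: "nat \<Rightarrow> nat" where r: "strict_mono r"
      and "\<forall>k. (a (r k) * (h0 * iv (a (r k))), a (r k) * (h * iv (a (r k)))) = (a k0 * (h0 * iv (a k0)), a k0 * (h * iv (a k0)))"
      by blast
    then have rk: "a (r k) * (x * iv (a (r k))) = a k0 * (x * iv (a k0))" if "x = h0 \<or> x = h" for k x
      using that by auto
    define b where "b k = iv (a k0) * a (r k)" for k
    have bG: "b k \<in> G" for k by (simp add: b_def aG)
    have comm: "b k * x = x * b k" if x: "x = h0 \<or> x = h" for k x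
    proof -
      have xG: "x \<in> G" using x h h0 by auto
      have "b k * x = iv (a k0) * ((a (r k) * (x * iv (a (r k)))) * a (r k))"
        using xG aG[of k0] aG[of "r k"] by (simp add: b_def assoc iv_left)
      also have "\<dots> = iv (a k0) * ((a k0 * (x * iv (a k0))) * a (r k))" by (simp only: rk[OF x])
      also have "\<dots> = x * b k" using xG aG[of k0] aG[of "r k"] by (simp add: b_def assoc)
      finally show ?thesis .
    qed
    define \<phi> where "\<phi> = app n (iv (a k0)) p"
    have b: "conv b (\<lambda>k. c (r k)) \<phi> t"
      unfolding b_def \<phi>_def by (intro conv_left[OF conv_subseq[OF a r]]) (simp add: aG)
    have \<phi>: "null_vec n \<phi>" unfolding \<phi>_def by (intro null_app p) (simp add: aG)
    have "hf n t \<phi> = hf n (app n (a k0) t) p" by (simp add: \<phi>_def hf_app_left aG)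
    also have "\<dots> = hf n (\<lambda>i. t i * lam (a k0)) p" by (intro hf_cong) (simp_all add: lam aG)
    finally have t\<phi>: "hf n t \<phi> \<noteq> 0" using tp lam0[OF aG] by (simp add: hf_mult_left)
    have "hf n \<phi> (app n x \<phi>) = 0" if x: "x = h0 \<or> x = h" for x
    proof -
      have xG: "x \<in> G" using x h h0 by auto
      \<comment> \<open>Comparing the limits of \<open>x * b k\<close> and \<open>b k * x\<close> at
        \<open>\<phi>\<close> shows that \<open>x\<close> preserves the attracting line
        \<open>\<phi>\<close> of the sequence \<open>b\<close>.\<close>
      have "app n x \<phi> i * hf n t \<phi> = \<phi> i * hf n t (app n x \<phi>)" if i: "i \<le> n" for i
      proof (rule LIMSEQ_unique)
        show "(\<lambda>k. c (r k) *\<^sub>R app n (x * b k) \<phi> i) \<longlonglongrightarrow> app n x \<phi> i * hf n t \<phi>"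
          by (intro conv_app[OF conv_left[OF b xG]] tendsto_const i)
        have "(\<lambda>k. c (r k) *\<^sub>R app n (b k) (app n x \<phi>) i) \<longlonglongrightarrow> \<phi> i * hf n t (app n x \<phi>)"
          by (intro conv_app[OF b] tendsto_const i)
        then show "(\<lambda>k. c (r k) *\<^sub>R app n (x * b k) \<phi> i) \<longlonglongrightarrow> \<phi> i * hf n t (app n x \<phi>)"
          by (simp only: comm[OF x, symmetric] app_mult_G[OF bG xG])
      qed
      then have "hf n \<phi> (\<lambda>i. app n x \<phi> i * hf n t \<phi>) = hf n \<phi> (\<lambda>i. \<phi> i * hf n t (app n x \<phi>))"
        by (intro hf_cong) simp_all
      with \<phi> t\<phi> show ?thesis by (simp add: hf_mult_right null_vec_def)
    qed
    with \<phi> t\<phi> show ?thesis by blast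
  qed
  have "(\<lambda>k. K2 * c k) \<longlonglongrightarrow> K2 * 0" by (intro tendsto_intros conv_0[OF a])
  then have "eventually (\<lambda>k. K2 * c k < 1) sequentially" by (intro order_tendstoD(2)) auto
  \<comment> \<open>Some \<open>a j\<close> contracts \<open>t\<close> strictly; this
    \<open>h0\<close> is loxodromic and its second fixed line is unique.\<close>
  then obtain j where "K2 * c j < 1" using eventually_happens'[OF sequentially_bot] by blast
  then have lj: "norm (lam (a j)) < 1" using lam_le[of j] by simp
  define h0 where "h0 = a j"
  have h0: "h0 \<in> G" by (simp add: h0_def aG)
  \<comment> \<open>The pairing of \<open>t\<close> and \<open>\<phi>\<close> is nonzero and
    invariant, so the two multipliers have norms with product 1.\<close>
  have multiplier: "\<exists>m. norm m > 1 \<and> (\<forall>i\<le>n. app n h0 \<phi> i = \<phi> i * m)"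
    if \<phi>: "null_vec n \<phi>" "hf n t \<phi> \<noteq> 0" "hf n \<phi> (app n h0 \<phi>) = 0" for \<phi>
  proof -
    define m where "m = inverse (\<phi> n) * app n h0 \<phi> n"
    have m: "app n h0 \<phi> i = \<phi> i * m" if "i \<le> n" for i
      using null_vec_orthogonal[OF \<phi>(1) null_app[OF h0 \<phi>(1)] \<phi>(3) that] by (simp add: m_def)
    have "hf n t \<phi> = hf n (app n h0 t) (app n h0 \<phi>)" by (simp add: h0)
    also have "\<dots> = hf n (\<lambda>i. t i * lam h0) (\<lambda>i. \<phi> i * m)" by (intro hf_cong) (simp_all add: lam h0 m)
    also have "\<dots> = cj (lam h0) * (hf n t \<phi> * m)" by (simp add: hf_mult_left hf_mult_right)
    finally have "norm (hf n t \<phi>) = norm (cj (lam h0) * (hf n t \<phi> * m))" by (rule arg_cong)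
    then have "norm (hf n t \<phi>) = norm (lam h0) * (norm (hf n t \<phi>) * norm m)"
      unfolding norm_mult norm_cj .
    then have "norm (hf n t \<phi>) * (norm (lam h0) * norm m) = norm (hf n t \<phi>) * 1" by (metis mult.left_commute mult.right_neutral)
    then have one: "norm (lam h0) * norm m = 1" using \<phi>(2) mult_left_cancel norm_eq_zero by blast
    have "norm m > 1"
    proof (rule ccontr)
      assume "\<not> norm m > 1"
      then have "norm (lam h0) * norm m \<le> norm (lam h0) * 1" by (intro mult_left_mono) auto
      with one lj show False by (simp add: h0_def)
    qed
    with m show ?thesis by blast
  qed
  obtain \<phi> where \<phi>: "null_vec n \<phi>" "hf n t \<phi> \<noteq> 0" "hf n \<phi> (app n h0 \<phi>) = 0" using common[OF h0 h0] by blast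
  from multiplier[OF \<phi>] obtain m where m': "norm m > 1 \<and> (\<forall>i\<le>n. app n h0 \<phi> i = \<phi> i * m)" ..
  then have m: "norm m > 1" "\<And>i. i \<le> n \<Longrightarrow> app n h0 \<phi> i = \<phi> i * m" by simp_all
  have "hf n \<phi> (app n h \<phi>) = 0" if h: "h \<in> G" for h
  proof -
    obtain \<psi> where \<psi>: "null_vec n \<psi>" "hf n t \<psi> \<noteq> 0" "hf n \<psi> (app n h0 \<psi>) = 0" "hf n \<psi> (app n h \<psi>) = 0"
      using common[OF h0 h] by blast
    from multiplier[OF \<psi>(1-3)] obtain m' where "norm m' > 1 \<and> (\<forall>i\<le>n. app n h0 \<psi> i = \<psi> i * m')" ..
    then have m': "norm m' > 1" "\<And>i. i \<le> n \<Longrightarrow> app n h0 \<psi> i = \<psi> i * m'" by simp_all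
    have "hf n \<psi> \<phi> = hf n (app n h0 \<psi>) (app n h0 \<phi>)" by (simp add: h0)
    also have "\<dots> = hf n (\<lambda>i. \<psi> i * m') (\<lambda>i. \<phi> i * m)" by (intro hf_cong) (simp_all add: m m')
    also have "\<dots> = cj m' * (hf n \<psi> \<phi> * m)" by (simp add: hf_mult_left hf_mult_right)
    finally have "norm (hf n \<psi> \<phi>) = norm (cj m' * (hf n \<psi> \<phi> * m))" by (rule arg_cong)
    then have e: "norm (hf n \<psi> \<phi>) = norm (hf n \<psi> \<phi>) * (norm m' * norm m)"
      unfolding norm_mult norm_cj by (metis mult.left_commute)
    have "1 * 1 < norm m' * norm m" using m(1) m'(1) by (intro mult_strict_mono) auto
    \<comment> \<open>Both lines are expanded by \<open>h0\<close>, so an invariant nonzero pairing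
      between them would be multiplied by a factor of norm greater than 1.\<close>
    have "hf n \<psi> \<phi> = 0"
    proof (rule ccontr)
      assume "hf n \<psi> \<phi> \<noteq> 0"
      then have "norm (hf n \<psi> \<phi>) * (1 * 1) < norm (hf n \<psi> \<phi>) * (norm m' * norm m)"
        using \<open>1 * 1 < norm m' * norm m\<close> by (intro mult_strict_left_mono) auto
      with e show False by linarith
    qed
    note orth = null_vec_orthogonal[OF \<psi>(1) \<phi>(1) this]
    have "\<exists>q. \<forall>i\<le>n. \<phi> i = \<psi> i * q"
      by (intro exI allI impI) (rule orth)
    then obtain q where "\<forall>i\<le>n. \<phi> i = \<psi> i * q" ..
    then have eq: "\<phi> i = \<psi> i * q" if "i \<le> n" for i using that by simp
    have c: "app n h \<phi> = (\<lambda>i. app n h \<psi> i * q)"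
      unfolding app_mult_right[symmetric] by (rule app_cong) (rule eq)
    have "hf n \<phi> (app n h \<phi>) = hf n (\<lambda>i. \<psi> i * q) (\<lambda>i. app n h \<psi> i * q)"
      by (subst c) (rule hf_cong, erule eq, rule refl)
    also have "\<dots> = 0" unfolding hf_mult_left hf_mult_right \<psi>(4) by simp
    finally show ?thesis .
  qed
  then have f\<phi>: "fixes_line \<phi>" using \<phi> by (simp add: fixes_line_def)
  \<comment> \<open>A limit point off both fixed lines would have a repelling line equal to both
    \<open>t\<close> and \<open>\<phi>\<close>, which are different.\<close>
  have only: "hf n \<phi> z = 0" if "limit_pt z" "hf n t z \<noteq> 0" for z
  proof (rule ccontr)
    assume "hf n \<phi> z \<noteq> 0"
    obtain g d e where e: "null_vec n e" and g: "conv g d z e" using \<open>limit_pt z\<close> by (auto simp: limit_pt_def)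
    have "hf n e t = 0" "hf n e \<phi> = 0"
      using fixes_line_conv[OF ft g that(2)] fixes_line_conv[OF f\<phi> g \<open>hf n \<phi> z \<noteq> 0\<close>] by auto
    then have "hf n t \<phi> = 0" by (intro null_vec_orthogonal_trans[OF t(1) e \<phi>(1)] hf_0_sym[of n e t])
    with \<phi>(2) show False by simp
  qed
  have zn: "null_vec n z1" "null_vec n z2" using z(1,2) by (simp_all add: limit_pt_def)
  have "hf n z1 z2 = 0"
    by (rule null_vec_orthogonal_trans[OF zn(1) \<phi>(1) zn(2) hf_0_sym[OF only[OF z(1,4)]] only[OF z(2,5)]])
  with z show False by simp
qed

end

section \<open>Free semigroups generated by commutators\<close>

lemma null_vec_not_both:
  assumes "null_vec n a" "null_vec n b" "hf n a b \<noteq> 0" "null_vec n x"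
  shows "hf n x a \<noteq> 0 \<or> hf n x b \<noteq> 0"
proof (rule ccontr)
  assume "\<not> ?thesis"
  then have "hf n x a = 0" "hf n x b = 0" by simp_all
  from null_vec_orthogonal_trans[OF assms(1,4,2) hf_0_sym[OF this(1)] this(2)] assms(3)
  show False by simp
qed

text \<open>A projective neighbourhood in the chart of last coordinate 1; by
  \<open>near_scale\<close> it depends only on the line of \<open>w\<close>.\<close>

definition near :: "nat \<Rightarrow> real \<Rightarrow> (nat \<Rightarrow> 'a) \<Rightarrow> (nat \<Rightarrow> 'a::hyp_scalar) \<Rightarrow> bool" where
  "near n \<delta> x w \<longleftrightarrow> w n \<noteq> 0 \<and> (\<forall>i\<le>n. norm (w i * inverse (w n) - x i) < \<delta>)"

lemma near_scale:
  assumes "q \<noteq> 0"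
  shows "near n \<delta> x (\<lambda>i. w i * q) \<longleftrightarrow> near n \<delta> x w"
proof -
  have "(w i * q) * inverse (w n * q) = w i * inverse (w n)" if "w n \<noteq> 0" for i
    using that assms by (simp add: nonzero_inverse_mult_distrib mult.assoc) (simp add: mult.assoc[symmetric])
  then show ?thesis using assms by (auto simp: near_def)
qed

lemma near_mono: "near n \<delta> x w \<Longrightarrow> \<delta> \<le> \<delta>' \<Longrightarrow> near n \<delta>' x w"
  by (force simp: near_def)

lemma near_refl: "x n = 1 \<Longrightarrow> 0 < \<delta> \<Longrightarrow> near n \<delta> x x"
  by (simp add: near_def)

lemma near_disjoint:
  assumes "i \<le> n" "\<delta> \<le> norm (x i - y i) / 2" "near n \<delta> x w" "near n \<delta> y w"
  shows False
proof -
  have "norm (w i * inverse (w n) - x i) < \<delta>" "norm (w i * inverse (w n) - y i) < \<delta>"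
    using assms by (auto simp: near_def)
  moreover have "norm (x i - y i) \<le> norm (w i * inverse (w n) - x i) + norm (w i * inverse (w n) - y i)"
    using norm_triangle_ineq4[of "w i * inverse (w n) - y i" "w i * inverse (w n) - x i"] by simp
  ultimately show False using assms(2) by linarith
qed

context hyp_group
begin

lemma conv_normalize:
  assumes "conv g c \<xi> \<eta>" "\<xi> n \<noteq> 0"
  shows "conv g c (\<lambda>i. \<xi> i * inverse (\<xi> n)) (\<lambda>i. \<eta> i * cj (\<xi> n))"
proof -
  have "conv g c (\<lambda>i. (\<xi> i * inverse (\<xi> n)) * \<xi> n) \<eta>"
    by (rule conv_cong[OF assms(1)]) (simp_all add: assms(2) mult.assoc)
  then show ?thesis by (simp only: conv_move_scalar)
qed

text \<open>Attraction is uniform near any \<open>x\<close> outside the kernel of the limit. The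
  source radius \<open>\<delta>0\<close> is fixed before the target radius \<open>\<delta>\<close>,
  so ping-pong can shrink the target below all source radii.\<close>

lemma conv_attracts:
  assumes cv: "conv a c \<xi> \<eta>" and "\<xi> n = 1" and x: "hf n \<eta> x \<noteq> 0"
  shows "\<exists>\<delta>0>0. \<forall>\<delta>>0. \<forall>\<^sub>F k in sequentially. \<forall>w. near n \<delta>0 x w \<longrightarrow> near n \<delta> \<xi> (app n (a k) w)"
proof -
  \<comment> \<open>A small ball around \<open>x\<close> avoids the hyperplane orthogonal to
    \<open>\<eta>\<close>, which the limit map sends to 0.\<close>
  have "\<exists>\<delta>0>0. \<forall>w. (\<forall>i\<le>n. norm (w i - x i) \<le> \<delta>0) \<longrightarrow> hf n \<eta> w \<noteq> 0"
  proof (rule ccontr)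
    assume "\<not> ?thesis"
    then have "\<forall>m. \<exists>w. (\<forall>i\<le>n. norm (w i - x i) \<le> inverse (real (Suc m))) \<and> hf n \<eta> w = 0"
      by (metis inverse_positive_iff_positive of_nat_0_less_iff zero_less_Suc)
    from choice[OF this] obtain W where W: "\<forall>m. (\<forall>i\<le>n. norm (W m i - x i) \<le> inverse (real (Suc m))) \<and> hf n \<eta> (W m) = 0" ..
    have "(\<lambda>m. hf n \<eta> (W m)) \<longlonglongrightarrow> hf n \<eta> x"
    proof (rule tendsto_hf[OF tendsto_const])
      fix i assume "i \<le> n"
      then have "(\<lambda>m. W m i - x i) \<longlonglongrightarrow> 0"
        using W by (intro Lim_null_comparison[OF always_eventually LIMSEQ_inverse_real_of_nat]) auto
      then show "(\<lambda>m. W m i) \<longlonglongrightarrow> x i" by (simp only: Lim_null[symmetric])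
    qed
    with W x show False by (simp add: LIMSEQ_const_iff)
  qed
  then obtain \<delta>0 where \<delta>0: "\<delta>0 > 0" and nz: "\<And>w. (\<And>i. i \<le> n \<Longrightarrow> norm (w i - x i) \<le> \<delta>0) \<Longrightarrow> hf n \<eta> w \<noteq> 0"
    by blast
  have "\<forall>\<^sub>F k in sequentially. \<forall>w. near n \<delta>0 x w \<longrightarrow> near n \<delta> \<xi> (app n (a k) w)" if \<delta>: "\<delta> > 0" for \<delta>
  proof (rule ccontr)
    assume "\<not> ?thesis"
    then obtain r where r: "strict_mono (r :: nat \<Rightarrow> nat)"
      and bad: "\<forall>k. \<not> (\<forall>w. near n \<delta>0 x w \<longrightarrow> near n \<delta> \<xi> (app n (a (r k)) w))"
      using not_eventually_sequentiallyD by blast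
    from bad have "\<forall>k. \<exists>w. near n \<delta>0 x w \<and> \<not> near n \<delta> \<xi> (app n (a (r k)) w)" by blast
    from choice[OF this] obtain W where W: "\<forall>k. near n \<delta>0 x (W k) \<and> \<not> near n \<delta> \<xi> (app n (a (r k)) (W k))" ..
    \<comment> \<open>Counterexamples scaled to last coordinate 1 subconverge to some
      \<open>l\<close> in the ball; \<open>conv_app\<close> with these varying vectors sends their
      images to the line of \<open>\<xi>\<close> after all.\<close>
    define V where "V = (\<lambda>k i. W k i * inverse (W k n))"
    have V: "norm (V k i - x i) < \<delta>0" if "i \<le> n" for k i
      using W that by (auto simp: near_def V_def)
    have "bounded (range (\<lambda>k. V k i))" if "i \<in> {..n}" for i
    proof (rule boundedI[of _ "norm (x i) + \<delta>0"])
      fix y assume "y \<in> range (\<lambda>k. V k i)"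
      then obtain k where "y = V k i" by auto
      then show "norm y \<le> norm (x i) + \<delta>0"
        using V[of i k] that norm_triangle_sub[of "V k i" "x i"] by simp
    qed
    then obtain s l where s: "strict_mono (s :: nat \<Rightarrow> nat)" and l: "\<forall>i\<in>{..n}. (\<lambda>k. V (s k) i) \<longlonglongrightarrow> l i"
      using finite_index_subseq[of "{..n}" V] by blast
    have "norm (l i - x i) \<le> \<delta>0" if "i \<le> n" for i
    proof (rule LIMSEQ_le_const2)
      show "(\<lambda>k. norm (V (s k) i - x i)) \<longlonglongrightarrow> norm (l i - x i)"
        using l that by (intro tendsto_norm tendsto_diff tendsto_const) auto
      show "\<exists>N. \<forall>k\<ge>N. norm (V (s k) i - x i) \<le> \<delta>0" using V[OF that] by (auto intro: less_imp_le)
    qed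
    then have hl: "hf n \<eta> l \<noteq> 0" by (rule nz)
    define Y where "Y k i = c (r (s k)) *\<^sub>R app n (a (r (s k))) (V (s k)) i" for k i
    have Y: "(\<lambda>k. Y k i) \<longlonglongrightarrow> \<xi> i * hf n \<eta> l" if "i \<le> n" for i
      unfolding Y_def using l that by (intro conv_app[OF conv_subseq[OF conv_subseq[OF cv r] s]]) auto
    have Yn: "(\<lambda>k. Y k n) \<longlonglongrightarrow> hf n \<eta> l" using Y[of n] assms(2) by simp
    have "(\<lambda>k. Y k i * inverse (Y k n)) \<longlonglongrightarrow> \<xi> i" if "i \<le> n" for i
      using tendsto_mult[OF Y[OF that] tendsto_inverse[OF Yn hl]] hl by (simp add: mult.assoc)
    then have "\<forall>i\<in>{..n}. \<forall>\<^sub>F k in sequentially. norm (Y k i * inverse (Y k n) - \<xi> i) < \<delta>"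
      using \<delta> by (auto simp: dist_norm[symmetric] dest: tendstoD)
    then have "\<forall>\<^sub>F k in sequentially. \<forall>i\<in>{..n}. norm (Y k i * inverse (Y k n) - \<xi> i) < \<delta>"
      by (simp add: eventually_ball_finite)
    from eventually_conj[OF this tendsto_imp_eventually_ne[OF Yn hl]]
    obtain k where k: "\<forall>i\<in>{..n}. norm (Y k i * inverse (Y k n) - \<xi> i) < \<delta>" "Y k n \<noteq> 0"
      using eventually_happens'[OF sequentially_bot] by blast
    define q where "q = c (r (s k)) *\<^sub>R inverse (W (s k) n)"
    have "Y k = (\<lambda>i. app n (a (r (s k))) (W (s k)) i * q)"
      by (rule ext) (simp add: Y_def V_def app_mult_right q_def)
    moreover have "near n \<delta> \<xi> (Y k)" using k by (simp add: near_def)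
    moreover have "W (s k) n \<noteq> 0" using W by (simp add: near_def)
    then have "q \<noteq> 0" using conv_pos[OF cv, of "r (s k)"] by (simp add: q_def)
    ultimately have "near n \<delta> \<xi> (app n (a (r (s k))) (W (s k)))" by (simp add: near_scale)
    with W show False by blast
  qed
  with \<delta>0 show ?thesis by blast
qed

text \<open>Neither kernel contains either attracting line, so for large \<open>k\<close> both
  matrices attract small balls around both attracting points: \<open>a k\<close> sends them into the
  first ball and \<open>b k\<close> into the second. No inverses enter, which is enough for a
  semigroup.\<close>

lemma ping_pong:
  assumes a: "conv a c \<xi> \<eta>" and b: "conv b d \<xi>' \<eta>'"
    and nv: "null_vec n \<xi>" "null_vec n \<xi>'" and ne: "hf n \<xi> \<xi>' \<noteq> 0"
    and h: "hf n \<eta> \<xi> \<noteq> 0" "hf n \<eta> \<xi>' \<noteq> 0" "hf n \<eta>' \<xi> \<noteq> 0" "hf n \<eta>' \<xi>' \<noteq> 0"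
  shows "\<exists>k P Q v. P \<inter> Q = {} \<and> v \<in> P \<and> (\<forall>w\<in>P \<union> Q. app n (a k) w \<in> P \<and> app n (b k) w \<in> Q)"
proof -
  define x y where "x = (\<lambda>i. \<xi> i * inverse (\<xi> n))" and "y = (\<lambda>i. \<xi>' i * inverse (\<xi>' n))"
  have nz: "\<xi> n \<noteq> 0" "\<xi>' n \<noteq> 0" using nv null_vec_norm(1) by blast+
  have x: "x n = 1" "y n = 1" using nz by (simp_all add: x_def y_def)
  define e f where "e = (\<lambda>i. \<eta> i * cj (\<xi> n))" and "f = (\<lambda>i. \<eta>' i * cj (\<xi>' n))"
  have a': "conv a c x e" unfolding x_def e_def by (rule conv_normalize[OF a nz(1)])
  have b': "conv b d y f" unfolding y_def f_def by (rule conv_normalize[OF b nz(2)])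
  have hh: "hf n e x \<noteq> 0" "hf n e y \<noteq> 0" "hf n f x \<noteq> 0" "hf n f y \<noteq> 0"
    using h nz by (simp_all add: x_def y_def e_def f_def hf_mult_left hf_mult_right)
  have "\<exists>i\<le>n. x i \<noteq> y i"
  proof (rule ccontr)
    assume "\<not> ?thesis"
    then have "hf n x y = hf n x x" by (intro hf_cong) auto
    then show False using nv ne nz by (simp add: x_def y_def hf_mult_left hf_mult_right null_vec_def)
  qed
  then obtain i where i: "i \<le> n" "x i \<noteq> y i" by blast
  define A where "A \<delta>0 u v g \<longleftrightarrow> (\<forall>\<delta>>0. \<forall>\<^sub>F k in sequentially. \<forall>w. near n \<delta>0 u w \<longrightarrow> near n \<delta> v (app n (g k) w))"
    for \<delta>0 u v and g :: "nat \<Rightarrow> 'a mat"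
  have "\<exists>d>0. A d x x a" unfolding A_def by (rule conv_attracts[OF a' x(1) hh(1)])
  then obtain d1 where d1: "d1 > 0" "A d1 x x a" by blast
  have "\<exists>d>0. A d y x a" unfolding A_def by (rule conv_attracts[OF a' x(1) hh(2)])
  then obtain d2 where d2: "d2 > 0" "A d2 y x a" by blast
  have "\<exists>d>0. A d x y b" unfolding A_def by (rule conv_attracts[OF b' x(2) hh(3)])
  then obtain d3 where d3: "d3 > 0" "A d3 x y b" by blast
  have "\<exists>d>0. A d y y b" unfolding A_def by (rule conv_attracts[OF b' x(2) hh(4)])
  then obtain d4 where d4: "d4 > 0" "A d4 y y b" by blast
  note d = d1 d2 d3 d4
  \<comment> \<open>Below every source radius, and at most half the distance in one coordinate where
    the centres differ, which makes the balls disjoint.\<close>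
  define \<delta> where "\<delta> = Min {d1, d2, d3, d4, norm (x i - y i) / 2}"
  have \<delta>: "\<delta> > 0" "\<delta> \<le> d1" "\<delta> \<le> d2" "\<delta> \<le> d3" "\<delta> \<le> d4" "\<delta> \<le> norm (x i - y i) / 2"
    using d i by (simp_all add: \<delta>_def)
  have "\<forall>\<^sub>F k in sequentially. (\<forall>w. near n d1 x w \<longrightarrow> near n \<delta> x (app n (a k) w)) \<and>
      (\<forall>w. near n d2 y w \<longrightarrow> near n \<delta> x (app n (a k) w)) \<and>
      (\<forall>w. near n d3 x w \<longrightarrow> near n \<delta> y (app n (b k) w)) \<and>
      (\<forall>w. near n d4 y w \<longrightarrow> near n \<delta> y (app n (b k) w))"
    using d \<delta>(1) unfolding A_def by (intro eventually_conj) blast+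
  then obtain k where k: "\<And>w. near n d1 x w \<Longrightarrow> near n \<delta> x (app n (a k) w)"
      "\<And>w. near n d2 y w \<Longrightarrow> near n \<delta> x (app n (a k) w)"
      "\<And>w. near n d3 x w \<Longrightarrow> near n \<delta> y (app n (b k) w)"
      "\<And>w. near n d4 y w \<Longrightarrow> near n \<delta> y (app n (b k) w)"
    using eventually_happens'[OF sequentially_bot] by blast
  define P Q where "P = {w. near n \<delta> x w}" and "Q = {w. near n \<delta> y w}"
  have "P \<inter> Q = {}" using near_disjoint[where x = x and y = y, OF i(1) \<delta>(6)] by (auto simp: P_def Q_def)
  moreover have "x \<in> P" using near_refl[where x = x, OF x(1) \<delta>(1)] by (simp add: P_def)
  moreover have "app n (a k) w \<in> P \<and> app n (b k) w \<in> Q" if "w \<in> P \<union> Q" for w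
    using that unfolding P_def Q_def
  proof (elim UnE CollectE)
    assume "near n \<delta> x w"
    then have "near n d1 x w" "near n d3 x w" using near_mono \<delta> by blast+
    then show "app n (a k) w \<in> {w. near n \<delta> x w} \<and> app n (b k) w \<in> {w. near n \<delta> y w}"
      using k(1,3) by simp
  next
    assume "near n \<delta> y w"
    then have "near n d2 y w" "near n d4 y w" using near_mono \<delta> by blast+
    then show "app n (a k) w \<in> {w. near n \<delta> x w} \<and> app n (b k) w \<in> {w. near n \<delta> y w}"
      using k(2,4) by simp
  qed
  ultimately show ?thesis by blast
qed

lemma word_in [simp]: "A \<in> G \<Longrightarrow> B \<in> G \<Longrightarrow> word (Suc n) A B w \<in> G"
  by (induction w) auto

text \<open>The first letter of a nonempty word is visible in the position of the image of
  \<open>v\<close>, in \<open>P\<close> or in \<open>Q\<close>; cancel it and continue. Words of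
  equal length run out together, so the empty word is never compared with a longer one.\<close>

lemma ping_pong_word_inj:
  assumes AB: "A \<in> G" "B \<in> G" and PQ: "P \<inter> Q = {}" and v: "v \<in> P"
    and pp: "\<And>w. w \<in> P \<union> Q \<Longrightarrow> app n A w \<in> P \<and> app n B w \<in> Q"
  shows "inj_on (word (Suc n) A B) {w. length w = m}"
proof -
  have act: "app n (word (Suc n) A B (x # w)) v \<in> (if x then P else Q)" for x w
  proof (induction w arbitrary: x)
    case Nil
    have "app n (word (Suc n) A B [x]) v = app n (if x then A else B) (app n (1\<^sub>m (Suc n)) v)"
      unfolding word.simps by (rule app_mult_G) (use AB in auto)
    also have "\<dots> = app n (if x then A else B) v" by (rule app_cong) (simp add: app_one)
    finally show ?case using pp[of v] v by simp
  next
    case (Cons y w)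
    have "app n (word (Suc n) A B (x # y # w)) v = app n (if x then A else B) (app n (word (Suc n) A B (y # w)) v)"
      using AB by (subst word.simps(2), subst app_mult_G) (auto simp del: word.simps)
    moreover have "app n (word (Suc n) A B (y # w)) v \<in> P \<union> Q" using Cons[of y] by (auto simp del: word.simps split: if_splits)
    ultimately show ?case using pp by (simp del: word.simps)
  qed
  have "word (Suc n) A B w = word (Suc n) A B w' \<Longrightarrow> w = w'" if "length w = length w'" for w w'
    using that
  proof (induction w w' rule: list_induct2)
    case (Cons x w y w')
    have "x = y"
    proof (rule ccontr)
      assume "x \<noteq> y"
      then show False using act[of x w] act[of y w'] Cons.prems PQ
        by (cases x; cases y) (auto simp del: word.simps)
    qed
    with Cons.prems have "word (Suc n) A B w = word (Suc n) A B w'"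
      using left_cancel[of "if x then A else B"] AB by simp
    with Cons.IH \<open>x = y\<close> show ?case by simp
  qed simp
  then show ?thesis by (auto intro!: inj_onI)
qed

text \<open>Prepares the commutators: a sequence \<open>g\<close> with distinct attracting and
  repelling lines, and a sequence \<open>h\<close> for which the two coincide in a third line
  \<open>\<zeta>\<close>.\<close>

lemma limit_pairs:
  assumes three: three_limits
  shows "\<exists>\<xi> \<eta> \<zeta> g c h d q. null_vec n \<xi> \<and> null_vec n \<eta> \<and> null_vec n \<zeta> \<and> q \<noteq> 0 \<and> conv g c \<xi> \<eta> \<and>
    conv h d (\<lambda>i. \<zeta> i * q) \<zeta> \<and> hf n \<xi> \<eta> \<noteq> 0 \<and> hf n \<xi> \<zeta> \<noteq> 0 \<and> hf n \<eta> \<zeta> \<noteq> 0"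
proof -
  have move: "\<exists>A\<in>G. hf n x (app n A x) \<noteq> 0" if "null_vec n x" for x
    using three_limits_no_fixed_line[OF three, of x] that by (auto simp: fixes_line_def)
  from three obtain z1 z2 z3 where z: "limit_pt z1" "limit_pt z2" "limit_pt z3"
    "hf n z1 z2 \<noteq> 0" "hf n z1 z3 \<noteq> 0" "hf n z2 z3 \<noteq> 0" unfolding three_limits_def by blast
  have zn: "null_vec n z1" "null_vec n z2" "null_vec n z3" using z by (simp_all add: limit_pt_def)
  have "\<exists>\<xi> \<eta> g c. null_vec n \<xi> \<and> null_vec n \<eta> \<and> conv g c \<xi> \<eta> \<and> hf n \<xi> \<eta> \<noteq> 0"
  proof -
    from z(1) obtain g c \<eta> where \<eta>: "null_vec n \<eta>" and g: "conv g c z1 \<eta>" by (auto simp: limit_pt_def)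
    show ?thesis
    proof (cases "hf n z1 \<eta> = 0")
      case True
      \<comment> \<open>If the attracting and repelling lines coincide, a translation that moves the
        attracting one separates them.\<close>
      obtain A where A: "A \<in> G" "hf n z1 (app n A z1) \<noteq> 0" using move[OF zn(1)] by blast
      have nA: "null_vec n (app n A z1)" by (rule null_app[OF A(1) zn(1)])
      have "hf n (app n A z1) \<eta> \<noteq> 0"
        using null_vec_not_both[OF zn(1) nA A(2) \<eta>] hf_0_sym[OF True] hf_0_sym by blast
      with nA \<eta> conv_left[OF g A(1)] show ?thesis by blast
    qed (use zn \<eta> g in blast)
  qed
  then obtain \<xi> \<eta> g c where 1: "null_vec n \<xi>" "null_vec n \<eta>" "conv g c \<xi> \<eta>" "hf n \<xi> \<eta> \<noteq> 0" by blast
  \<comment> \<open>Each of \<open>\<xi>\<close> and \<open>\<eta>\<close> agrees with at most one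
    of the three limit points, so one is left over.\<close>
  have "hf n \<xi> z1 \<noteq> 0 \<and> hf n \<eta> z1 \<noteq> 0 \<or> hf n \<xi> z2 \<noteq> 0 \<and> hf n \<eta> z2 \<noteq> 0 \<or> hf n \<xi> z3 \<noteq> 0 \<and> hf n \<eta> z3 \<noteq> 0"
    using null_vec_not_both[OF zn(1,2) z(4) 1(1)] null_vec_not_both[OF zn(1,3) z(5) 1(1)] null_vec_not_both[OF zn(2,3) z(6) 1(1)]
      null_vec_not_both[OF zn(1,2) z(4) 1(2)] null_vec_not_both[OF zn(1,3) z(5) 1(2)] null_vec_not_both[OF zn(2,3) z(6) 1(2)]
    by blast
  then obtain \<zeta> where 2: "limit_pt \<zeta>" "hf n \<xi> \<zeta> \<noteq> 0" "hf n \<eta> \<zeta> \<noteq> 0"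
    using z(1-3) by (elim disjE conjE) simp_all
  from 2(1) obtain h d \<theta> where \<theta>: "null_vec n \<theta>" and h: "conv h d \<zeta> \<theta>" and \<zeta>: "null_vec n \<zeta>"
    by (auto simp: limit_pt_def)
  obtain A where A: "A \<in> G" "hf n \<theta> (app n A \<theta>) \<noteq> 0" using move[OF \<theta>] by blast
  \<comment> \<open>Conjugating \<open>A\<close> by \<open>h k\<close> makes the attracting line of
    \<open>h\<close> both attracting and repelling; the scalar between the factors is nonzero
    because \<open>A\<close> moves \<open>\<theta>\<close>.\<close>
  have "conv (\<lambda>k. h k * (A * iv (h k))) (\<lambda>k. d k * d k) (\<lambda>i. \<zeta> i * hf n \<theta> (app n A \<theta>)) \<zeta>"
    by (rule conv_mult[OF h conv_left[OF conv_iv[OF h] A(1)]])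
  with 1 2 \<zeta> A(2) show ?thesis by blast
qed

text \<open>The commutators of g, h and of their inverses have the limits \<open>\<xi>\<close> ...
  \<open>\<zeta>\<close>* J and \<open>\<eta>\<close> ... \<open>\<zeta>\<close>* J up to nonzero
  scalars: they attract to different lines and repel from the same third one, so ping-pong
  applies.\<close>

lemma free_commutators:
  assumes three: three_limits
  shows "\<exists>g\<in>G. \<exists>h\<in>G. \<forall>m. inj_on (word (Suc n) ((g * h) * (iv g * iv h)) ((iv g * iv h) * (g * h))) {w. length w = m}"
proof -
  obtain \<xi> \<eta> \<zeta> g c h d q where nv: "null_vec n \<xi>" "null_vec n \<eta>" "null_vec n \<zeta>" and q: "q \<noteq> 0"
    and g: "conv g c \<xi> \<eta>" and h: "conv h d (\<lambda>i. \<zeta> i * q) \<zeta>"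
    and ne: "hf n \<xi> \<eta> \<noteq> 0" "hf n \<xi> \<zeta> \<noteq> 0" "hf n \<eta> \<zeta> \<noteq> 0"
    using limit_pairs[OF three] by blast
  have ne': "hf n \<zeta> \<xi> \<noteq> 0" "hf n \<zeta> \<eta> \<noteq> 0" using ne hf_0_sym by blast+
  note gh = conv_mult[OF g h] and gh' = conv_mult[OF conv_iv[OF g] conv_iv[OF h]]
  have "\<exists>k P Q v. P \<inter> Q = {} \<and> v \<in> P \<and> (\<forall>w\<in>P \<union> Q. app n (g k * h k * (iv (g k) * iv (h k))) w \<in> P \<and>
      app n (iv (g k) * iv (h k) * (g k * h k)) w \<in> Q)"
    by (rule ping_pong[OF conv_mult[OF gh gh'] conv_mult[OF gh' gh]])
      (use q ne ne' nv in \<open>auto simp: hf_mult_left hf_mult_right mult.assoc intro!: null_vec_mult\<close>)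
  then obtain k P Q v where pp: "P \<inter> Q = {}" "v \<in> P"
    "\<And>w. w \<in> P \<union> Q \<Longrightarrow> app n (g k * h k * (iv (g k) * iv (h k))) w \<in> P \<and> app n (iv (g k) * iv (h k) * (g k * h k)) w \<in> Q"
    by blast
  have gk: "g k \<in> G" "h k \<in> G" using conv_G[OF g] conv_G[OF h] by auto
  then have "inj_on (word (Suc n) (g k * h k * (iv (g k) * iv (h k))) (iv (g k) * iv (h k) * (g k * h k))) {w. length w = m}" for m
    by (intro ping_pong_word_inj[OF _ _ pp]) auto
  with gk show ?thesis by blast
qed

end

section \<open>Polynomial growth of parabolic subgroups\<close>

text \<open>The exponent 4 comes from a quadratic bound on the size of words of length m, squared by
  the counting bound.\<close>

lemma exp_beats_polynomial: "\<exists>m::nat. (c * (real m + 1) ^ 4) ^ D < 2 ^ m"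
proof -
  have "((\<lambda>x::real. x ^ (4 * D) / exp x) \<longlongrightarrow> 0) at_top" by (rule tendsto_power_div_exp_0)
  moreover have "filterlim (\<lambda>m. ln 2 * (real m + 1)) at_top sequentially"
  proof (rule filterlim_at_top_mono)
    show "filterlim (\<lambda>m. ln 2 * real m) at_top sequentially"
      by (rule filterlim_tendsto_pos_mult_at_top[OF tendsto_const _ filterlim_real_sequentially]) simp
  qed (simp add: distrib_left)
  ultimately have "(\<lambda>m. (ln 2 * (real m + 1)) ^ (4 * D) / exp (ln 2 * (real m + 1))) \<longlonglongrightarrow> 0"
    by (rule filterlim_compose)
  from tendsto_mult_left[OF this, of "2 * \<bar>c\<bar> ^ D / ln 2 ^ (4 * D)"]
  have "(\<lambda>m. 2 * \<bar>c\<bar> ^ D / ln 2 ^ (4 * D) * ((ln 2 * (real m + 1)) ^ (4 * D) / exp (ln 2 * (real m + 1)))) \<longlonglongrightarrow> 0"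
    unfolding mult_zero_right .
  then have "eventually (\<lambda>m. 2 * \<bar>c\<bar> ^ D / ln 2 ^ (4 * D) * ((ln 2 * (real m + 1)) ^ (4 * D) / exp (ln 2 * (real m + 1))) < 1) sequentially"
    by (rule order_tendstoD) simp
  then obtain m where m: "2 * \<bar>c\<bar> ^ D / ln 2 ^ (4 * D) * ((ln 2 * (real m + 1)) ^ (4 * D) / exp (ln 2 * (real m + 1))) < 1"
    using eventually_happens'[OF sequentially_bot] by blast
  have "exp (ln 2 * (real m + 1)) = (2::real) ^ Suc m"
    using exp_of_nat_mult[of "Suc m" "ln (2::real)"] by (simp add: mult.commute add.commute)
  then have "2 * \<bar>c\<bar> ^ D / ln 2 ^ (4 * D) * ((ln 2 * (real m + 1)) ^ (4 * D) / exp (ln 2 * (real m + 1)))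
      = (\<bar>c\<bar> * (real m + 1) ^ 4) ^ D / 2 ^ m"
    by (simp add: power_mult_distrib power_mult)
  with m have "(\<bar>c\<bar> * (real m + 1) ^ 4) ^ D / 2 ^ m < 1" by (simp only:)
  then have "(\<bar>c\<bar> * (real m + 1) ^ 4) ^ D < 2 ^ m" by simp
  moreover have "(c * (real m + 1) ^ 4) ^ D \<le> \<bar>(c * (real m + 1) ^ 4) ^ D\<bar>" by simp
  moreover have "\<bar>(c * (real m + 1) ^ 4) ^ D\<bar> = (\<bar>c\<bar> * (real m + 1) ^ 4) ^ D" by (simp add: power_abs abs_mult)
  ultimately show ?thesis by (intro exI[of _ m]) linarith
qed

context hyp_group
begin

text \<open>Coordinates adapted to a boundary point: \<open>u\<close> lies where the form is
  Euclidean, and the last condition says that \<open>W\<close> lies on a fixed horosphere at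
  \<open>\<theta>\<close>, which multipliers of norm 1 preserve.\<close>

definition unit_decomp :: "(nat \<Rightarrow> 'a) \<Rightarrow> real \<Rightarrow> real \<Rightarrow> (nat \<Rightarrow> 'a) \<Rightarrow> bool" where
  "unit_decomp \<theta> N M W \<longleftrightarrow> (\<exists>x u. (\<forall>i\<le>n. W i = \<theta> i * x + u i) \<and> u n = 0 \<and>
     (\<Sum>i<n. (norm (u i))\<^sup>2) \<le> N\<^sup>2 \<and> norm x \<le> M \<and> norm (hf n \<theta> u) = 1)"

lemma unit_decomp_mono:
  assumes W: "unit_decomp \<theta> N M W" and M: "M \<le> M'"
  shows "unit_decomp \<theta> N M' W"
proof -
  from W obtain x u where xu: "(\<forall>i\<le>n. W i = \<theta> i * x + u i) \<and> u n = 0 \<and>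
     (\<Sum>i<n. (norm (u i))\<^sup>2) \<le> N\<^sup>2" "norm x \<le> M" "norm (hf n \<theta> u) = 1"
    unfolding unit_decomp_def by (elim exE conjE) (intro that conjI)
  from xu(2) M have "norm x \<le> M'" by simp
  with xu(1,3) show ?thesis unfolding unit_decomp_def by (intro exI[of _ x] exI[of _ u]) simp
qed

text \<open>\<open>A u\<close> differs from the new \<open>u'\<close> by \<open>\<theta> y\<close>
  with |y| <= K N. As \<open>A\<close> preserves the form and |<\<open>\<theta>\<close>, A u>| = 1,
  the squared length of \<open>u\<close> grows by at most 2 K N, hence N by at most K: additive
  instead of multiplicative growth.\<close>

lemma unit_decomp_step:
  assumes \<theta>: "null_vec n \<theta>" "\<theta> n = 1" and A: "A \<in> G"
    and l: "\<And>i. i \<le> n \<Longrightarrow> app n A \<theta> i = \<theta> i * l" "norm l = 1"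
    and K: "(real n + 1) * nn A \<le> K" and N: "0 \<le> N" and W: "unit_decomp \<theta> N M W"
  shows "unit_decomp \<theta> (N + K) (M + K * N) (app n A W)"
proof -
  obtain x u where x: "\<And>i. i \<le> n \<Longrightarrow> W i = \<theta> i * x + u i" and u: "u n = 0" "(\<Sum>i<n. (norm (u i))\<^sup>2) \<le> N\<^sup>2"
    "norm x \<le> M" "norm (hf n \<theta> u) = 1" using W unfolding unit_decomp_def by blast
  have K0: "0 \<le> K" using K nn_ge1[OF A] by (smt (verit) mult_nonneg_nonneg of_nat_0_le_iff)
  have t0: "hf n \<theta> \<theta> = 0" using \<theta> by (simp add: null_vec_def)
  have uj: "norm (u j) \<le> N" if "j \<le> n" for j
  proof (cases "j = n")
    case False
    then have "(norm (u j))\<^sup>2 \<le> (\<Sum>i<n. (norm (u i))\<^sup>2)" using that by (intro member_le_sum) auto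
    with u(2) have "(norm (u j))\<^sup>2 \<le> N\<^sup>2" by linarith
    then show ?thesis using N by (rule power2_le_imp_le)
  qed (simp add: u N)
  define y where "y = app n A u n"
  have "norm y \<le> (\<Sum>j\<le>n. norm (A $$ (n,j) * u j))" unfolding y_def app_def by (simp add: norm_sum)
  also have "\<dots> \<le> (\<Sum>j\<le>n. nn A * N)"
    unfolding norm_mult by (intro sum_mono mult_mono entry_le_nn[OF A] uj) (auto simp: nn_def)
  also have "\<dots> = ((real n + 1) * nn A) * N" by simp
  also have "\<dots> \<le> K * N" using K N by (intro mult_right_mono)
  finally have y: "norm y \<le> K * N" .
  define u' where "u' = (\<lambda>i. app n A u i - \<theta> i * y)"
  have "hf n \<theta> u = hf n (app n A \<theta>) (app n A u)" using A by simp
  also have "\<dots> = hf n (\<lambda>i. \<theta> i * l) (app n A u)" by (intro hf_cong l refl)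
  finally have hu: "norm (hf n \<theta> (app n A u)) = 1" using u(4) l(2) by (simp add: hf_mult_left norm_mult)
  have un: "u' n = 0" by (simp add: u'_def y_def \<theta>)
  have "of_real (\<Sum>i<n. (norm (u' i))\<^sup>2) = hf n u' u'" by (simp add: hf_self un)
  also have "\<dots> = hf n u u - (hf n (app n A u) \<theta> * y + cj y * hf n \<theta> (app n A u))"
    using A by (simp add: u'_def hf_diff_left hf_diff_right hf_mult_left hf_mult_right t0)
  also have "hf n u u = of_real (\<Sum>i<n. (norm (u i))\<^sup>2)" by (simp add: hf_self u(1))
  finally have "of_real ((\<Sum>i<n. (norm (u' i))\<^sup>2) - (\<Sum>i<n. (norm (u i))\<^sup>2))
      = - (hf n (app n A u) \<theta> * y + cj y * hf n \<theta> (app n A u))" by simp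
  then have "norm (of_real ((\<Sum>i<n. (norm (u' i))\<^sup>2) - (\<Sum>i<n. (norm (u i))\<^sup>2)) :: 'a)
      \<le> norm (hf n (app n A u) \<theta> * y) + norm (cj y * hf n \<theta> (app n A u))"
    by (metis norm_minus_cancel norm_triangle_ineq)
  also have "\<dots> = 2 * norm y"
    using hu by (simp add: norm_mult) (metis cj_hf norm_cj mult_1)
  finally have "\<bar>(\<Sum>i<n. (norm (u' i))\<^sup>2) - (\<Sum>i<n. (norm (u i))\<^sup>2)\<bar> \<le> 2 * norm y" by (simp only: norm_of_real)
  then have "(\<Sum>i<n. (norm (u' i))\<^sup>2) \<le> N\<^sup>2 + 2 * (K * N)" using u(2) y by linarith
  also have "\<dots> \<le> (N + K)\<^sup>2" by (simp add: power2_sum)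
  finally have 1: "(\<Sum>i<n. (norm (u' i))\<^sup>2) \<le> (N + K)\<^sup>2" .
  have 2: "norm (l * x + y) \<le> M + K * N"
    using norm_triangle_ineq[of "l * x" y] u(3) y l(2) by (simp add: norm_mult)
  have 3: "norm (hf n \<theta> u') = 1" using hu by (simp add: u'_def hf_diff_right hf_mult_right t0)
  have 4: "app n A W i = \<theta> i * (l * x + y) + u' i" if "i \<le> n" for i
  proof -
    have "app n A W = app n A (\<lambda>i. \<theta> i * x + u i)" by (rule app_cong) (rule x)
    then have "app n A W i = app n A \<theta> i * x + app n A u i" by (simp add: app_add app_mult_right)
    with l(1)[OF that] show ?thesis by (simp add: u'_def mult.assoc distrib_left)
  qed
  show ?thesis unfolding unit_decomp_def
    by (intro exI[of _ "l * x + y"] exI[of _ u'] conjI allI impI 1 2 3 4 un)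
qed

text \<open>Starting from the base point, N grows linearly in the length and M by at most K N in
  each step, so quadratically. The last coordinate of the image is \<open>x\<close>, and its norm is
  \<open>nn\<close>.\<close>

lemma parabolic_word_growth:
  assumes \<theta>: "null_vec n \<theta>" "\<theta> n = 1" and A: "A \<in> G" "B \<in> G"
    and l: "\<And>i. i \<le> n \<Longrightarrow> app n A \<theta> i = \<theta> i * l" "norm l = 1"
    and l': "\<And>i. i \<le> n \<Longrightarrow> app n B \<theta> i = \<theta> i * l'" "norm l' = 1"
  shows "\<exists>C\<ge>1. \<forall>w. nn (word (Suc n) A B w) \<le> C * (real (length w) + 1)\<^sup>2"
proof -
  define K where "K = (real n + 1) * nn A + (real n + 1) * nn B"
  have K: "(real n + 1) * nn A \<le> K" "(real n + 1) * nn B \<le> K" "0 \<le> K" by (auto simp: K_def nn_def)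
  have inv: "unit_decomp \<theta> (1 + K * real (length w)) (1 + real (length w) * (K * (1 + K * real (length w))))
      (app n (word (Suc n) A B w) (std n))" for w
  proof (induction w)
    case Nil
    have "(\<Sum>i<n. (norm (std n i - \<theta> i))\<^sup>2) = (\<Sum>i<n. (norm (\<theta> i))\<^sup>2)"
      by (intro sum.cong) (auto simp: std_def)
    also have "\<dots> = 1" using null_vec_norm(2)[OF \<theta>(1)] \<theta>(2) by simp
    finally have b1: "(\<Sum>i<n. (norm (std n i - \<theta> i))\<^sup>2) \<le> 1\<^sup>2" by simp
    have b2: "norm (hf n \<theta> (\<lambda>i. std n i - \<theta> i)) = 1"
      unfolding hf_diff_right hf_std_right[OF order_refl] using \<theta> by (simp add: null_vec_def)
    have b3: "std n n - \<theta> n = 0" using \<theta> by (simp add: std_def)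
    have b4: "app n (word (Suc n) A B []) (std n) i = \<theta> i * 1 + (std n i - \<theta> i)" if "i \<le> n" for i
      using that by (simp add: app_one)
    have b5: "norm (1::'a) \<le> 1" by simp
    \<comment> \<open>The base point is \<open>\<theta>\<close> plus a vector with last coordinate
      0, of length 1 because \<open>\<theta>\<close> is null.\<close>
    have "unit_decomp \<theta> 1 1 (app n (word (Suc n) A B []) (std n))"
      unfolding unit_decomp_def by (intro exI[of _ 1] exI[of _ "\<lambda>i. std n i - \<theta> i"] conjI allI impI b1 b2 b3 b4 b5)
    then show ?case by simp
  next
    case (Cons x w)
    define N M where "N = 1 + K * real (length w)" and "M = 1 + real (length w) * (K * N)"
    have N0: "0 \<le> N" using K by (simp add: N_def)
    have IH: "unit_decomp \<theta> N M (app n (word (Suc n) A B w) (std n))" using Cons by (simp add: N_def M_def)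
    have s1: "unit_decomp \<theta> (N + K) (M + K * N) (app n (if x then A else B) (app n (word (Suc n) A B w) (std n)))"
      using unit_decomp_step[OF \<theta> A(1) l K(1) N0 IH] unit_decomp_step[OF \<theta> A(2) l' K(2) N0 IH] by simp
    have s2: "app n (word (Suc n) A B (x # w)) (std n) = app n (if x then A else B) (app n (word (Suc n) A B w) (std n))"
      unfolding word.simps by (rule app_mult_G) (use A in auto)
    have s3: "N + K = 1 + K * real (length (x # w))" by (simp add: N_def algebra_simps)
    have s4: "M + K * N \<le> 1 + real (length (x # w)) * (K * (N + K))"
    proof -
      have "M + K * N = 1 + real (length (x # w)) * (K * N)" by (simp add: M_def algebra_simps)
      also have "\<dots> \<le> 1 + real (length (x # w)) * (K * (N + K))"
        using K(3) by (intro add_mono mult_left_mono order_refl) auto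
      finally show ?thesis .
    qed
    show ?case unfolding s2 s3[symmetric] by (rule unit_decomp_mono[OF s1 s4])
  qed
  have "nn (word (Suc n) A B w) \<le> (1 + K)\<^sup>2 * (real (length w) + 1)\<^sup>2" for w
  proof -
    let ?m = "real (length w)"
    from inv[of w] obtain x u where "app n (word (Suc n) A B w) (std n) n = \<theta> n * x + u n" "u n = 0"
      "norm x \<le> 1 + ?m * (K * (1 + K * ?m))" unfolding unit_decomp_def by blast
    then have "nn (word (Suc n) A B w) \<le> 1 + ?m * (K * (1 + K * ?m))" using \<theta> by (simp add: app_std nn_def)
    also have "\<dots> \<le> (1 + K * ?m)\<^sup>2" using K(3) by (simp add: power2_eq_square algebra_simps)
    also have "\<dots> \<le> ((1 + K) * (?m + 1))\<^sup>2" using K(3) by (intro power_mono) (auto simp: algebra_simps)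
    finally show ?thesis by (simp add: power_mult_distrib)
  qed
  moreover have "1 \<le> (1 + K)\<^sup>2" using K(3) by simp
  ultimately show ?thesis by blast
qed

text \<open>Injectivity would put 2^m group elements into a ball of radius quadratic in m, which
  contains only polynomially many.\<close>

lemma parabolic_not_free:
  assumes "null_vec n \<theta>" "\<theta> n = 1" "A \<in> G" "B \<in> G"
    "\<And>i. i \<le> n \<Longrightarrow> app n A \<theta> i = \<theta> i * l" "norm l = 1"
    "\<And>i. i \<le> n \<Longrightarrow> app n B \<theta> i = \<theta> i * l'" "norm l' = 1"
  shows "\<exists>m. \<not> inj_on (word (Suc n) A B) {w. length w = m}"
proof (rule ccontr)
  assume "\<not> ?thesis"
  then have inj: "\<And>m. inj_on (word (Suc n) A B) {w. length w = m}" by blast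
  obtain C where C: "C \<ge> 1" "\<And>w. nn (word (Suc n) A B w) \<le> C * (real (length w) + 1)\<^sup>2"
    using parabolic_word_growth[OF assms] by blast
  obtain K D where KD: "\<And>R. R \<ge> 1 \<Longrightarrow> finite {A \<in> G. nn A \<le> R} \<and> real (card {A \<in> G. nn A \<le> R}) \<le> (K * R\<^sup>2) ^ D"
    using polynomial_count by blast
  have "2 ^ m \<le> (K * C\<^sup>2 * (real m + 1) ^ 4) ^ D" for m
  proof -
    define R where "R = C * (real m + 1)\<^sup>2"
    have "1 * 1 \<le> R" unfolding R_def using C(1) by (intro mult_mono) auto
    then have R: "R \<ge> 1" by simp
    have "word (Suc n) A B ` {w. length w = m} \<subseteq> {A \<in> G. nn A \<le> R}"
      using assms(3,4) C(2) by (auto simp: R_def)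
    then have "card {w :: bool list. length w = m} \<le> card {A \<in> G. nn A \<le> R}"
      using inj[of m] KD[OF R] card_inj_on_le by blast
    moreover have "card {w :: bool list. length w = m} = 2 ^ m"
      using card_lists_length_eq[of "UNIV :: bool set" m] by simp
    ultimately have "real (2 ^ m) \<le> real (card {A \<in> G. nn A \<le> R})" by simp
    also have "\<dots> \<le> (K * R\<^sup>2) ^ D" using KD[OF R] by simp
    also have "K * R\<^sup>2 = K * C\<^sup>2 * (real m + 1) ^ 4" by (simp add: R_def power_mult_distrib power_mult[symmetric])
    finally show ?thesis by simp
  qed
  then show False using exp_beats_polynomial[of "K * C\<^sup>2" D] by (metis not_le)
qed

end

section \<open>Transfer to the image group: no invariant boundary point\<close>

lemma image_word:
  assumes "\<And>A B. A \<in> \<Gamma> \<Longrightarrow> B \<in> \<Gamma> \<Longrightarrow> \<rho> (A * B) = \<rho> A * \<rho> B" "\<rho> (1\<^sub>m N) = 1\<^sub>m N"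
    "A \<in> \<Gamma>" "B \<in> \<Gamma>" "\<And>w. word N A B w \<in> \<Gamma>"
  shows "\<rho> (word N A B w) = word N (\<rho> A) (\<rho> B) w"
  using assms by (induction w) auto

text \<open>By injectivity the images of the two commutators still generate a free semigroup. On a
  fixed line the norm of the multiplier is multiplicative, so it is 1 on these images, against
  \<open>parabolic_not_free\<close>. The 2^m distinct words of length m also rule out a finite
  image.\<close>

lemma free_image_no_fixed_line:
  fixes \<Gamma> \<Delta> :: "'a::hyp_scalar mat set"
  assumes "hyp_group n \<Gamma>" "hyp_group n \<Delta>" and three: "hyp_group.three_limits n \<Gamma>"
    and hom: "\<And>A B. A \<in> \<Gamma> \<Longrightarrow> B \<in> \<Gamma> \<Longrightarrow> \<rho> (A * B) = \<rho> A * \<rho> B" "\<rho> (1\<^sub>m (Suc n)) = 1\<^sub>m (Suc n)"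
    and inj: "inj_on \<rho> \<Gamma>" and into: "\<And>A. A \<in> \<Gamma> \<Longrightarrow> \<rho> A \<in> \<Delta>"
  shows "\<not> hyp_group.fixes_line n \<Delta> \<theta>" and "infinite \<Delta>"
proof -
  interpret \<Gamma>: hyp_group n \<Gamma> by fact
  interpret \<Delta>: hyp_group n \<Delta> by fact
  obtain g h where gh: "g \<in> \<Gamma>" "h \<in> \<Gamma>" and free:
    "\<And>m. inj_on (word (Suc n) ((g * h) * (\<Gamma>.iv g * \<Gamma>.iv h)) ((\<Gamma>.iv g * \<Gamma>.iv h) * (g * h))) {w. length w = m}"
    using \<Gamma>.free_commutators[OF three] by blast
  define A B where "A = (g * h) * (\<Gamma>.iv g * \<Gamma>.iv h)" and "B = (\<Gamma>.iv g * \<Gamma>.iv h) * (g * h)"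
  have AB: "A \<in> \<Gamma>" "B \<in> \<Gamma>" using gh by (auto simp: A_def B_def)
  have words: "word (Suc n) A B w \<in> \<Gamma>" for w using AB by simp
  have inj_words: "inj_on (word (Suc n) (\<rho> A) (\<rho> B)) {w. length w = m}" for m
  proof -
    have "inj_on (\<lambda>w. \<rho> (word (Suc n) A B w)) {w. length w = m}"
      using free[of m] inj words unfolding A_def[symmetric] B_def[symmetric]
      by (auto simp: inj_on_def)
    then show ?thesis using image_word[OF hom AB words] by simp
  qed
  show "infinite \<Delta>"
  proof
    assume fin: "finite \<Delta>"
    have "card {w :: bool list. length w = m} \<le> card \<Delta>" for m
      by (rule card_inj_on_le[OF inj_words[of m] _ fin]) (use AB into in auto)
    moreover have "card {w :: bool list. length w = m} = 2 ^ m" for m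
      using card_lists_length_eq[of "UNIV :: bool set" m] by simp
    ultimately have "2 ^ m \<le> card \<Delta>" for m by metis
    from this[of "card \<Delta>"] show False using less_exp[of "card \<Delta>"] by simp
  qed
  show "\<not> \<Delta>.fixes_line \<theta>"
  proof
    assume fix0: "\<Delta>.fixes_line \<theta>"
    define t where "t = (\<lambda>i. \<theta> i * inverse (\<theta> n))"
    have t: "null_vec n t" "t n = 1"
      using null_vec_normalize[of n \<theta>] fix0 by (simp_all add: t_def \<Delta>.fixes_line_def)
    have ft: "\<Delta>.fixes_line t"
      using fix0 t by (simp add: \<Delta>.fixes_line_def t_def app_mult_right hf_mult_left hf_mult_right)
    have m: "app n X t i = t i * app n X t n" if "X \<in> \<Delta>" "i \<le> n" for X i
    proof -
      from \<Delta>.fixes_line_multiplier[OF ft that(1)] obtain q where "\<forall>i\<le>n. app n X t i = t i * q" by blast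
      with that t show ?thesis by simp
    qed
    define L where "L X = norm (app n X t n)" for X
    have LL: "L (X * Y) = L X * L Y" if "X \<in> \<Delta>" "Y \<in> \<Delta>" for X Y
    proof -
      have "app n (X * Y) t n = app n X (app n Y t) n" using that by (simp add: \<Delta>.app_mult_G)
      also have "\<dots> = app n X (\<lambda>i. t i * app n Y t n) n" by (intro fun_cong[OF app_cong] m that)
      finally show ?thesis by (simp add: L_def app_mult_right norm_mult)
    qed
    have L1: "L (1\<^sub>m (Suc n)) = 1" by (simp add: L_def app_one t)
    have inv: "L (\<rho> x) * L (\<rho> (\<Gamma>.iv x)) = 1" if "x \<in> \<Gamma>" for x
    proof -
      have "\<rho> x * \<rho> (\<Gamma>.iv x) = 1\<^sub>m (Suc n)" using that hom \<Gamma>.iv_right[OF that] \<Gamma>.iv_in[OF that] by metis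
      then show ?thesis using LL[of "\<rho> x" "\<rho> (\<Gamma>.iv x)"] that into L1 by simp
    qed
    have c: "(a * b) * (a' * b') = 1" "(a' * b') * (a * b) = 1" if "a * a' = 1" "b * b' = 1" for a b a' b' :: real
    proof -
      have "(a * b) * (a' * b') = (a * a') * (b * b')" by (simp only: mult_ac)
      then show "(a * b) * (a' * b') = 1" using that by simp
      then show "(a' * b') * (a * b) = 1" by (simp only: mult.commute)
    qed
    have "L (\<rho> A) = 1" "L (\<rho> B) = 1"
      using gh into by (simp_all add: A_def B_def hom LL c[OF inv[OF gh(1)] inv[OF gh(2)]])
    then have "\<exists>m. \<not> inj_on (word (Suc n) (\<rho> A) (\<rho> B)) {w. length w = m}"
      unfolding L_def
      by (intro \<Delta>.parabolic_not_free[OF t into[OF AB(1)] into[OF AB(2)] m[OF into[OF AB(1)]] _ m[OF into[OF AB(2)]]])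
    with inj_words show False by blast
  qed
qed

text \<open>Representations are only required to be multiplicative; this recovers that they preserve
  the identity. A vector killed by \<open>A\<close> is orthogonal to everything, and A std - std is
  such a vector.\<close>

lemma idempotent_unitary:
  assumes A: "A \<in> U_n1 n" and idem: "A * A = A"
  shows "A = 1\<^sub>m (Suc n)"
proof -
  have carr: "A \<in> carrier_mat (Suc n) (Suc n)" using A by (simp add: U_n1_def)
  show ?thesis
  proof (rule eq_matI)
    fix i j assume "i < dim_row (1\<^sub>m (Suc n))" "j < dim_col (1\<^sub>m (Suc n))"
    then have ij: "i \<le> n" "j \<le> n" by auto
    define d where "d = (\<lambda>l. app n A (std j) l - std j l)"
    have "app n A d = (\<lambda>l. 0)"
      using app_mult[OF carr carr, of "std j"] by (simp add: d_def app_diff idem)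
    then have "hf n (std i) d = hf n (app n A (std i)) (\<lambda>l. 0)" using hf_app_app[OF A, of "std i" d] by simp
    also have "\<dots> = 0" by (simp add: hf_def)
    finally have "d i = 0" using ij by (simp add: hf_std_left)
    then show "A $$ (i,j) = 1\<^sub>m (Suc n) $$ (i,j)" using ij by (simp add: d_def app_std std_def)
  qed (use carr in auto)
qed

section \<open>Values of the form on an orbit\<close>

text \<open>The trace of the rank-one matrix x s y* J. Over a commutative field it is s times
  \<open>hf n y x\<close>; over the quaternions the order of factors matters and it is a separate
  quantity.\<close>

definition trf :: "nat \<Rightarrow> (nat \<Rightarrow> 'a) \<Rightarrow> 'a \<Rightarrow> (nat \<Rightarrow> 'a) \<Rightarrow> 'a::hyp_scalar" where
  "trf n x s y = (\<Sum>i\<le>n. sg n i *\<^sub>R (x i * s * cj (y i)))"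

lemma trf_split: "trf n x s y = (\<Sum>i<n. x i * s * cj (y i)) - x n * s * cj (y n)"
  by (simp add: trf_def lessThan_Suc_atMost[symmetric])

lemma cj_neg_iff: "cj a = - a \<longleftrightarrow> inner a 1 = (0::real)" for a :: "'a::hyp_scalar"
  by (simp add: cj_def)

lemma eq_minus_self: "z = - z \<Longrightarrow> z = (0::'a::real_vector)"
proof -
  assume "z = - z"
  then have "2 *\<^sub>R z = 0" by (metis scaleR_2 add.right_inverse)
  then show "z = 0" by simp
qed

lemma imaginary_square: "cj a = - a \<Longrightarrow> a * a = - ((norm a)\<^sup>2 *\<^sub>R (1::'a::hyp_scalar))"
proof -
  assume "cj a = - a"
  then have "- (a * a) = (norm a)\<^sup>2 *\<^sub>R 1" using mult_cj[of a] by (simp add: of_real_def)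
  then show "a * a = - ((norm a)\<^sup>2 *\<^sub>R 1)" by (metis minus_minus)
qed

text \<open>By the class axiom \<open>commutant\<close>, what commutes with a nonzero imaginary
  \<open>a\<close> lies in R + R a; the imaginary elements of this plane are the multiples of
  \<open>a\<close>.\<close>

lemma imaginary_commuting_parallel:
  fixes a b :: "'a::hyp_scalar"
  assumes "cj a = - a" "cj b = - b" "a \<noteq> 0" "b * a = a * b"
  shows "\<exists>r. b = r *\<^sub>R a"
proof -
  obtain r s where b: "b = r *\<^sub>R 1 + s *\<^sub>R a"
    using commutant[OF assms(4) _ assms(3)] assms(1) by (auto simp: cj_neg_iff)
  have "inner b 1 = r + s * inner a 1" by (simp add: b inner_add_left)
  then have "r = 0" using assms(1,2) by (simp add: cj_neg_iff)
  with b show ?thesis by auto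
qed

text \<open>For imaginary \<open>a\<close> the trace is its own negative under conjugation, so being
  real it vanishes. This is the equality \<open>null_cauchy_eq\<close> with both vectors equal to
  the normalized \<open>x\<close> and W = x_n a cj(x_n).\<close>

lemma trace_core_commute:
  assumes x: "null_vec n x" and tr: "cj (trf n x a x) = trf n x a x" and a: "cj a = - a" and i: "i \<le> n"
  shows "(x i * inverse (x n)) * (x n * a * cj (x n)) = (x n * a * cj (x n)) * (x i * inverse (x n))"
proof -
  have "cj (trf n x a x) = - trf n x a x"
    by (simp add: trf_def cj_sum cj_scaleR cj_mult a sum_negf mult.assoc)
  with tr have "trf n x a x = 0" by (intro eq_minus_self) (rule trans[OF sym])
  then have "(\<Sum>i<n. x i * a * cj (x i)) = x n * a * cj (x n)" by (simp add: trf_split)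
  moreover have "(x i * inverse (x n)) * (x n * a * cj (x n)) * cj (x i * inverse (x n)) = x i * a * cj (x i)" for i
  proof -
    have nz: "x n \<noteq> 0" by (rule null_vec_norm(1)[OF x])
    have "cj (x n) * cj (inverse (x n)) = 1" using nz by (simp add: cj_mult[symmetric])
    then have "cj (x n) * (cj (inverse (x n)) * z) = z" for z by (simp add: mult.assoc[symmetric])
    moreover have "inverse (x n) * (x n * z) = z" for z using nz by (simp add: mult.assoc[symmetric])
    ultimately show ?thesis by (simp add: cj_mult mult.assoc)
  qed
  ultimately have "(\<Sum>i<n. (x i * inverse (x n)) * (x n * a * cj (x n)) * cj (x i * inverse (x n))) = x n * a * cj (x n)"
    by simp
  then show ?thesis
    by (rule null_cauchy_eq[OF null_vec_normalize[OF x] null_vec_normalize[OF x] _ i])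
qed

lemma conjugate_parallel:
  fixes a b w :: "'a::hyp_scalar"
  assumes "w * b * cj w = r *\<^sub>R (w * a * cj w)" "w \<noteq> 0"
  shows "b = r *\<^sub>R a"
proof -
  have "w * (b - r *\<^sub>R a) * cj w = 0" using assms(1) by (simp add: right_diff_distrib left_diff_distrib)
  then show ?thesis using assms(2) by simp
qed

text \<open>Isolates the algebra from the dynamics. \<open>S\<close> is to be the real span of the
  scalars between the factors of rank-one limits at one boundary point, \<open>Orb\<close> the orbit
  of that point; \<open>S_cj\<close> reflects inversion and \<open>mul\<close> multiplication of
  such limits.\<close>

locale trace_core =
  fixes n :: nat and S :: "'a::hyp_scalar set" and Orb :: "(nat \<Rightarrow> 'a) set" and x0 y0 :: "nat \<Rightarrow> 'a"
  assumes S: "subspace S" and S_cj: "\<And>s. s \<in> S \<Longrightarrow> cj s \<in> S"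
    and null: "\<And>x. x \<in> Orb \<Longrightarrow> null_vec n x"
    and x0: "x0 \<in> Orb" "x0 n = 1" and y0: "y0 \<in> Orb" "hf n x0 y0 \<noteq> 0"
    and tr: "\<And>s x y. s \<in> S \<Longrightarrow> x \<in> Orb \<Longrightarrow> y \<in> Orb \<Longrightarrow> cj (trf n x s y) = trf n x s y"
    and mul: "\<And>s s' x y. s \<in> S \<Longrightarrow> s' \<in> S \<Longrightarrow> x \<in> Orb \<Longrightarrow> y \<in> Orb \<Longrightarrow> s * hf n x y * s' \<in> S"
begin

text \<open>The normalized coordinate commutes with the conjugates of both \<open>a\<close> and
  \<open>b\<close>, so it lies in two different planes R + R A and R + R B, which meet in the
  reals.\<close>

lemma real_coordinates:
  assumes a: "a \<in> S" "cj a = - a" "a \<noteq> 0" and b: "b \<in> S" "cj b = - b" and np: "\<nexists>r. b = r *\<^sub>R a"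
    and x: "x \<in> Orb" and i: "i \<le> n"
  shows "\<exists>r. x i = of_real r * x n"
proof -
  have nx: "x n \<noteq> 0" by (rule null_vec_norm(1)[OF null[OF x]])
  define A B z where "A = x n * a * cj (x n)" and "B = x n * b * cj (x n)" and "z = x i * inverse (x n)"
  have AB: "cj A = - A" "cj B = - B" "A \<noteq> 0" using nx a b by (simp_all add: A_def B_def cj_mult mult.assoc)
  have zA: "z * A = A * z" unfolding z_def A_def by (rule trace_core_commute[OF null[OF x] tr[OF a(1) x x] a(2) i])
  have zB: "z * B = B * z" unfolding z_def B_def by (rule trace_core_commute[OF null[OF x] tr[OF b(1) x x] b(2) i])
  obtain r s where z: "z = r *\<^sub>R 1 + s *\<^sub>R A" using commutant[OF zA _ AB(3)] AB(1) by (auto simp: cj_neg_iff)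
  have "s = 0"
  proof (rule ccontr)
    assume s: "s \<noteq> 0"
    from zB have "s *\<^sub>R (A * B) = s *\<^sub>R (B * A)" by (simp add: z distrib_left distrib_right)
    with s have "B * A = A * B" by simp
    from imaginary_commuting_parallel[OF AB(1,2,3) this] obtain r where "B = r *\<^sub>R A" by blast
    then have "b = r *\<^sub>R a" unfolding A_def B_def using nx by (rule conjugate_parallel)
    with np show False by blast
  qed
  then have "x i * inverse (x n) = of_real r" using z by (simp add: z_def of_real_def)
  then have "x i * inverse (x n) * x n = of_real r * x n" by simp
  then show ?thesis using nx by (auto simp: mult.assoc)
qed

text \<open>With two independent imaginary scalars, \<open>x0\<close> and \<open>y0\<close> have
  real coordinates up to a right factor, and the trace becomes a nonzero real number times s * cj(y0
  n). Its reality for all s confines \<open>S\<close> to one real line, a contradiction.\<close>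

lemma imaginary_parallel:
  assumes a: "a \<in> S" "cj a = - a" "a \<noteq> 0" and b: "b \<in> S" "cj b = - b"
  shows "\<exists>r. b = r *\<^sub>R a"
proof (rule ccontr)
  assume np: "\<nexists>r. b = r *\<^sub>R a"
  have "\<forall>i\<in>{..n}. \<exists>r. x0 i = of_real r * x0 n" "\<forall>i\<in>{..n}. \<exists>r. y0 i = of_real r * y0 n"
    using real_coordinates[OF a b np x0(1)] real_coordinates[OF a b np y0(1)] by blast+
  from bchoice[OF this(1)] bchoice[OF this(2)] obtain p t where
    p: "\<forall>i\<in>{..n}. x0 i = of_real (p i) * x0 n" and t: "\<forall>i\<in>{..n}. y0 i = of_real (t i) * y0 n" by (elim exE)
  define c where "c = (\<Sum>i\<le>n. sg n i * (p i * t i))"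
  have "hf n x0 y0 = hf n (\<lambda>i. of_real (p i)) (\<lambda>i. of_real (t i) * y0 n)"
  proof (rule hf_cong)
    fix i assume "i \<le> n"
    then show "x0 i = of_real (p i)" using bspec[OF p, of i] x0(2) by simp
    show "y0 i = of_real (t i) * y0 n" by (rule bspec[OF t]) (simp add: \<open>i \<le> n\<close>)
  qed
  also have "\<dots> = c *\<^sub>R y0 n"
    by (simp add: hf_def c_def sum_distrib_right scaleR_conv_of_real mult.assoc)
  finally have c: "c \<noteq> 0" using y0(2) by auto
  have tr': "trf n x0 s y0 = c *\<^sub>R (s * cj (y0 n))" for s
  proof -
    have "trf n x0 s y0 = (\<Sum>i\<le>n. sg n i *\<^sub>R (of_real (p i) * s * cj (of_real (t i) * y0 n)))"
      unfolding trf_def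
    proof (rule sum.cong)
      fix i assume "i \<in> {..n}"
      have "x0 i = of_real (p i)" using bspec[OF p \<open>i \<in> {..n}\<close>] x0(2) by simp
      moreover have "y0 i = of_real (t i) * y0 n" by (rule bspec[OF t \<open>i \<in> {..n}\<close>])
      ultimately show "sg n i *\<^sub>R (x0 i * s * cj (y0 i)) = sg n i *\<^sub>R (of_real (p i) * s * cj (of_real (t i) * y0 n))"
        by (simp only:)
    qed simp
    also have "\<dots> = (\<Sum>i\<le>n. (sg n i * (p i * t i)) *\<^sub>R (s * cj (y0 n)))"
      by (intro sum.cong refl) (simp add: cj_mult of_real_def cj_scaleR)
    finally show ?thesis by (simp add: c_def scaleR_sum_left)
  qed
  have r: "s * cj (y0 n) \<in> \<real>" if "s \<in> S" for s
  proof -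
    have "c *\<^sub>R cj (s * cj (y0 n)) = c *\<^sub>R (s * cj (y0 n))"
      using tr[OF that x0(1) y0(1)] by (simp add: tr' cj_scaleR)
    with c show ?thesis by (simp add: cj_fixed_iff[symmetric])
  qed
  have ny: "cj (y0 n) \<noteq> 0" using null_vec_norm(1)[OF null[OF y0(1)]] by simp
  obtain r1 r2 where r12: "a * cj (y0 n) = of_real r1" "b * cj (y0 n) = of_real r2"
    using r[OF a(1)] r[OF b(1)] by (metis Reals_cases)
  have "r1 \<noteq> 0" using r12(1) a(3) ny by (metis mult_eq_0_iff of_real_0)
  then have "b * cj (y0 n) = ((r2 / r1) *\<^sub>R a) * cj (y0 n)" by (simp add: r12 of_real_def)
  then have "b = (r2 / r1) *\<^sub>R a" using ny by (metis mult_right_cancel)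
  with np show False by blast
qed

text \<open>Coordinates of \<open>x0\<close> commute with \<open>a\<close>, so the traces for
  \<open>a\<close> and for 1 differ by the factor \<open>a\<close>; both are real, so both vanish.
  That makes \<open>y0\<close> a left multiple of \<open>x0\<close>, and averaging the form value
  over conjugation by \<open>a\<close> then shows that it is 0.\<close>

lemma no_real_and_imaginary:
  assumes one: "1 \<in> S" and a: "a \<in> S" "cj a = - a" "a \<noteq> 0"
  shows False
proof -
  have xa: "x0 i * a = a * x0 i" if "i \<le> n" for i
    using trace_core_commute[OF null[OF x0(1)] tr[OF a(1) x0(1) x0(1)] a(2) that] x0(2) by simp
  have xa': "cj (x0 i) * a = a * cj (x0 i)" if "i \<le> n" for i
  proof -
    have "cj (x0 i * a) = cj (a * x0 i)" by (simp add: xa[OF that])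
    then show ?thesis by (simp add: cj_mult a(2))
  qed
  have "trf n x0 a y0 = a * trf n x0 1 y0"
    unfolding trf_def sum_distrib_left by (intro sum.cong refl) (simp add: xa mult.assoc)
  moreover obtain r where r: "trf n x0 1 y0 = of_real r"
    using tr[OF one x0(1) y0(1)] unfolding cj_fixed_iff by (rule Reals_cases)
  ultimately have "cj (r *\<^sub>R a) = r *\<^sub>R a" using tr[OF a(1) x0(1) y0(1)] by (simp add: of_real_def)
  then have "r *\<^sub>R a = - (r *\<^sub>R a)" by (simp add: cj_scaleR a(2))
  then have "r *\<^sub>R a = 0" by (rule eq_minus_self)
  with a(3) have "r = 0" by simp
  \<comment> \<open>The vanishing trace for s = 1 is the equality case again and gives y0 = l x0. In
    the complex case this already means the same line; in the quaternionic case a left multiple may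
    be a different line, hence the averaging below.\<close>
  then have s0: "(\<Sum>i<n. x0 i * cj (y0 i)) = cj (y0 n)" using r x0(2) by (simp add: trf_split)
  define l where "l = y0 n"
  have l: "l \<noteq> 0" unfolding l_def by (rule null_vec_norm(1)[OF null[OF y0(1)]])
  have "x0 i * cj l * cj (y0 i * inverse l) = x0 i * cj (y0 i)" for i
  proof -
    have "cj l * cj (inverse l) = 1" using l by (simp add: cj_mult[symmetric])
    then have "cj l * (cj (inverse l) * z) = z" for z by (simp add: mult.assoc[symmetric])
    then show ?thesis by (simp add: cj_mult mult.assoc)
  qed
  then have s1: "(\<Sum>i<n. x0 i * cj l * cj (y0 i * inverse l)) = cj l" using s0 by (simp add: l_def)
  have y'1: "null_vec n (\<lambda>i. y0 i * inverse l)" "y0 n * inverse l = 1"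
    using null_vec_normalize[OF null[OF y0(1)]] by (simp_all add: l_def)
  have y: "y0 i = l * x0 i" if i: "i \<le> n" for i
  proof -
    have "x0 i * cj l = cj l * (y0 i * inverse l)"
      by (rule null_cauchy_eq[where y = "\<lambda>i. y0 i * inverse l", OF null[OF x0(1)] x0(2) y'1 s1 i])
    then have "l * (x0 i * cj l) * l = l * (cj l * (y0 i * inverse l)) * l" by simp
    moreover have "l * (x0 i * cj l) * l = (norm l)\<^sup>2 *\<^sub>R (l * x0 i)"
      by (simp add: mult.assoc mult_cj') (simp add: of_real_def mult.assoc[symmetric])
    moreover have "l * (cj l * (y0 i * inverse l)) * l = (norm l)\<^sup>2 *\<^sub>R y0 i"
      using l by (simp add: mult.assoc[symmetric] mult_cj) (simp add: of_real_def mult.assoc)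
    ultimately show ?thesis using l by simp
  qed
  \<comment> \<open>The imaginary part of the form value lies in \<open>S\<close>, so it is a
    multiple of \<open>a\<close> and \<open>t\<close> commutes with \<open>a\<close>.\<close>
  define t where "t = hf n x0 y0"
  have tS: "t \<in> S" using mul[OF one one x0(1) y0(1)] by (simp add: t_def)
  have im: "t - cj t \<in> S" "cj (t - cj t) = - (t - cj t)"
    using subspace_diff[OF S tS S_cj[OF tS]] by (simp_all add: cj_diff)
  obtain r where r: "t - cj t = r *\<^sub>R a" using imaginary_parallel[OF a im] by blast
  have t2: "2 *\<^sub>R t = (2 * inner t 1) *\<^sub>R 1 + r *\<^sub>R a"
    using r by (simp add: cj_def scaleR_2 algebra_simps)
  have "2 *\<^sub>R (t * a) = (2 *\<^sub>R t) * a" "2 *\<^sub>R (a * t) = a * (2 *\<^sub>R t)" by simp_all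
  then have "2 *\<^sub>R (t * a) = 2 *\<^sub>R (a * t)" unfolding t2 by (simp add: distrib_left distrib_right)
  then have ta: "t * a = a * t" by simp
  define N where "N = (norm a)\<^sup>2"
  have aa: "a * a = - (N *\<^sub>R 1)" unfolding N_def by (rule imaginary_square[OF a(2)])
  \<comment> \<open>As a^2 = -N, this is N (l + a l a^-1), a multiple of the projection of
    \<open>l\<close> to the commutant of \<open>a\<close>. The same operation applied to
    \<open>t\<close> gives 2 N t, and applied termwise it gives
    \<open>hf n x0 x0 * \<alpha>\<close>, which is 0.\<close>
  define \<alpha> where "\<alpha> = N *\<^sub>R l - a * l * a"
  have \<alpha>a: "\<alpha> * a = a * \<alpha>"
  proof -
    have "\<alpha> * a = N *\<^sub>R (l * a) - a * l * (a * a)" by (simp add: \<alpha>_def left_diff_distrib mult.assoc)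
    moreover have "a * \<alpha> = N *\<^sub>R (a * l) - (a * a) * l * a" by (simp add: \<alpha>_def right_diff_distrib mult.assoc)
    ultimately show ?thesis unfolding aa by simp
  qed
  have x\<alpha>: "\<alpha> * x0 i = x0 i * \<alpha>" if i: "i \<le> n" for i
  proof -
    obtain r s where "x0 i = r *\<^sub>R 1 + s *\<^sub>R a"
      using commutant[OF xa[OF i] _ a(3)] a(2) by (auto simp: cj_neg_iff)
    then show ?thesis using \<alpha>a by (simp add: distrib_left distrib_right)
  qed
  have "t = (\<Sum>i\<le>n. sg n i *\<^sub>R (cj (x0 i) * l * x0 i))"
    unfolding t_def hf_def by (intro sum.cong refl) (simp add: y mult.assoc)
  then have "N *\<^sub>R t - a * t * a = (\<Sum>i\<le>n. sg n i *\<^sub>R (N *\<^sub>R (cj (x0 i) * l * x0 i) - a * (cj (x0 i) * l * x0 i) * a))"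
    by (simp add: scaleR_sum_right sum_distrib_left sum_distrib_right sum_subtractf scaleR_diff_right mult.commute)
  also have "\<dots> = (\<Sum>i\<le>n. sg n i *\<^sub>R (cj (x0 i) * x0 i) * \<alpha>)"
  proof (rule sum.cong)
    fix i assume "i \<in> {..n}"
    then have i: "i \<le> n" by simp
    have "a * (cj (x0 i) * l * x0 i) * a = (a * cj (x0 i)) * l * (x0 i * a)" by (simp add: mult.assoc)
    also have "\<dots> = cj (x0 i) * (a * l * a) * x0 i" by (simp add: xa[OF i] xa'[OF i, symmetric] mult.assoc)
    finally have "N *\<^sub>R (cj (x0 i) * l * x0 i) - a * (cj (x0 i) * l * x0 i) * a = cj (x0 i) * (\<alpha> * x0 i)"
      by (simp add: \<alpha>_def left_diff_distrib right_diff_distrib mult.assoc)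
    then show "sg n i *\<^sub>R (N *\<^sub>R (cj (x0 i) * l * x0 i) - a * (cj (x0 i) * l * x0 i) * a) = sg n i *\<^sub>R (cj (x0 i) * x0 i) * \<alpha>"
      by (simp add: x\<alpha>[OF i] mult.assoc)
  qed simp
  also have "\<dots> = hf n x0 x0 * \<alpha>" by (simp add: hf_def sum_distrib_right)
  also have "\<dots> = 0" using null[OF x0(1)] by (simp add: null_vec_def)
  finally have z: "N *\<^sub>R t - a * t * a = 0" .
  have "a * t * a = t * (a * a)" by (simp only: ta[symmetric] mult.assoc)
  also have "\<dots> = - (N *\<^sub>R t)" unfolding aa by simp
  finally have "N *\<^sub>R t + N *\<^sub>R t = 0" using z by simp
  then have "(N + N) *\<^sub>R t = 0" by (simp only: scaleR_add_left)
  then show False using y0(2) a(3) by (simp add: t_def N_def)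
qed

text \<open>The previous lemmas leave S = R or S = R a. Applying \<open>mul\<close> with both outer
  scalars equal to the generator and dividing them off puts every form value on the same line, since
  a^-1 is a multiple of \<open>a\<close>.\<close>

lemma form_values:
  assumes nz: "s0 \<in> S" "s0 \<noteq> 0"
  shows "\<exists>\<sigma>. \<sigma> \<noteq> 0 \<and> (\<sigma> = 1 \<or> cj \<sigma> = - \<sigma>) \<and> (\<forall>x\<in>Orb. \<forall>y\<in>Orb. \<exists>r. hf n x y = r *\<^sub>R \<sigma>)"
proof (cases "\<exists>a\<in>S. cj a = - a \<and> a \<noteq> 0")
  case True
  then obtain a where a: "a \<in> S" "cj a = - a" "a \<noteq> 0" by blast
  have par: "\<exists>r. s = r *\<^sub>R a" if s: "s \<in> S" for s
  proof -
    have "s + cj s \<in> S" using S s S_cj by (simp add: subspace_add)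
    have s2: "s + cj s = (2 * inner s 1) *\<^sub>R 1" by (simp add: cj_def)
    have "inner s 1 = 0"
    proof (rule ccontr)
      assume k: "inner s 1 \<noteq> 0"
      have "inverse (2 * inner s 1) *\<^sub>R (s + cj s) = 1" unfolding s2 using k by simp
      with subspace_scale[OF S \<open>s + cj s \<in> S\<close>, of "inverse (2 * inner s 1)"] have "1 \<in> S" by simp
      then show False by (rule no_real_and_imaginary[OF _ a])
    qed
    with imaginary_parallel[OF a s] show ?thesis by (simp add: cj_neg_iff)
  qed
  have "\<exists>r. hf n x y = r *\<^sub>R a" if xy: "x \<in> Orb" "y \<in> Orb" for x y
  proof -
    obtain r where r: "a * hf n x y * a = r *\<^sub>R a" using par[OF mul[OF a(1) a(1) xy]] by blast
    then have "(a * hf n x y) * a = (r *\<^sub>R 1) * a" by simp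
    then have "a * hf n x y = r *\<^sub>R 1" using a(3) by (metis mult_right_cancel)
    then have "a * (a * hf n x y) = r *\<^sub>R a" by simp
    then have "- ((norm a)\<^sup>2 *\<^sub>R hf n x y) = r *\<^sub>R a"
      unfolding mult.assoc[symmetric] imaginary_square[OF a(2)] by simp
    then have "(norm a)\<^sup>2 *\<^sub>R hf n x y = (- r) *\<^sub>R a" by (metis minus_minus scaleR_minus_left)
    then have "inverse ((norm a)\<^sup>2) *\<^sub>R (norm a)\<^sup>2 *\<^sub>R hf n x y = inverse ((norm a)\<^sup>2) *\<^sub>R (- r) *\<^sub>R a" by (rule arg_cong)
    then have "hf n x y = (inverse ((norm a)\<^sup>2) * (- r)) *\<^sub>R a" using a(3) by simp
    then show ?thesis by blast
  qed
  with a show ?thesis by blast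
next
  case False
  have re: "s = inner s 1 *\<^sub>R 1" if s: "s \<in> S" for s
  proof -
    have "s - cj s \<in> S" using S s S_cj by (simp add: subspace_diff)
    moreover have "cj (s - cj s) = - (s - cj s)" by (simp add: cj_diff)
    ultimately have "s = cj s" using False by auto
    then have "2 *\<^sub>R s = 2 *\<^sub>R (inner s 1 *\<^sub>R 1)" by (simp add: cj_def scaleR_2 eq_diff_eq)
    then show ?thesis by (metis scaleR_cancel_left zero_neq_numeral)
  qed
  obtain r where r: "s0 = r *\<^sub>R 1" "r \<noteq> 0" using re[OF nz(1)] nz(2) by force
  have "\<exists>q. hf n x y = q *\<^sub>R 1" if xy: "x \<in> Orb" "y \<in> Orb" for x y
  proof -
    obtain q where "s0 * hf n x y * s0 = q *\<^sub>R 1" using re[OF mul[OF nz(1) nz(1) xy]] by blast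
    then have "(r * r) *\<^sub>R hf n x y = q *\<^sub>R 1" by (simp add: r)
    then have "inverse (r * r) *\<^sub>R (r * r) *\<^sub>R hf n x y = inverse (r * r) *\<^sub>R q *\<^sub>R 1" by (rule arg_cong)
    moreover have "r * r \<noteq> 0" using r(2) by simp
    ultimately have "hf n x y = (inverse (r * r) * q) *\<^sub>R 1"
      by (simp only: scaleR_scaleR left_inverse scaleR_one not_False_eq_True)
    then show ?thesis by blast
  qed
  then show ?thesis by (intro exI[of _ 1]) simp
qed

end

section \<open>Scalars arising from limits of elements with real trace\<close>

context hyp_group
begin

lemma trace_limit:
  assumes cv: "conv g c (\<lambda>i. \<xi> i * s) \<xi>" and tr: "\<And>A. A \<in> G \<Longrightarrow> cj (mtrace A) = mtrace A" and AB: "A \<in> G" "B \<in> G"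
  shows "cj (trf n (app n A \<xi>) s (app n B \<xi>)) = trf n (app n A \<xi>) s (app n B \<xi>)"
proof -
  \<comment> \<open>This is A * g j * iv B, again in the group; the outer factors of its limit are
    the translates of \<open>\<xi>\<close> by \<open>A\<close> and \<open>B\<close>.\<close>
  define k where "k = (\<lambda>j. iv (B * iv (A * g j)))"
  have "conv k c (app n A (\<lambda>i. \<xi> i * s)) (app n B \<xi>)"
    unfolding k_def by (rule conv_right[OF conv_right[OF cv AB(1)] AB(2)])
  then have k: "conv k c (\<lambda>i. app n A \<xi> i * s) (app n B \<xi>)" by (simp only: app_mult_right)
  have "(\<lambda>j. \<Sum>i\<le>n. c j *\<^sub>R (k j $$ (i,i))) \<longlonglongrightarrow> trf n (app n A \<xi>) s (app n B \<xi>)"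
    unfolding trf_def by (intro tendsto_sum conv_entry[OF k]) auto
  moreover have "(\<Sum>i\<le>n. c j *\<^sub>R (k j $$ (i,i))) = c j *\<^sub>R mtrace (k j)" for j
    using carr[OF conv_G[OF k, of j]] by (simp add: mtrace_def scaleR_sum_right lessThan_Suc_atMost)
  ultimately have l: "(\<lambda>j. c j *\<^sub>R mtrace (k j)) \<longlonglongrightarrow> trf n (app n A \<xi>) s (app n B \<xi>)" by simp
  have "(\<lambda>j. cj (c j *\<^sub>R mtrace (k j))) \<longlonglongrightarrow> cj (trf n (app n A \<xi>) s (app n B \<xi>))" by (rule tendsto_cj[OF l])
  moreover have "cj (c j *\<^sub>R mtrace (k j)) = c j *\<^sub>R mtrace (k j)" for j
    by (simp add: cj_scaleR tr conv_G[OF k])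
  ultimately show ?thesis using l LIMSEQ_unique by simp
qed

lemma real_trace_form:
  assumes tr: "\<And>A. A \<in> G \<Longrightarrow> cj (mtrace A) = mtrace A" and inf: "infinite G"
    and nofix: "\<And>\<theta>. \<not> fixes_line \<theta>"
  shows "\<exists>\<xi> \<sigma>. null_vec n \<xi> \<and> \<sigma> \<noteq> 0 \<and> (\<sigma> = 1 \<or> cj \<sigma> = - \<sigma>) \<and>
    (\<forall>A\<in>G. \<forall>B\<in>G. \<exists>r. hf n (app n A \<xi>) (app n B \<xi>) = r *\<^sub>R \<sigma>) \<and> (\<exists>A\<in>G. hf n \<xi> (app n A \<xi>) \<noteq> 0)"
proof -
  have move: "\<exists>A\<in>G. hf n x (app n A x) \<noteq> 0" if "null_vec n x" for x
    using nofix[of x] that by (auto simp: fixes_line_def)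
  obtain g where "\<And>k. g k \<in> G" "filterlim (\<lambda>k. nn (g k)) at_top sequentially"
    using infinite_unbounded_seq[OF inf] by blast
  from conv_exists[OF this] obtain r \<xi>' \<eta> where \<xi>': "null_vec n \<xi>'" "\<xi>' n = 1" and \<eta>: "null_vec n \<eta>"
    and cv': "conv (\<lambda>k. g (r k)) (\<lambda>k. 1 / nn (g (r k))) \<xi>' \<eta>" by blast
  \<comment> \<open>Applying the identity clears the coordinates beyond \<open>n\<close>, so that
    \<open>\<xi>\<close> is literally a member of its own orbit.\<close>
  define \<xi> where "\<xi> = app n (1\<^sub>m (Suc n)) \<xi>'"
  have \<xi>_eq: "\<xi> i = \<xi>' i" if "i \<le> n" for i using that by (simp add: \<xi>_def app_one)
  have \<xi>: "null_vec n \<xi>" "\<xi> n = 1"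
    using null_app[OF one_in \<xi>'(1)] \<xi>'(2) by (simp_all add: \<xi>_def app_one)
  have \<xi>_one: "app n (1\<^sub>m (Suc n)) \<xi> = \<xi>"
    using \<xi>_eq unfolding \<xi>_def by (intro app_cong)
  have cv: "conv (\<lambda>k. g (r k)) (\<lambda>k. 1 / nn (g (r k))) \<xi> \<eta>"
    by (rule conv_cong[OF cv']) (simp_all add: \<xi>_eq)
  obtain A where A: "A \<in> G" "hf n \<eta> (app n A \<eta>) \<noteq> 0" using move[OF \<eta>] by blast
  obtain B where B: "B \<in> G" "hf n \<xi> (app n B \<xi>) \<noteq> 0" using move[OF \<xi>(1)] by blast
  define S0 where "S0 = {s. \<exists>h d. conv h d (\<lambda>i. \<xi> i * s) \<xi>}"
  define Orb where "Orb = (\<lambda>A. app n A \<xi>) ` G"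
  \<comment> \<open>A nonzero scalar to start from: the limit of g A g^-1, where \<open>A\<close>
    moves the repelling line of \<open>g\<close>.\<close>
  have s0: "hf n \<eta> (app n A \<eta>) \<in> S0"
    unfolding S0_def using conv_mult[OF cv conv_left[OF conv_iv[OF cv] A(1)]] by blast
  have S0_cj: "cj s \<in> S0" if "s \<in> S0" for s
  proof -
    from that obtain h d where "conv h d (\<lambda>i. \<xi> i * s) \<xi>" by (auto simp: S0_def)
    from conv_iv[OF this] have "conv (\<lambda>k. iv (h k)) d \<xi> (\<lambda>i. \<xi> i * cj (cj s))" by simp
    then show ?thesis unfolding S0_def conv_move_scalar[symmetric] by blast
  qed
  have S0_mul: "s * hf n x y * s' \<in> S0" if "s \<in> S0" "s' \<in> S0" and xy: "x \<in> Orb" "y \<in> Orb" for s s' x y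
  proof -
    from that(1,2) obtain h d h' d' where h: "conv h d (\<lambda>i. \<xi> i * s) \<xi>" "conv h' d' (\<lambda>i. \<xi> i * s') \<xi>"
      by (auto simp: S0_def)
    from xy obtain X Y where XY: "X \<in> G" "Y \<in> G" "x = app n X \<xi>" "y = app n Y \<xi>" by (auto simp: Orb_def)
    have "conv (\<lambda>k. h k * (iv X * Y * h' k)) (\<lambda>k. d k * d' k) (\<lambda>i. \<xi> i * s * hf n \<xi> (app n (iv X * Y) (\<lambda>i. \<xi> i * s'))) \<xi>"
      by (rule conv_mult[OF h(1) conv_left[OF h(2)]]) (use XY in simp)
    moreover have "hf n \<xi> (app n (iv X * Y) (\<lambda>i. \<xi> i * s')) = hf n x y * s'"
      using XY by (simp add: app_mult_right hf_mult_right app_mult_G hf_app_left)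
    ultimately have "conv (\<lambda>k. h k * (iv X * Y * h' k)) (\<lambda>k. d k * d' k) (\<lambda>i. \<xi> i * (s * hf n x y * s')) \<xi>"
      by (simp add: mult.assoc)
    then show ?thesis unfolding S0_def by blast
  qed
  have "trace_core n (span S0) Orb \<xi> (app n B \<xi>)"
  proof
    show "subspace (span S0)" by (rule subspace_span)
    show "null_vec n x" if "x \<in> Orb" for x using that \<xi> by (auto simp: Orb_def intro: null_app)
    show "\<xi> n = 1" "hf n \<xi> (app n B \<xi>) \<noteq> 0" by fact+
    show "app n B \<xi> \<in> Orb" using B by (simp add: Orb_def)
    show "cj s \<in> span S0" if "s \<in> span S0" for s
      using that by (induction rule: span_induct_alt)
        (auto simp: cj_add cj_scaleR intro: span_add span_scale span_base S0_cj span_zero)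
    show "cj (trf n x s y) = trf n x s y" if "s \<in> span S0" and xy: "x \<in> Orb" "y \<in> Orb" for s x y
      using that(1)
    proof (induction rule: span_induct_alt)
      case base
      then show ?case by (simp add: trf_def)
    next
      case (step c s0 s)
      have "trf n x (c *\<^sub>R s0 + s) y = c *\<^sub>R trf n x s0 y + trf n x s y"
        by (simp add: trf_def distrib_left distrib_right scaleR_add_right sum.distrib scaleR_sum_right mult.commute)
      moreover have "cj (trf n x s0 y) = trf n x s0 y"
        using step(1) xy trace_limit[OF _ tr] unfolding S0_def Orb_def by blast
      ultimately show ?case using step by (simp add: cj_add cj_scaleR)
    qed
    show "s * hf n x y * s' \<in> span S0" if "s \<in> span S0" "s' \<in> span S0" and xy: "x \<in> Orb" "y \<in> Orb" for s s' x y
    proof -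
      have 1: "s * hf n x y * s' \<in> span S0" if "s \<in> S0" "s' \<in> span S0" for s s'
        using that(2)
      proof (induction rule: span_induct_alt)
        case (step c s1 s2)
        then show ?case using S0_mul[OF that(1) step(1) xy]
          by (simp add: distrib_left span_add span_scale span_base)
      qed (simp add: span_zero)
      from that(1) show ?thesis
      proof (induction rule: span_induct_alt)
        case (step c s1 s2)
        then show ?case using 1[OF step(1) that(2)] by (simp add: distrib_right span_add span_scale)
      qed (simp add: span_zero)
    qed
    show "\<xi> \<in> Orb" unfolding Orb_def using \<xi>_one by (intro image_eqI[OF _ one_in]) simp
  qed
  from trace_core.form_values[OF this span_base[OF s0] A(2)] \<xi> B show ?thesis
    unfolding Orb_def by blast
qed

end

section \<open>Real forms\<close>

text \<open>Gaussian elimination in a division ring. The unknowns stand to the right of the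
  coefficients, so the pivot is inverted from the left.\<close>

lemma homogeneous_solution:
  fixes A :: "'i \<Rightarrow> 'j \<Rightarrow> 'a::division_ring"
  assumes "finite R" "finite C" "card R < card C"
  shows "\<exists>q. (\<exists>j\<in>C. q j \<noteq> 0) \<and> (\<forall>i\<in>R. (\<Sum>j\<in>C. A i j * q j) = 0)"
  using assms
proof (induction R arbitrary: A C)
  case empty
  then obtain j where "j \<in> C" by (metis card.empty card_gt_0_iff ex_in_conv)
  then show ?case by (intro exI[of _ "\<lambda>_. 1"]) auto
next
  case (insert x R)
  show ?case
  proof (cases "\<forall>j\<in>C. A x j = 0")
    case True
    obtain q where q: "\<exists>j\<in>C. q j \<noteq> 0" "\<forall>i\<in>R. (\<Sum>j\<in>C. A i j * q j) = 0"
      using insert.IH[of C A] insert.prems insert.hyps by auto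
    with True show ?thesis by (intro exI[of _ q]) simp
  next
    case False
    then obtain c where c: "c \<in> C" "A x c \<noteq> 0" by blast
    define B where "B i j = A i j - A i c * (inverse (A x c) * A x j)" for i j
    have "card R < card (C - {c})" using insert.prems insert.hyps c by simp
    then obtain q where q: "\<exists>j\<in>C - {c}. q j \<noteq> 0" "\<forall>i\<in>R. (\<Sum>j\<in>C - {c}. B i j * q j) = 0"
      using insert.IH[of "C - {c}" B] insert.prems by auto
    define s where "s = (\<Sum>j\<in>C - {c}. A x j * q j)"
    define p where "p = q(c := - (inverse (A x c) * s))"
    have sum: "(\<Sum>j\<in>C. A i j * p j) = (\<Sum>j\<in>C - {c}. A i j * q j) - A i c * (inverse (A x c) * s)" for i
    proof -
      have "(\<Sum>j\<in>C. A i j * p j) = A i c * p c + (\<Sum>j\<in>C - {c}. A i j * p j)"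
        using insert.prems c(1) by (intro sum.remove) auto
      moreover have "(\<Sum>j\<in>C - {c}. A i j * p j) = (\<Sum>j\<in>C - {c}. A i j * q j)"
        by (intro sum.cong) (auto simp: p_def)
      ultimately show ?thesis by (simp add: p_def)
    qed
    have "(\<Sum>j\<in>C. A i j * p j) = 0" if i: "i \<in> R" for i
    proof -
      have "(\<Sum>j\<in>C - {c}. B i j * q j) = (\<Sum>j\<in>C - {c}. A i j * q j) - A i c * (inverse (A x c) * s)"
        by (simp add: B_def s_def left_diff_distrib sum_subtractf sum_distrib_left mult.assoc)
      with q(2) i show ?thesis by (simp add: sum)
    qed
    moreover have "(\<Sum>j\<in>C. A x j * p j) = 0"
      using c(2) by (simp add: sum s_def[symmetric] mult.assoc[symmetric])
    moreover have "\<exists>j\<in>C. p j \<noteq> 0" using q(1) by (auto simp: p_def)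
    ultimately show ?thesis by (intro exI[of _ p]) simp
  qed
qed

text \<open>The complement of a negative vector is positive definite: orthogonality and
  Cauchy-Schwarz bound |v_n w_n|^2 by (|v_n|^2 - 1) b, where b is the squared length of the first n
  coordinates of \<open>w\<close>.\<close>

lemma orthogonal_to_negative:
  fixes w :: "nat \<Rightarrow> 'a::hyp_scalar"
  assumes v: "hf n v v = - 1" and vw: "hf n v w = 0" and w: "l \<le> n" "w l \<noteq> 0"
  shows "\<exists>s>0. hf n w w = of_real s"
proof -
  define a b where "a = (\<Sum>i<n. (norm (v i))\<^sup>2)" and "b = (\<Sum>i<n. (norm (w i))\<^sup>2)"
  have "of_real (a - (norm (v n))\<^sup>2) = (of_real (- 1) :: 'a)" using v hf_self[of n v] by (simp add: a_def)
  then have a: "a = (norm (v n))\<^sup>2 - 1" by (simp only: of_real_eq_iff)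
  have a0: "0 \<le> a" and b0: "0 \<le> b" by (auto simp: a_def b_def intro: sum_nonneg)
  have "cj (v n) * w n = (\<Sum>i<n. cj (v i) * w i)" using vw by (simp add: hf_split)
  then have "norm (v n) * norm (w n) = norm (\<Sum>i<n. cj (v i) * w i)" by (metis norm_mult norm_cj)
  also have "\<dots> \<le> (\<Sum>i<n. norm (v i) * norm (w i))"
    by (rule order_trans[OF norm_sum]) (simp add: norm_mult)
  finally have "(norm (v n) * norm (w n))\<^sup>2 \<le> (\<Sum>i<n. norm (v i) * norm (w i))\<^sup>2" by (intro power_mono) auto
  also have "\<dots> \<le> a * b" unfolding a_def b_def by (rule Cauchy_Schwarz_ineq_sum)
  finally have le: "(norm (v n))\<^sup>2 * (norm (w n))\<^sup>2 \<le> ((norm (v n))\<^sup>2 - 1) * b" by (simp add: power_mult_distrib a)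
  have "b > 0"
  proof (rule ccontr)
    assume "\<not> b > 0"
    with b0 have "b = 0" by simp
    then have "\<forall>i\<in>{..<n}. (norm (w i))\<^sup>2 = 0" unfolding b_def by (subst (asm) sum_nonneg_eq_0_iff) auto
    then have z: "\<forall>i<n. w i = 0" by simp
    have "(norm (v n))\<^sup>2 * (norm (w n))\<^sup>2 \<le> 0" using le \<open>b = 0\<close> by simp
    moreover have "(norm (v n))\<^sup>2 > 0" using a a0 by linarith
    ultimately have "w n = 0" by (simp add: mult_le_0_iff)
    with z w show False by (metis le_neq_implies_less)
  qed
  have "0 < (norm (v n))\<^sup>2 * (b - (norm (w n))\<^sup>2)" using le \<open>b > 0\<close> by (simp add: algebra_simps)
  then have "0 < b - (norm (w n))\<^sup>2" by (metis zero_le_power2 zero_less_mult_pos less_le mult_eq_0_iff)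
  then show ?thesis unfolding hf_self b_def[symmetric] by blast
qed

text \<open>A real form: vectors \<open>e i\<close> whose real span \<open>V\<close> is invariant, with real coordinate
  functionals \<open>D i\<close>.\<close>

locale real_frame = hyp_group n G for n and G :: "'a::hyp_scalar mat set" +
  fixes V :: "(nat \<Rightarrow> 'a) set" and I :: "nat set" and e :: "nat \<Rightarrow> nat \<Rightarrow> 'a" and D :: "nat \<Rightarrow> (nat \<Rightarrow> 'a) \<Rightarrow> real"
  assumes fin: "finite I" and e: "\<And>i. i \<in> I \<Longrightarrow> e i \<in> V"
    and inv: "\<And>A v. A \<in> G \<Longrightarrow> v \<in> V \<Longrightarrow> app n A v \<in> V"
    and expand: "\<And>v l. v \<in> V \<Longrightarrow> l \<le> n \<Longrightarrow> v l = (\<Sum>i\<in>I. D i v *\<^sub>R e i l)"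
    and D_cong: "\<And>i v w. (\<And>l. l \<le> n \<Longrightarrow> v l = w l) \<Longrightarrow> D i v = D i w"
    and D_sum: "\<And>i c v. D i (\<lambda>l. \<Sum>k\<in>I. c k *\<^sub>R v k l) = (\<Sum>k\<in>I. c k * D i (v k))"
    and two: "\<exists>x\<in>V. \<exists>y\<in>V. null_vec n x \<and> null_vec n y \<and> hf n x y \<noteq> 0"
begin

definition coef :: "'a mat \<Rightarrow> nat \<Rightarrow> nat \<Rightarrow> real" where "coef A i j = D i (app n A (e j))"

lemma app_frame: "A \<in> G \<Longrightarrow> v \<in> V \<Longrightarrow> l \<le> n \<Longrightarrow> app n A v l = (\<Sum>j\<in>I. D j v *\<^sub>R app n A (e j) l)"
proof -
  assume A: "A \<in> G" "v \<in> V" "l \<le> n"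
  have "app n A v = app n A (\<lambda>l. \<Sum>j\<in>I. D j v *\<^sub>R e j l)" by (rule app_cong) (rule expand[OF A(2)])
  also have "\<dots> = (\<lambda>l. \<Sum>j\<in>I. D j v *\<^sub>R app n A (e j) l)" by (simp only: app_sum app_scaleR)
  finally show ?thesis by simp
qed

lemma coef_mult:
  assumes "A \<in> G" "B \<in> G" "j \<in> I"
  shows "coef (A * B) i j = (\<Sum>l\<in>I. coef A i l * coef B l j)"
proof -
  have "coef (A * B) i j = D i (app n A (app n B (e j)))" using assms by (simp add: coef_def app_mult_G)
  also have "\<dots> = D i (\<lambda>l. \<Sum>k\<in>I. D k (app n B (e j)) *\<^sub>R app n A (e k) l)"
    by (rule D_cong) (rule app_frame[OF assms(1) inv[OF assms(2) e[OF assms(3)]]])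
  also have "\<dots> = (\<Sum>l\<in>I. coef A i l * coef B l j)" by (simp add: D_sum coef_def mult.commute)
  finally show ?thesis .
qed

text \<open>If infinitely many elements had bounded coefficients, a rescaled rank-one limit would
  kill all of \<open>V\<close>. Its second factor would then coincide with two different boundary
  points of \<open>V\<close>.\<close>

lemma coef_proper: "finite {A \<in> G. \<forall>i\<in>I. \<forall>j\<in>I. \<bar>coef A i j\<bar> \<le> K}"
proof (rule ccontr)
  assume "infinite {A \<in> G. \<forall>i\<in>I. \<forall>j\<in>I. \<bar>coef A i j\<bar> \<le> K}"
  then obtain g where g: "\<And>k. g k \<in> {A \<in> G. \<forall>i\<in>I. \<forall>j\<in>I. \<bar>coef A i j\<bar> \<le> K}"
    and lim: "filterlim (\<lambda>k. nn (g k)) at_top sequentially"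
    using infinite_unbounded_seq by blast
  have gG: "\<And>k. g k \<in> G" using g by blast
  obtain r \<zeta> \<eta> where \<zeta>: "\<zeta> n = 1" and \<eta>: "null_vec n \<eta>" and cv: "conv (\<lambda>k. g (r k)) (\<lambda>k. 1 / nn (g (r k))) \<zeta> \<eta>"
    using conv_exists[OF gG lim] by blast
  have "hf n \<eta> v = 0" if v: "v \<in> V" for v
  proof -
    define M where "M = (\<Sum>j\<in>I. \<bar>D j v\<bar> * (\<Sum>i\<in>I. K * norm (e i n)))"
    have bound: "norm (app n (g k) v n) \<le> M" for k
    proof -
      have "norm (app n (g k) v n) \<le> (\<Sum>j\<in>I. \<bar>D j v\<bar> * norm (app n (g k) (e j) n))"
        unfolding app_frame[OF gG v order_refl] by (rule order_trans[OF norm_sum]) simp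
      also have "\<dots> \<le> M" unfolding M_def
      proof (intro sum_mono mult_left_mono)
        fix j assume j: "j \<in> I"
        have "norm (app n (g k) (e j) n) \<le> (\<Sum>i\<in>I. norm (coef (g k) i j *\<^sub>R e i n))"
          unfolding expand[OF inv[OF gG e[OF j]] order_refl] coef_def by (rule norm_sum)
        also have "\<dots> \<le> (\<Sum>i\<in>I. K * norm (e i n))"
          using g[of k] j by (intro sum_mono) (simp add: mult_right_mono)
        finally show "norm (app n (g k) (e j) n) \<le> (\<Sum>i\<in>I. K * norm (e i n))" .
      qed simp
      finally show ?thesis .
    qed
    have "(\<lambda>k. (1 / nn (g (r k))) *\<^sub>R app n (g (r k)) v n) \<longlonglongrightarrow> \<zeta> n * hf n \<eta> v"
      by (intro conv_app[OF cv] tendsto_const order_refl)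
    moreover have "(\<lambda>k. (1 / nn (g (r k))) *\<^sub>R app n (g (r k)) v n) \<longlonglongrightarrow> 0"
    proof (rule Lim_null_comparison)
      show "(\<lambda>k. 1 / nn (g (r k)) * M) \<longlonglongrightarrow> 0" using tendsto_mult_right[OF conv_0[OF cv], of M] by simp
      show "\<forall>\<^sub>F k in sequentially. norm ((1 / nn (g (r k))) *\<^sub>R app n (g (r k)) v n) \<le> 1 / nn (g (r k)) * M"
      proof (intro always_eventually allI)
        fix k
        have "norm ((1 / nn (g (r k))) *\<^sub>R app n (g (r k)) v n) = 1 / nn (g (r k)) * norm (app n (g (r k)) v n)"
          using conv_pos[OF cv, of k] by simp
        also have "\<dots> \<le> 1 / nn (g (r k)) * M"
          using conv_pos[OF cv, of k] by (intro mult_left_mono bound) simp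
        finally show "norm ((1 / nn (g (r k))) *\<^sub>R app n (g (r k)) v n) \<le> 1 / nn (g (r k)) * M" .
      qed
    qed
    ultimately show ?thesis using \<zeta> LIMSEQ_unique by fastforce
  qed
  with two null_vec_not_both[OF _ _ _ \<eta>] show False by blast
qed

end

section \<open>The two real forms: Lorentzian and symplectic orbit spans\<close>

context hyp_group
begin

inductive_set real_span :: "(nat \<Rightarrow> 'a) \<Rightarrow> (nat \<Rightarrow> 'a) set" for \<xi> where
  base: "A \<in> G \<Longrightarrow> app n A \<xi> \<in> real_span \<xi>"
| add: "v \<in> real_span \<xi> \<Longrightarrow> w \<in> real_span \<xi> \<Longrightarrow> (\<lambda>i. v i + w i) \<in> real_span \<xi>"
| scale: "v \<in> real_span \<xi> \<Longrightarrow> (\<lambda>i. r *\<^sub>R v i) \<in> real_span \<xi>"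

lemma real_span_diff: "v \<in> real_span \<xi> \<Longrightarrow> w \<in> real_span \<xi> \<Longrightarrow> (\<lambda>i. v i - w i) \<in> real_span \<xi>"
  using real_span.add[OF _ real_span.scale[of w \<xi> "-1"], of v] by simp

lemma real_span_sum:
  "finite K \<Longrightarrow> (\<And>k. k \<in> K \<Longrightarrow> v k \<in> real_span \<xi>) \<Longrightarrow> (\<lambda>i. \<Sum>k\<in>K. c k *\<^sub>R v k i) \<in> real_span \<xi>"
proof (induction K rule: finite_induct)
  case empty
  show ?case using real_span.scale[where r = 0, OF real_span.base[OF one_in, of \<xi>]] by simp
next
  case (insert x K)
  then show ?case using real_span.add[OF real_span.scale[of "v x" \<xi> "c x"]] by simp
qed

lemma real_span_app: "v \<in> real_span \<xi> \<Longrightarrow> A \<in> G \<Longrightarrow> app n A v \<in> real_span \<xi>"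
proof (induction rule: real_span.induct)
  case (base B)
  then show ?case using real_span.base[of "A * B" \<xi>] by (simp add: app_mult_G)
qed (simp_all add: app_add app_scaleR real_span.intros)

lemma real_span_hf:
  assumes "\<And>A B. A \<in> G \<Longrightarrow> B \<in> G \<Longrightarrow> \<exists>r. hf n (app n A \<xi>) (app n B \<xi>) = r *\<^sub>R \<sigma>"
    and v: "v \<in> real_span \<xi>" and w: "w \<in> real_span \<xi>"
  shows "\<exists>r. hf n v w = r *\<^sub>R \<sigma>"
  using v
proof (induction rule: real_span.induct)
  case (base A)
  from w show ?case
  proof (induction rule: real_span.induct)
    case (base B)
    with assms(1)[OF \<open>A \<in> G\<close>] show ?case by blast
  next
    case (add v w)
    then show ?case by (metis hf_add_right scaleR_add_left)
  next
    case (scale v r)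
    then show ?case by (metis hf_scaleR_right scaleR_scaleR)
  qed
next
  case (add v w)
  then show ?case by (metis hf_add_left scaleR_add_left)
next
  case (scale v r)
  then show ?case by (metis hf_scaleR_left scaleR_scaleR)
qed

definition orthonormal :: "(nat \<Rightarrow> 'a) \<Rightarrow> nat \<Rightarrow> (nat \<Rightarrow> nat \<Rightarrow> 'a) \<Rightarrow> bool" where
  "orthonormal v m f \<longleftrightarrow> hf n v v = - 1 \<and> (\<forall>i<m. hf n v (f i) = 0) \<and>
     (\<forall>i<m. \<forall>j<m. hf n (f i) (f j) = (if i = j then 1 else 0))"

text \<open>Together with \<open>v\<close> these are m + 1 independent vectors in dimension n + 1; a
  linear relation would be killed by pairing with one member.\<close>

lemma orthonormal_le:
  assumes "orthonormal v m f"
  shows "m \<le> n"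
proof (rule ccontr)
  assume "\<not> m \<le> n"
  define g where "g j = (if j = m then v else f j)" for j
  have g: "hf n (g i) (g j) = (if i = j then (if i = m then - 1 else 1) else 0)" if "i \<le> m" "j \<le> m" for i j
    using assms that hf_0_sym unfolding orthonormal_def g_def by (auto simp: le_less)
  have "card {..n} < card {..m}" using \<open>\<not> m \<le> n\<close> by simp
  from homogeneous_solution[OF _ _ this, of "\<lambda>i j. g j i"] obtain q j where j: "j \<le> m" "q j \<noteq> 0"
    and q: "\<And>i. i \<le> n \<Longrightarrow> (\<Sum>j\<le>m. g j i * q j) = 0" by auto
  have "hf n (g j) (\<lambda>i. \<Sum>k\<le>m. g k i * q k) = hf n (g j) (\<lambda>i. 0)" by (intro hf_cong q refl)
  then have "(\<Sum>k\<le>m. hf n (g j) (g k) * q k) = 0" unfolding hf_sum_right hf_mult_right by (simp add: hf_def)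
  moreover have "(\<Sum>k\<le>m. hf n (g j) (g k) * q k) = (\<Sum>k\<in>{j}. hf n (g j) (g k) * q k)"
    using j by (intro sum.mono_neutral_right) (auto simp: g)
  ultimately show False using j by (simp add: g split: if_splits)
qed

text \<open>Two null vectors of the span give a vector \<open>v\<close> of norm -1, placed at index
  \<open>n\<close>. A maximal orthonormal family in its complement spans the rest, because any
  remainder is a positive vector that could be normalized and added.\<close>

lemma real_frame_real:
  assumes \<xi>: "null_vec n \<xi>" and form: "\<And>A B. A \<in> G \<Longrightarrow> B \<in> G \<Longrightarrow> \<exists>r. hf n (app n A \<xi>) (app n B \<xi>) = r *\<^sub>R 1"
    and B: "B \<in> G" "hf n \<xi> (app n B \<xi>) \<noteq> 0"
  shows "\<exists>m e D. m \<le> n \<and> real_frame n G (real_span \<xi>) ({..<m} \<union> {n}) e D \<and>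
     (\<forall>i\<in>{..<m} \<union> {n}. \<forall>j\<in>{..<m} \<union> {n}. hf n (e i) (e j) = (if i = j then of_real (sg n i) else 0))"
proof -
  have fv: "\<exists>r. hf n v w = r *\<^sub>R 1" if "v \<in> real_span \<xi>" "w \<in> real_span \<xi>" for v w
    by (rule real_span_hf[OF _ that]) (rule form)
  let ?V = "real_span \<xi>"
  define x where "x = app n (1\<^sub>m (Suc n)) \<xi>"
  define y where "y = app n B \<xi>"
  have xy: "x \<in> ?V" "y \<in> ?V" "null_vec n x" "null_vec n y"
    using B \<xi> by (auto simp: x_def y_def intro: real_span.base null_app)
  have "hf n x y = hf n \<xi> y" by (intro hf_cong) (auto simp: x_def app_one)
  then have hxy: "hf n x y \<noteq> 0" using B by (simp add: y_def)
  obtain t where t: "hf n x y = t *\<^sub>R 1" using fv[OF xy(1,2)] by blast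
  have t0: "t \<noteq> 0" using hxy t by auto
  have t': "hf n y x = t *\<^sub>R 1" using cj_hf[of n x y] t by (simp add: cj_scaleR)
  \<comment> \<open>Then x + c y has form norm 2 c t = -1, as \<open>x\<close> and \<open>y\<close>
    are null.\<close>
  define c where "c = - 1 / (2 * t)"
  define v where "v = (\<lambda>i. x i + c *\<^sub>R y i)"
  have vV: "v \<in> ?V" unfolding v_def by (intro real_span.add real_span.scale xy)
  have "hf n v v = (c * t + c * t) *\<^sub>R 1"
    using xy(3,4) unfolding scaleR_add_left
    by (simp add: v_def hf_add_left hf_add_right hf_scaleR_left hf_scaleR_right t t' null_vec_def)
  moreover have "c * t + c * t = - 1" using t0 by (simp add: c_def)
  ultimately have hv: "hf n v v = - 1" by simp
  define P where "P m \<longleftrightarrow> (\<exists>f. orthonormal v m f \<and> (\<forall>i<m. f i \<in> ?V))" for m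
  have "P 0" using hv by (auto simp: P_def orthonormal_def)
  have "\<exists>m. P m \<and> \<not> P (Suc m)"
  proof (rule ccontr)
    assume "\<not> ?thesis"
    then have "P m" for m using \<open>P 0\<close> by (induction m) auto
    then have "P (Suc n)" by blast
    then show False using orthonormal_le unfolding P_def by fastforce
  qed
  then obtain m f where f: "orthonormal v m f" "\<And>i. i < m \<Longrightarrow> f i \<in> ?V" and max: "\<not> P (Suc m)"
    unfolding P_def by blast
  have m: "m \<le> n" by (rule orthonormal_le[OF f(1)])
  define e where "e i = (if i < m then f i else v)" for i
  let ?I = "{..<m} \<union> {n}"
  define D where "D i w = sg n i * inner (hf n (e i) w) 1" for i w
  have eV: "e i \<in> ?V" for i using f(2) vV by (simp add: e_def)
  have ee: "hf n (e i) (e j) = (if i = j then of_real (sg n i) else 0)" if "i \<in> ?I" "j \<in> ?I" for i j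
    using f(1) m that hf_0_sym unfolding orthonormal_def e_def by (auto simp: hv)
  have De: "hf n (e i) w = (sg n i * D i w) *\<^sub>R 1" if w: "w \<in> ?V" for i w
  proof -
    obtain r where "hf n (e i) w = r *\<^sub>R 1" using fv[OF eV w] by blast
    then show ?thesis by (simp add: D_def)
  qed
  have expand: "w l = (\<Sum>i\<in>?I. D i w *\<^sub>R e i l)" if w: "w \<in> ?V" and l: "l \<le> n" for w l
  proof (rule ccontr)
    assume ne: "w l \<noteq> (\<Sum>i\<in>?I. D i w *\<^sub>R e i l)"
    define u where "u = (\<lambda>l. w l - (\<Sum>i\<in>?I. D i w *\<^sub>R e i l))"
    have uV: "u \<in> ?V" unfolding u_def by (intro real_span_diff w real_span_sum eV) simp
    have eu: "hf n (e j) u = 0" if j: "j \<in> ?I" for j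
    proof -
      have "hf n (e j) (\<lambda>l. \<Sum>i\<in>?I. D i w *\<^sub>R e i l) = (\<Sum>i\<in>?I. D i w *\<^sub>R hf n (e j) (e i))"
        by (simp only: hf_sum_right hf_scaleR_right)
      also have "\<dots> = (\<Sum>i\<in>{j}. D i w *\<^sub>R hf n (e j) (e i))"
        using j ee by (intro sum.mono_neutral_right) auto
      also have "\<dots> = hf n (e j) w" using ee[OF j j] by (simp add: De[OF w] of_real_def mult.commute)
      finally show ?thesis by (simp add: u_def hf_diff_right)
    qed
    have "hf n v u = 0" using eu[of n] m by (simp add: e_def)
    then obtain s where s: "s > 0" "hf n u u = of_real s"
      using orthogonal_to_negative[OF hv _ l, of u] ne by (auto simp: u_def)
    define g where "g = f(m := (\<lambda>l. inverse (sqrt s) *\<^sub>R u l))"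
    have fu: "hf n (f i) u = 0" "hf n u (f i) = 0" if "i < m" for i
      using eu[of i] that hf_0_sym by (auto simp: e_def)
    have "inverse (sqrt s) * (inverse (sqrt s) * s) = 1" using s(1) by (simp add: field_simps)
    then have "orthonormal v (Suc m) g"
      using f(1) fu \<open>hf n v u = 0\<close> s unfolding orthonormal_def g_def
      by (auto simp: less_Suc_eq hf_scaleR_left hf_scaleR_right of_real_def)
    moreover have "g i \<in> ?V" if "i < Suc m" for i
      using that f(2) uV by (auto simp: g_def less_Suc_eq intro: real_span.scale)
    ultimately have "P (Suc m)" by (auto simp: P_def)
    with max show False by simp
  qed
  have "real_frame n G ?V ?I e D"
  proof
    show "finite ?I" by simp
    show "D i v = D i w" if "\<And>l. l \<le> n \<Longrightarrow> v l = w l" for i v w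
      unfolding D_def using hf_cong[of n "e i" "e i" v w] that by simp
    show "D i (\<lambda>l. \<Sum>k\<in>?I. c k *\<^sub>R v k l) = (\<Sum>k\<in>?I. c k * D i (v k))" for i c v
      unfolding D_def hf_sum_right hf_scaleR_right inner_sum_left sum_distrib_left
      by (intro sum.cong refl) simp
    show "\<exists>x\<in>?V. \<exists>y\<in>?V. null_vec n x \<and> null_vec n y \<and> hf n x y \<noteq> 0" using xy hxy by blast
    show "e i \<in> ?V" if "i \<in> ?I" for i by (rule eV)
    show "app n A v \<in> ?V" if "A \<in> G" "v \<in> ?V" for A v by (rule real_span_app[OF that(2,1)])
    show "v l = (\<Sum>i\<in>?I. D i v *\<^sub>R e i l)" if "v \<in> ?V" "l \<le> n" for v l by (rule expand[OF that])
  qed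
  with m ee show ?thesis by blast
qed

text \<open>A Hermitian form with imaginary values is alternating over the reals, so every vector of
  the span is isotropic. A vector orthogonal to both \<open>x\<close> and \<open>y\<close> would be
  a null vector on two different lines, so the span is a plane, and preserving the area form
  \<open>k\<close> means determinant 1.\<close>

lemma real_frame_imaginary:
  assumes \<xi>: "null_vec n \<xi>" and \<sigma>: "\<sigma> \<noteq> 0" "cj \<sigma> = - \<sigma>"
    and form: "\<And>A B. A \<in> G \<Longrightarrow> B \<in> G \<Longrightarrow> \<exists>r. hf n (app n A \<xi>) (app n B \<xi>) = r *\<^sub>R \<sigma>"
    and B: "B \<in> G" "hf n \<xi> (app n B \<xi>) \<noteq> 0"
  shows "\<exists>e D. real_frame n G (real_span \<xi>) {0, 1} e D \<and>
    (\<forall>A\<in>G. real_frame.coef n e D A 0 0 * real_frame.coef n e D A 1 1 - real_frame.coef n e D A 0 1 * real_frame.coef n e D A 1 0 = 1)"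
proof -
  have fv: "\<exists>r. hf n v w = r *\<^sub>R \<sigma>" if "v \<in> real_span \<xi>" "w \<in> real_span \<xi>" for v w
    by (rule real_span_hf[OF _ that]) (rule form)
  let ?V = "real_span \<xi>"
  define x where "x = app n (1\<^sub>m (Suc n)) \<xi>"
  define y where "y = app n B \<xi>"
  have xy: "x \<in> ?V" "y \<in> ?V" "null_vec n x" "null_vec n y"
    using B \<xi> by (auto simp: x_def y_def intro: real_span.base null_app)
  have "hf n x y = hf n \<xi> y" by (intro hf_cong) (auto simp: x_def app_one)
  then have hxy: "hf n x y \<noteq> 0" using B by (simp add: y_def)
  define k where "k = hf n x y"
  have k0: "k \<noteq> 0" using hxy by (simp add: k_def)
  obtain t where t: "k = t *\<^sub>R \<sigma>" using fv[OF xy(1,2)] by (auto simp: k_def)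
  have ck: "cj k = - k" by (simp add: t cj_scaleR \<sigma>)
  have fk: "\<exists>r. hf n u w = r *\<^sub>R k" if uw: "u \<in> ?V" "w \<in> ?V" for u w
  proof -
    obtain r where "hf n u w = r *\<^sub>R \<sigma>" using fv[OF uw] by blast
    moreover have "t \<noteq> 0" using k0 t by auto
    ultimately have "hf n u w = (r / t) *\<^sub>R k" by (simp add: t)
    then show ?thesis by blast
  qed
  define N where "N = inner k k"
  have N: "N > 0" using k0 by (simp add: N_def)
  have yx: "hf n y x = - k" using cj_hf[of n x y] ck by (simp add: k_def)
  have xx: "hf n x x = 0" "hf n y y = 0" using xy by (auto simp: null_vec_def)
  define e where "e i = (if i = 0 then x else y)" for i :: nat
  \<comment> \<open>For w = p x + q y, pairing with \<open>y\<close> gives -p k and pairing with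
    \<open>x\<close> gives q k.\<close>
  define D where "D i w = (if i = 0 then - inner (hf n y w) k / N else inner (hf n x w) k / N)" for i :: nat and w
  have eV: "e i \<in> ?V" for i using xy by (simp add: e_def)
  have yw: "hf n y w = (- D 0 w) *\<^sub>R k" and xw: "hf n x w = D 1 w *\<^sub>R k" if w: "w \<in> ?V" for w
  proof -
    obtain r where "hf n y w = r *\<^sub>R k" using fk[OF xy(2) w] by blast
    then show "hf n y w = (- D 0 w) *\<^sub>R k" using N by (simp add: D_def N_def)
    obtain r where "hf n x w = r *\<^sub>R k" using fk[OF xy(1) w] by blast
    then show "hf n x w = D 1 w *\<^sub>R k" using N by (simp add: D_def N_def)
  qed
  have self: "hf n w w = 0" if w: "w \<in> ?V" for w
  proof -
    obtain r where r: "hf n w w = r *\<^sub>R k" using fk[OF w w] by blast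
    then have "hf n w w = - hf n w w" using cj_hf[of n w w] by (simp add: cj_scaleR ck)
    then show ?thesis by (rule eq_minus_self)
  qed
  have expand: "w l = (\<Sum>i\<in>{0,1}. D i w *\<^sub>R e i l)" if w: "w \<in> ?V" and l: "l \<le> n" for w l
  proof (rule ccontr)
    assume ne: "w l \<noteq> (\<Sum>i\<in>{0,1}. D i w *\<^sub>R e i l)"
    define u where "u = (\<lambda>l. w l - (D 0 w *\<^sub>R x l + D 1 w *\<^sub>R y l))"
    have uV: "u \<in> ?V" unfolding u_def by (intro real_span_diff w real_span.add real_span.scale xy)
    have "null_vec n u" using self[OF uV] ne l by (auto simp: null_vec_def u_def e_def)
    moreover have "hf n x u = 0" "hf n y u = 0"
      unfolding u_def hf_diff_right hf_add_right hf_scaleR_right xx yx k_def[symmetric] xw[OF w] yw[OF w] by simp_all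
    then have "hf n u x = 0" "hf n u y = 0" using hf_0_sym by blast+
    ultimately show False using null_vec_not_both[OF xy(3,4) hxy] by blast
  qed
  have frame: "real_frame n G ?V {0,1} e D"
  proof
    show "D i v = D i w" if "\<And>l. l \<le> n \<Longrightarrow> v l = w l" for i v w
      unfolding D_def using hf_cong[of n y y v w] hf_cong[of n x x v w] that by simp
    show "D i (\<lambda>l. \<Sum>k\<in>{0, 1 :: nat}. c k *\<^sub>R v k l) = (\<Sum>k\<in>{0, 1 :: nat}. c k * D i (v k))" for i c v
      unfolding D_def hf_sum_right hf_scaleR_right
      by (simp add: inner_add_left add_divide_distrib diff_divide_distrib)
    show "\<exists>x\<in>?V. \<exists>y\<in>?V. null_vec n x \<and> null_vec n y \<and> hf n x y \<noteq> 0" using xy hxy by blast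
    show "finite {0, 1 :: nat}" by simp
    show "e i \<in> ?V" if "i \<in> {0, 1}" for i by (rule eV)
    show "app n A v \<in> ?V" if "A \<in> G" "v \<in> ?V" for A v by (rule real_span_app[OF that(2,1)])
    show "v l = (\<Sum>i\<in>{0, 1}. D i v *\<^sub>R e i l)" if "v \<in> ?V" "l \<le> n" for v l by (rule expand[OF that])
  qed
  interpret F: real_frame n G ?V "{0,1}" e D by (rule frame)
  have "F.coef A 0 0 * F.coef A 1 1 - F.coef A 0 1 * F.coef A 1 0 = 1" if A: "A \<in> G" for A
  proof -
    have "app n A (e j) l = F.coef A 0 j *\<^sub>R x l + F.coef A 1 j *\<^sub>R y l" if "l \<le> n" for j l
      using expand[OF real_span_app[OF eV A] that] by (simp add: F.coef_def e_def)
    note c = this[of _ 0] this[of _ 1]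
    have "k = hf n (app n A (e 0)) (app n A (e 1))" using A by (simp add: e_def k_def)
    also have "\<dots> = hf n (\<lambda>l. F.coef A 0 0 *\<^sub>R x l + F.coef A 1 0 *\<^sub>R y l) (\<lambda>l. F.coef A 0 1 *\<^sub>R x l + F.coef A 1 1 *\<^sub>R y l)"
      by (intro hf_cong c)
    also have "\<dots> = (F.coef A 0 0 * F.coef A 1 1 - F.coef A 0 1 * F.coef A 1 0) *\<^sub>R k"
      by (simp add: hf_add_left hf_add_right hf_scaleR_left hf_scaleR_right xx yx k_def[symmetric] scaleR_diff_left mult.commute)
    finally have "(F.coef A 0 0 * F.coef A 1 1 - F.coef A 0 1 * F.coef A 1 0) *\<^sub>R k = 1 *\<^sub>R k" by simp
    then show ?thesis using k0 by (metis scaleR_right_imp_eq)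
  qed
  with frame show ?thesis by blast
qed

end

section \<open>Real Lorentz representations\<close>

definition real_mat :: "nat \<Rightarrow> (nat \<Rightarrow> nat \<Rightarrow> real) \<Rightarrow> 'a::hyp_scalar mat" where
  "real_mat n R = Matrix.mat (Suc n) (Suc n) (\<lambda>(i,j). of_real (R i j))"

definition lorentz :: "nat \<Rightarrow> (nat \<Rightarrow> nat \<Rightarrow> real) \<Rightarrow> bool" where
  "lorentz n R \<longleftrightarrow> (\<forall>i\<le>n. \<forall>j\<le>n. (\<Sum>l\<le>n. sg n l * (R l i * R l j)) = (if i = j then sg n i else 0))"

lemma real_mat_carrier [simp]: "real_mat n R \<in> carrier_mat (Suc n) (Suc n)"
  by (simp add: real_mat_def)

lemma real_mat_index [simp]: "i \<le> n \<Longrightarrow> j \<le> n \<Longrightarrow> real_mat n R $$ (i,j) = of_real (R i j)"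
  by (simp add: real_mat_def)

lemma real_mat_mult:
  fixes n :: nat
  assumes "\<And>i j. i \<le> n \<Longrightarrow> j \<le> n \<Longrightarrow> T i j = (\<Sum>l\<le>n. R i l * S l j)"
  shows "(real_mat n R :: 'a::hyp_scalar mat) * real_mat n S = real_mat n T"
proof (rule eq_matI)
  fix i j assume "i < dim_row (real_mat n T :: 'a mat)" "j < dim_col (real_mat n T :: 'a mat)"
  then have ij: "i \<le> n" "j \<le> n" by (auto simp: real_mat_def)
  then show "((real_mat n R :: 'a mat) * real_mat n S) $$ (i,j) = real_mat n T $$ (i,j)"
    by (simp add: mult_mat_index[OF real_mat_carrier real_mat_carrier] assms)
qed (auto simp: real_mat_def)

lemma real_mat_U:
  assumes "lorentz n R"
  shows "(real_mat n R :: 'a::hyp_scalar mat) \<in> U_n1 n"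
proof -
  have "(\<Sum>l\<le>n. sg n l *\<^sub>R (cj ((real_mat n R :: 'a mat) $$ (l,i)) * real_mat n R $$ (l,j)))
      = (if i = j then of_real (sg n i) else 0)" if ij: "i \<le> n" "j \<le> n" for i j
  proof -
    have "(\<Sum>l\<le>n. sg n l *\<^sub>R (cj ((real_mat n R :: 'a mat) $$ (l,i)) * real_mat n R $$ (l,j)))
        = (\<Sum>l\<le>n. of_real (sg n l * (R l i * R l j)))"
      using ij by (intro sum.cong refl) (simp add: scaleR_conv_of_real)
    also have "\<dots> = of_real (\<Sum>l\<le>n. sg n l * (R l i * R l j))" by (rule of_real_sum[symmetric])
    also have "(\<Sum>l\<le>n. sg n l * (R l i * R l j)) = (if i = j then sg n i else 0)"
      using assms ij unfolding lorentz_def by blast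
    finally show ?thesis by simp
  qed
  then show ?thesis unfolding U_n1_iff by (intro conjI allI impI real_mat_carrier)
qed

context hyp_group
begin

lemma pow_in: "A \<in> G \<Longrightarrow> A ^\<^sub>m k \<in> G"
proof (induction k)
  case 0
  then show ?case using carrier_matD(1)[OF carr[OF 0]] by simp
qed simp

lemma pow_add: "A \<in> G \<Longrightarrow> A ^\<^sub>m (k + l) = A ^\<^sub>m k * A ^\<^sub>m l"
proof (induction l)
  case 0
  then show ?case using carrier_matD(1)[OF carr[OF 0]] pow_in[OF 0, of k] by simp
next
  case (Suc l)
  then show ?case using pow_in[of A] by (simp add: assoc)
qed

text \<open>The last clause is properness. It yields discreteness of the image and a finite kernel
  at once, so it need only be checked on matrix entries.\<close>

definition real_rep :: "('a mat \<Rightarrow> nat \<Rightarrow> nat \<Rightarrow> real) \<Rightarrow> bool" where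
  "real_rep R \<longleftrightarrow> (\<forall>A\<in>G. \<forall>B\<in>G. \<forall>i\<le>n. \<forall>j\<le>n. R (A * B) i j = (\<Sum>l\<le>n. R A i l * R B l j)) \<and>
     (\<forall>A\<in>G. lorentz n (R A)) \<and> (\<forall>K. finite {A \<in> G. \<forall>i\<le>n. \<forall>j\<le>n. \<bar>R A i j\<bar> \<le> K})"

lemma real_rep_hom:
  assumes "real_rep R" "A \<in> G" "B \<in> G"
  shows "(real_mat n (R (A * B)) :: 'a mat) = real_mat n (R A) * real_mat n (R B)"
  using assms by (intro real_mat_mult[symmetric]) (simp add: real_rep_def)

text \<open>All powers of a kernel element have the same image, so by properness they form a finite
  set; two powers agree and the element is torsion.\<close>

lemma real_rep_faithful:
  assumes R: "real_rep R" and tf: "torsion_free (Suc n) G"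
  shows "inj_on (\<lambda>A. real_mat n (R A) :: 'a mat) G"
proof (rule inj_onI)
  let ?\<tau> = "\<lambda>A. real_mat n (R A) :: 'a mat"
  fix A B assume A: "A \<in> G" and B: "B \<in> G" and eq: "?\<tau> A = ?\<tau> B"
  define C where "C = iv A * B"
  have C: "C \<in> G" using A B by (simp add: C_def)
  have tC: "?\<tau> C = ?\<tau> (1\<^sub>m (Suc n))"
  proof -
    have "?\<tau> C = ?\<tau> (iv A * A)" using A B eq by (simp only: C_def real_rep_hom[OF R] iv_in)
    then show ?thesis using A by (simp add: iv_left)
  qed
  have pow: "?\<tau> (C ^\<^sub>m k) = ?\<tau> (1\<^sub>m (Suc n))" for k
  proof (induction k)
    case 0
    then show ?case using carrier_matD(1)[OF carr[OF C]] by simp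
  next
    case (Suc k)
    have "?\<tau> (C ^\<^sub>m Suc k) = ?\<tau> (1\<^sub>m (Suc n)) * ?\<tau> (1\<^sub>m (Suc n))"
      using real_rep_hom[OF R pow_in[OF C] C] Suc tC by simp
    then show ?case using real_rep_hom[OF R one_in one_in] by simp
  qed
  define K where "K = (\<Sum>i\<le>n. \<Sum>j\<le>n. \<bar>R (1\<^sub>m (Suc n)) i j\<bar>)"
  have "\<bar>R (C ^\<^sub>m k) i j\<bar> \<le> K" if ij: "i \<le> n" "j \<le> n" for k i j
  proof -
    have "?\<tau> (C ^\<^sub>m k) $$ (i,j) = ?\<tau> (1\<^sub>m (Suc n)) $$ (i,j)" by (simp only: pow)
    then have "R (C ^\<^sub>m k) i j = R (1\<^sub>m (Suc n)) i j" using ij by simp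
    moreover have "\<bar>R (1\<^sub>m (Suc n)) i j\<bar> \<le> (\<Sum>j\<le>n. \<bar>R (1\<^sub>m (Suc n)) i j\<bar>)"
      using ij by (intro member_le_sum) auto
    moreover have "\<dots> \<le> K" unfolding K_def using ij by (intro member_le_sum[of i]) (auto intro: sum_nonneg)
    ultimately show ?thesis by linarith
  qed
  then have "range (\<lambda>k. C ^\<^sub>m k) \<subseteq> {A \<in> G. \<forall>i\<le>n. \<forall>j\<le>n. \<bar>R A i j\<bar> \<le> K}" using pow_in[OF C] by auto
  then have "finite (range (\<lambda>k. C ^\<^sub>m k))" using R unfolding real_rep_def by (blast intro: finite_subset)
  from finite_range_constant_subseq[OF this] obtain k0 and r :: "nat \<Rightarrow> nat" where r: "strict_mono r"
    and "\<forall>k. C ^\<^sub>m r k = C ^\<^sub>m k0" by blast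
  then have e: "C ^\<^sub>m r 0 = C ^\<^sub>m r 1" by simp
  have lt: "r 0 < r 1" using r by (simp add: strict_mono_def)
  have "C ^\<^sub>m r 1 = C ^\<^sub>m r 0 * C ^\<^sub>m (r 1 - r 0)" using pow_add[OF C, of "r 0" "r 1 - r 0"] lt by simp
  then have "C ^\<^sub>m r 0 * C ^\<^sub>m (r 1 - r 0) = C ^\<^sub>m r 0 * 1\<^sub>m (Suc n)"
    using e pow_in[OF C] by simp
  then have "C ^\<^sub>m (r 1 - r 0) = 1\<^sub>m (Suc n)" by (rule left_cancel[OF pow_in[OF C] pow_in[OF C] one_in])
  moreover have "r 1 - r 0 > 0" using lt by simp
  ultimately have "C = 1\<^sub>m (Suc n)" using tf C unfolding torsion_free_def by blast
  then have "A * C = A" using A by simp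
  then show "A = B" using A B by (simp add: C_def)
qed

text \<open>Only finitely many group elements have images within distance 1 of a given image, so a
  smallest positive gap exists.\<close>

lemma real_rep_discrete:
  assumes R: "real_rep R"
  shows "discrete_mats ((\<lambda>A. real_mat n (R A) :: 'a mat) ` G)"
  unfolding discrete_mats_def
proof (intro ballI)
  let ?\<tau> = "\<lambda>A. real_mat n (R A) :: 'a mat"
  fix X assume "X \<in> ?\<tau> ` G"
  then obtain A where A: "A \<in> G" "X = ?\<tau> A" by blast
  define K where "K = (\<Sum>i\<le>n. \<Sum>j\<le>n. \<bar>R A i j\<bar>)"
  have le: "\<bar>R A i j\<bar> \<le> K" if ij: "i \<le> n" "j \<le> n" for i j
  proof -
    have "\<bar>R A i j\<bar> \<le> (\<Sum>j\<le>n. \<bar>R A i j\<bar>)" using ij by (intro member_le_sum) auto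
    moreover have "\<dots> \<le> K" unfolding K_def using ij by (intro member_le_sum[of i]) (auto intro: sum_nonneg)
    ultimately show ?thesis by linarith
  qed
  define T where "T = {B \<in> G. \<forall>i\<le>n. \<forall>j\<le>n. \<bar>R B i j\<bar> \<le> K + 1}"
  have T: "finite T" using R by (simp add: T_def real_rep_def)
  define P where "P = (\<lambda>(B,i,j). \<bar>R A i j - R B i j\<bar>) ` (T \<times> {..n} \<times> {..n}) - {0}"
  have P: "finite P" using T by (simp add: P_def)
  \<comment> \<open>The 1 serves the elements outside \<open>T\<close>, which differ from
    \<open>A\<close> by more than 1 in some entry.\<close>
  define e where "e = Min (insert 1 P)"
  have e: "e > 0" "e \<le> 1" "\<And>x. x \<in> P \<Longrightarrow> e \<le> x" using P by (auto simp: e_def P_def)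
  have "\<exists>i\<le>n. \<exists>j\<le>n. e \<le> \<bar>R A i j - R B i j\<bar>" if B: "B \<in> G" "?\<tau> B \<noteq> ?\<tau> A" for B
  proof (cases "B \<in> T")
    case True
    have "\<exists>i\<le>n. \<exists>j\<le>n. R A i j \<noteq> R B i j"
    proof (rule ccontr)
      assume "\<not> ?thesis"
      then have "?\<tau> B = ?\<tau> A" by (intro eq_matI) (auto simp: real_mat_def)
      with B show False by simp
    qed
    then obtain i j where ij: "i \<le> n" "j \<le> n" "R A i j \<noteq> R B i j" by blast
    then have "\<bar>R A i j - R B i j\<bar> \<in> P" using True by (force simp: P_def)
    with e(3) ij show ?thesis by blast
  next
    case False
    then obtain i j where ij: "i \<le> n" "j \<le> n" "\<bar>R B i j\<bar> > K + 1" using B by (auto simp: T_def not_le)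
    then have "1 \<le> \<bar>R A i j - R B i j\<bar>" using le[OF ij(1,2)] by linarith
    with e(2) ij show ?thesis by (meson order_trans)
  qed
  then have "\<exists>i<dim_row X. \<exists>j<dim_col X. e \<le> eabs (X $$ (i,j) - Y $$ (i,j))" if "Y \<in> ?\<tau> ` G" "Y \<noteq> X" for Y
  proof -
    from that obtain B where B: "B \<in> G" "Y = ?\<tau> B" by blast
    with that A have "?\<tau> B \<noteq> ?\<tau> A" by simp
    then obtain i j where ij: "i \<le> n" "j \<le> n" "e \<le> \<bar>R A i j - R B i j\<bar>"
      using \<open>\<And>B. B \<in> G \<Longrightarrow> ?\<tau> B \<noteq> ?\<tau> A \<Longrightarrow> _\<close> B(1) by blast
    have "eabs (X $$ (i,j) - Y $$ (i,j)) = \<bar>R A i j - R B i j\<bar>"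
      using ij A B by (simp add: eabs_norm of_real_diff[symmetric] del: of_real_diff)
    moreover have "dim_row X = Suc n" "dim_col X = Suc n" using A by (simp_all add: real_mat_def)
    ultimately show ?thesis using ij by (metis less_Suc_eq_le)
  qed
  with e(1) show "\<exists>e>0. \<forall>B\<in>?\<tau> ` G. B \<noteq> X \<longrightarrow> (\<exists>i<dim_row X. \<exists>j<dim_col X. e \<le> eabs (X $$ (i,j) - B $$ (i,j)))"
    by blast
qed

end

text \<open>Extends a matrix on the Lorentz subspace by the identity on its complement, except for a
  number \<open>c\<close> in the first free slot \<open>m\<close>, meant for correcting the sign of
  the determinant.\<close>

definition frame_ext :: "nat \<Rightarrow> nat \<Rightarrow> real \<Rightarrow> (nat \<Rightarrow> nat \<Rightarrow> real) \<Rightarrow> nat \<Rightarrow> nat \<Rightarrow> real" where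
  "frame_ext n m c r i j = (if (i < m \<or> i = n) \<and> (j < m \<or> j = n) then r i j
     else if i = j then (if i = m then c else 1) else 0)"

lemma sum_frame_index:
  fixes m n :: nat
  assumes "m \<le> n" "\<And>l. l \<le> n \<Longrightarrow> \<not> (l < m \<or> l = n) \<Longrightarrow> f l = 0"
  shows "sum f {..n} = sum f ({..<m} \<union> {n})"
  using assms by (intro sum.mono_neutral_right) auto

lemma sum_single_index:
  fixes i n :: nat
  assumes "i \<le> n" "\<And>l. l \<le> n \<Longrightarrow> l \<noteq> i \<Longrightarrow> f l = 0"
  shows "sum f {..n} = f i"
proof -
  have "sum f {..n} = sum f {i}" using assms by (intro sum.mono_neutral_right) auto
  then show ?thesis by simp
qed

lemma frame_ext_mult:
  assumes m: "m \<le> n" and ij: "i \<le> n" "j \<le> n"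
    and t: "\<And>i j. i \<in> {..<m} \<union> {n} \<Longrightarrow> j \<in> {..<m} \<union> {n} \<Longrightarrow> t i j = (\<Sum>l\<in>{..<m} \<union> {n}. r i l * s l j)"
  shows "frame_ext n m (c * d) t i j = (\<Sum>l\<le>n. frame_ext n m c r i l * frame_ext n m d s l j)"
proof (cases "i < m \<or> i = n")
  case i: True
  have "(\<Sum>l\<le>n. frame_ext n m c r i l * frame_ext n m d s l j)
      = (\<Sum>l\<in>{..<m} \<union> {n}. frame_ext n m c r i l * frame_ext n m d s l j)"
    using i by (intro sum_frame_index[OF m]) (auto simp: frame_ext_def)
  also have "\<dots> = (\<Sum>l\<in>{..<m} \<union> {n}. if j < m \<or> j = n then r i l * s l j else 0)"
    using i by (intro sum.cong) (auto simp: frame_ext_def)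
  also have "\<dots> = frame_ext n m (c * d) t i j" using i t[of i j] by (auto simp: frame_ext_def)
  finally show ?thesis by simp
next
  case i: False
  have "(\<Sum>l\<le>n. frame_ext n m c r i l * frame_ext n m d s l j) = frame_ext n m c r i i * frame_ext n m d s i j"
    using i ij by (intro sum_single_index) (auto simp: frame_ext_def)
  with i show ?thesis by (auto simp: frame_ext_def)
qed

lemma frame_ext_lorentz:
  assumes m: "m \<le> n" and c: "c * c = 1"
    and r: "\<And>i j. i \<in> {..<m} \<union> {n} \<Longrightarrow> j \<in> {..<m} \<union> {n} \<Longrightarrow> (\<Sum>l\<in>{..<m} \<union> {n}. sg n l * (r l i * r l j)) = (if i = j then sg n i else 0)"
  shows "lorentz n (frame_ext n m c r)"
  unfolding lorentz_def
proof (intro allI impI)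
  fix i j assume ij: "i \<le> n" "j \<le> n"
  show "(\<Sum>l\<le>n. sg n l * (frame_ext n m c r l i * frame_ext n m c r l j)) = (if i = j then sg n i else 0)"
  proof (cases "i < m \<or> i = n")
    case i: True
    have "(\<Sum>l\<le>n. sg n l * (frame_ext n m c r l i * frame_ext n m c r l j))
        = (\<Sum>l\<in>{..<m} \<union> {n}. sg n l * (frame_ext n m c r l i * frame_ext n m c r l j))"
      using i by (intro sum_frame_index[OF m]) (auto simp: frame_ext_def)
    also have "\<dots> = (\<Sum>l\<in>{..<m} \<union> {n}. if j < m \<or> j = n then sg n l * (r l i * r l j) else 0)"
      using i by (intro sum.cong) (auto simp: frame_ext_def)
    also have "\<dots> = (if i = j then sg n i else 0)"
      using i r[of i j] by (cases "j < m \<or> j = n") auto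
    finally show ?thesis .
  next
    case i: False
    have "(\<Sum>l\<le>n. sg n l * (frame_ext n m c r l i * frame_ext n m c r l j))
        = sg n i * (frame_ext n m c r i i * frame_ext n m c r i j)"
      using i ij by (intro sum_single_index) (auto simp: frame_ext_def)
    with i c show ?thesis by (auto simp: frame_ext_def)
  qed
qed

text \<open>The character \<open>ch\<close> with values 1 and -1 is left open, so that the
  determinant can be adjusted afterwards.\<close>

lemma (in real_frame) frame_real_rep:
  assumes I: "I = {..<m} \<union> {n}" and m: "m \<le> n"
    and ee: "\<And>i j. i \<in> I \<Longrightarrow> j \<in> I \<Longrightarrow> hf n (e i) (e j) = (if i = j then of_real (sg n i) else 0)"
    and ch: "\<And>A. A \<in> G \<Longrightarrow> ch A * ch A = 1" "\<And>A B. A \<in> G \<Longrightarrow> B \<in> G \<Longrightarrow> ch (A * B) = ch A * ch B"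
  shows "real_rep (\<lambda>A. frame_ext n m (ch A) (coef A))"
  unfolding real_rep_def
proof (intro conjI ballI allI impI)
  fix A B i j assume AB: "A \<in> G" "B \<in> G" and ij: "i \<le> n" "j \<le> n"
  show "frame_ext n m (ch (A * B)) (coef (A * B)) i j
      = (\<Sum>l\<le>n. frame_ext n m (ch A) (coef A) i l * frame_ext n m (ch B) (coef B) l j)"
    unfolding ch(2)[OF AB] by (rule frame_ext_mult[OF m ij]) (use coef_mult[OF AB] in \<open>simp add: I\<close>)
next
  fix A assume A: "A \<in> G"
  show "lorentz n (frame_ext n m (ch A) (coef A))"
  proof (rule frame_ext_lorentz[OF m ch(1)[OF A]])
    fix i j assume "i \<in> {..<m} \<union> {n}" "j \<in> {..<m} \<union> {n}"
    then have ij: "i \<in> I" "j \<in> I" by (simp_all add: I)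
    have "hf n (e i) (e j) = hf n (app n A (e i)) (app n A (e j))" using A by simp
    also have "\<dots> = hf n (\<lambda>l. \<Sum>k\<in>I. coef A k i *\<^sub>R e k l) (\<lambda>l. \<Sum>k\<in>I. coef A k j *\<^sub>R e k l)"
      unfolding coef_def by (intro hf_cong expand inv e ij A)
    also have "\<dots> = (\<Sum>k\<in>I. \<Sum>l\<in>I. coef A k i *\<^sub>R coef A l j *\<^sub>R hf n (e k) (e l))"
      by (simp only: hf_sum_left hf_sum_right hf_scaleR_left hf_scaleR_right scaleR_sum_right)
    also have "\<dots> = (\<Sum>k\<in>I. \<Sum>l\<in>{k}. coef A k i *\<^sub>R coef A l j *\<^sub>R hf n (e k) (e l))"
      using fin by (intro sum.cong refl sum.mono_neutral_right) (auto simp: ee)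
    also have "\<dots> = of_real (\<Sum>k\<in>I. sg n k * (coef A k i * coef A k j))"
      unfolding of_real_sum by (intro sum.cong refl) (simp add: ee of_real_def mult_ac)
    finally have "(of_real (if i = j then sg n i else 0) :: 'a) = of_real (\<Sum>k\<in>I. sg n k * (coef A k i * coef A k j))"
      using ee[OF ij] by (simp split: if_splits)
    then show "(\<Sum>l\<in>{..<m} \<union> {n}. sg n l * (coef A l i * coef A l j)) = (if i = j then sg n i else 0)"
      unfolding I[symmetric] of_real_eq_iff by simp
  qed
next
  fix K
  show "finite {A \<in> G. \<forall>i\<le>n. \<forall>j\<le>n. \<bar>frame_ext n m (ch A) (coef A) i j\<bar> \<le> K}"
  proof (rule finite_subset[OF _ coef_proper[of K]], intro subsetI CollectI conjI ballI)
    fix A i j assume A: "A \<in> {A \<in> G. \<forall>i\<le>n. \<forall>j\<le>n. \<bar>frame_ext n m (ch A) (coef A) i j\<bar> \<le> K}" and ij: "i \<in> I" "j \<in> I"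
    then have "\<bar>frame_ext n m (ch A) (coef A) i j\<bar> \<le> K" using m by (auto simp: I)
    then show "\<bar>coef A i j\<bar> \<le> K" using ij by (auto simp: frame_ext_def I)
  qed auto
qed

text \<open>The action \<open>X \<mapsto> g X g\<^sup>T\<close> on symmetric \<open>2\<times>2\<close> matrices \<open>X = (t + u, y; y, t - u)\<close> preserves
  \<open>- det X = y\<^sup>2 + u\<^sup>2 - t\<^sup>2\<close>; the coordinates \<open>y, u, t\<close> carry the indices \<open>0, 1, n\<close>.\<close>

definition sym_square :: "nat \<Rightarrow> real \<Rightarrow> real \<Rightarrow> real \<Rightarrow> real \<Rightarrow> nat \<Rightarrow> nat \<Rightarrow> real" where
  "sym_square n a b c d i j =
    (if i = 0 then (if j = 0 then a*d + b*c else if j = 1 then a*c - b*d else if j = n then a*c + b*d else 0)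
     else if i = 1 then (if j = 0 then a*b - c*d else if j = 1 then (a*a - b*b - c*c + d*d) / 2
       else if j = n then (a*a + b*b - c*c - d*d) / 2 else 0)
     else if i = n then (if j = 0 then a*b + c*d else if j = 1 then (a*a - b*b + c*c - d*d) / 2
       else if j = n then (a*a + b*b + c*c + d*d) / 2 else 0)
     else if i = j then 1 else 0)"

lemma sum_three_index:
  fixes n :: nat
  assumes "2 \<le> n" "\<And>l. l \<le> n \<Longrightarrow> l \<noteq> 0 \<Longrightarrow> l \<noteq> 1 \<Longrightarrow> l \<noteq> n \<Longrightarrow> f l = 0"
  shows "sum f {..n} = f 0 + f 1 + (f n :: real)"
proof -
  have "sum f {..n} = sum f {0, 1, n}" using assms by (intro sum.mono_neutral_right) auto
  with assms(1) show ?thesis by simp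
qed

lemma sym_square_mult:
  assumes n: "2 \<le> n" and ij: "i \<le> n" "j \<le> n"
  shows "sym_square n (a*a' + b*c') (a*b' + b*d') (c*a' + d*c') (c*b' + d*d') i j
    = (\<Sum>l\<le>n. sym_square n a b c d i l * sym_square n a' b' c' d' l j)"
proof (cases "i = 0 \<or> i = 1 \<or> i = n")
  case i: True
  have "(\<Sum>l\<le>n. sym_square n a b c d i l * sym_square n a' b' c' d' l j)
      = sym_square n a b c d i 0 * sym_square n a' b' c' d' 0 j + sym_square n a b c d i 1 * sym_square n a' b' c' d' 1 j
      + sym_square n a b c d i n * sym_square n a' b' c' d' n j"
    using i n by (intro sum_three_index) (auto simp: sym_square_def)
  moreover consider "j = 0" | "j = 1" | "j = n" | "j \<noteq> 0" "j \<noteq> 1" "j \<noteq> n" by blast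
  then have "sym_square n (a*a' + b*c') (a*b' + b*d') (c*a' + d*c') (c*b' + d*d') i j
      = sym_square n a b c d i 0 * sym_square n a' b' c' d' 0 j + sym_square n a b c d i 1 * sym_square n a' b' c' d' 1 j
      + sym_square n a b c d i n * sym_square n a' b' c' d' n j"
    using i n by cases (auto simp: sym_square_def field_simps)
  ultimately show ?thesis by simp
next
  case i: False
  have "(\<Sum>l\<le>n. sym_square n a b c d i l * sym_square n a' b' c' d' l j)
      = sym_square n a b c d i i * sym_square n a' b' c' d' i j"
    using i ij by (intro sum_single_index) (auto simp: sym_square_def)
  with i show ?thesis by (auto simp: sym_square_def)
qed

lemma sym_square_lorentz:
  assumes n: "2 \<le> n" and det: "a*d - b*c = 1"
  shows "lorentz n (sym_square n a b c d)"
  unfolding lorentz_def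
proof (intro allI impI)
  fix i j assume ij: "i \<le> n" "j \<le> n"
  have d2: "(a*d - b*c) * (a*d - b*c) = 1" by (simp add: det)
  show "(\<Sum>l\<le>n. sg n l * (sym_square n a b c d l i * sym_square n a b c d l j)) = (if i = j then sg n i else 0)"
  proof (cases "i = 0 \<or> i = 1 \<or> i = n")
    case i: True
    have "(\<Sum>l\<le>n. sg n l * (sym_square n a b c d l i * sym_square n a b c d l j))
        = sym_square n a b c d 0 i * sym_square n a b c d 0 j + sym_square n a b c d 1 i * sym_square n a b c d 1 j
        - sym_square n a b c d n i * sym_square n a b c d n j"
      using i n by (subst sum_three_index) (auto simp: sym_square_def sg_def)
    moreover consider "j = 0" | "j = 1" | "j = n" | "j \<noteq> 0" "j \<noteq> 1" "j \<noteq> n" by blast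
    then have "sym_square n a b c d 0 i * sym_square n a b c d 0 j + sym_square n a b c d 1 i * sym_square n a b c d 1 j
        - sym_square n a b c d n i * sym_square n a b c d n j = (if i = j then sg n i * ((a*d - b*c) * (a*d - b*c)) else 0)"
      using i n by cases (auto simp: sym_square_def sg_def field_simps)
    ultimately show ?thesis by (simp add: d2)
  next
    case i: False
    have "(\<Sum>l\<le>n. sg n l * (sym_square n a b c d l i * sym_square n a b c d l j))
        = sg n i * (sym_square n a b c d i i * sym_square n a b c d i j)"
      using i ij by (intro sum_single_index) (auto simp: sym_square_def)
    with i show ?thesis by (auto simp: sym_square_def)
  qed
qed

lemma (in real_frame) sym_square_real_rep:
  assumes I: "I = {0, 1}" and n: "2 \<le> n"
    and det: "\<And>A. A \<in> G \<Longrightarrow> coef A 0 0 * coef A 1 1 - coef A 0 1 * coef A 1 0 = 1"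
  shows "real_rep (\<lambda>A. sym_square n (coef A 0 0) (coef A 0 1) (coef A 1 0) (coef A 1 1))"
  unfolding real_rep_def
proof (intro conjI ballI allI impI)
  fix A B i j assume AB: "A \<in> G" "B \<in> G" and ij: "i \<le> n" "j \<le> n"
  have c: "coef (A * B) k l = coef A k 0 * coef B 0 l + coef A k 1 * coef B 1 l" if "l \<in> {0, 1}" for k l
    using coef_mult[OF AB, of l k] that by (simp add: I)
  show "sym_square n (coef (A * B) 0 0) (coef (A * B) 0 1) (coef (A * B) 1 0) (coef (A * B) 1 1) i j
    = (\<Sum>l\<le>n. sym_square n (coef A 0 0) (coef A 0 1) (coef A 1 0) (coef A 1 1) i l
       * sym_square n (coef B 0 0) (coef B 0 1) (coef B 1 0) (coef B 1 1) l j)"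
    unfolding sym_square_mult[OF n ij, symmetric] by (simp add: c)
next
  fix A assume "A \<in> G"
  then show "lorentz n (sym_square n (coef A 0 0) (coef A 0 1) (coef A 1 0) (coef A 1 1))"
    by (intro sym_square_lorentz[OF n] det)
next
  fix K
  show "finite {A \<in> G. \<forall>i\<le>n. \<forall>j\<le>n. \<bar>sym_square n (coef A 0 0) (coef A 0 1) (coef A 1 0) (coef A 1 1) i j\<bar> \<le> K}"
  proof (rule finite_subset[OF _ coef_proper[of "2 * K + 1"]], intro subsetI CollectI conjI ballI)
    fix A i j assume A: "A \<in> {A \<in> G. \<forall>i\<le>n. \<forall>j\<le>n. \<bar>sym_square n (coef A 0 0) (coef A 0 1) (coef A 1 0) (coef A 1 1) i j\<bar> \<le> K}"
      and ij: "i \<in> I" "j \<in> I"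
    have sq: "\<bar>x\<bar> \<le> x * x + 1" for x :: real
      using sum_squares_bound[of "\<bar>x\<bar>" 1] by (simp add: power2_eq_square)
    \<comment> \<open>The corner entry is half the sum of the squares of all four coefficients, so
      it alone bounds them. The kernel of the symmetric square, plus or minus 1, does not harm
      properness.\<close>
    have "\<bar>sym_square n (coef A 0 0) (coef A 0 1) (coef A 1 0) (coef A 1 1) n n\<bar> \<le> K" using A by blast
    then have "coef A 0 0 * coef A 0 0 + coef A 0 1 * coef A 0 1 + coef A 1 0 * coef A 1 0 + coef A 1 1 * coef A 1 1 \<le> 2 * K"
      using n by (simp add: sym_square_def)
    moreover have "0 \<le> coef A 0 0 * coef A 0 0" "0 \<le> coef A 0 1 * coef A 0 1" "0 \<le> coef A 1 0 * coef A 1 0" "0 \<le> coef A 1 1 * coef A 1 1"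
      by simp_all
    moreover note sq[of "coef A 0 0"] sq[of "coef A 0 1"] sq[of "coef A 1 0"] sq[of "coef A 1 1"]
    ultimately have "\<bar>coef A 0 0\<bar> \<le> 2 * K + 1" "\<bar>coef A 0 1\<bar> \<le> 2 * K + 1" "\<bar>coef A 1 0\<bar> \<le> 2 * K + 1" "\<bar>coef A 1 1\<bar> \<le> 2 * K + 1"
      by linarith+
    with ij show "\<bar>coef A i j\<bar> \<le> 2 * K + 1" by (auto simp: I)
  qed auto
qed

section \<open>The trace field theorem\<close>

hide_const (open) Determinants.det

lemma trace_field_subset_Reals: "trace_field S \<subseteq> \<real> \<longleftrightarrow> (\<forall>A\<in>S. mtrace A \<in> (\<real> :: 'a::real_normed_div_algebra set))"
proof
  have "mtrace ` S \<subseteq> trace_field S" by (auto simp: trace_field_def)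
  then show "trace_field S \<subseteq> \<real> \<Longrightarrow> \<forall>A\<in>S. mtrace A \<in> \<real>" by blast
  assume "\<forall>A\<in>S. mtrace A \<in> (\<real> :: 'a set)"
  then have "is_sub_division_ring (\<real> :: 'a set) \<and> mtrace ` S \<subseteq> \<real>"
    by (auto simp: is_sub_division_ring_def Reals_inverse)
  then show "trace_field S \<subseteq> \<real>" by (auto simp: trace_field_def)
qed

lemma discrete_faithful_repD:
  assumes "discrete_faithful_rep \<Gamma> S \<rho>"
  shows "A \<in> \<Gamma> \<Longrightarrow> \<rho> A \<in> S" and "A \<in> \<Gamma> \<Longrightarrow> B \<in> \<Gamma> \<Longrightarrow> \<rho> (A * B) = \<rho> A * \<rho> B"
    and "inj_on \<rho> \<Gamma>" and "discrete_mats (\<rho> ` \<Gamma>)"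
  using assms unfolding discrete_faithful_rep_def is_rep_def by blast+

lemma discrete_faithful_rep_mono: "discrete_faithful_rep \<Gamma> S \<rho> \<Longrightarrow> S \<subseteq> T \<Longrightarrow> discrete_faithful_rep \<Gamma> T \<rho>"
  unfolding discrete_faithful_rep_def is_rep_def by blast

lemma image_hyp_group:
  assumes "hyp_group n \<Gamma>" and U: "\<And>A. A \<in> \<Gamma> \<Longrightarrow> \<rho> A \<in> U_n1 n"
    and hom: "\<And>A B. A \<in> \<Gamma> \<Longrightarrow> B \<in> \<Gamma> \<Longrightarrow> \<rho> (A * B) = \<rho> A * \<rho> B"
    and disc: "discrete_mats (\<rho> ` \<Gamma>)"
  shows "\<rho> (1\<^sub>m (Suc n)) = 1\<^sub>m (Suc n)" and "hyp_group n (\<rho> ` \<Gamma>)"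
proof -
  interpret \<Gamma>: hyp_group n \<Gamma> by fact
  have "\<rho> (1\<^sub>m (Suc n)) * \<rho> (1\<^sub>m (Suc n)) = \<rho> (1\<^sub>m (Suc n))"
    using hom[OF \<Gamma>.one_in \<Gamma>.one_in] by simp
  then show one: "\<rho> (1\<^sub>m (Suc n)) = 1\<^sub>m (Suc n)" by (rule idempotent_unitary[OF U[OF \<Gamma>.one_in]])
  have inv: "\<exists>B\<in>\<rho> ` \<Gamma>. A * B = 1\<^sub>m (Suc n) \<and> B * A = 1\<^sub>m (Suc n)" if A: "A \<in> \<rho> ` \<Gamma>" for A
  proof -
    from A obtain X where X: "X \<in> \<Gamma>" "A = \<rho> X" by blast
    note h = hom[OF X(1) \<Gamma>.iv_in[OF X(1)]] hom[OF \<Gamma>.iv_in[OF X(1)] X(1)]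
    have "A * \<rho> (\<Gamma>.iv X) = 1\<^sub>m (Suc n)" "\<rho> (\<Gamma>.iv X) * A = 1\<^sub>m (Suc n)"
      unfolding X(2) h[symmetric] \<Gamma>.iv_right[OF X(1)] \<Gamma>.iv_left[OF X(1)] by (rule one)+
    with \<Gamma>.iv_in[OF X(1)] show ?thesis by blast
  qed
  have mult: "A * B \<in> \<rho> ` \<Gamma>" if "A \<in> \<rho> ` \<Gamma>" "B \<in> \<rho> ` \<Gamma>" for A B
  proof -
    from that obtain X Y where XY: "X \<in> \<Gamma>" "Y \<in> \<Gamma>" "A = \<rho> X" "B = \<rho> Y" by blast
    then have "A * B = \<rho> (X * Y)" by (simp add: hom)
    with XY show ?thesis by simp
  qed
  have one_mem: "1\<^sub>m (Suc n) \<in> \<rho> ` \<Gamma>" using one \<Gamma>.one_in by (metis imageI)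
  show "hyp_group n (\<rho> ` \<Gamma>)"
  proof
    show "is_mat_subgroup (Suc n) (\<rho> ` \<Gamma>) (U_n1 n)"
      unfolding is_mat_subgroup_def using U inv mult one_mem by blast
  qed (rule disc)
qed

lemma real_trace_image:
  fixes \<Gamma> :: "'a::hyp_scalar mat set"
  assumes \<Gamma>: "hyp_group n \<Gamma>" and tf: "torsion_free (Suc n) \<Gamma>" and ne: "nonelementary n \<Gamma>"
    and \<rho>: "discrete_faithful_rep \<Gamma> S \<rho>" and S: "S \<subseteq> U_n1 n" and tr: "trace_field (\<rho> ` \<Gamma>) \<subseteq> \<real>"
  shows "hyp_group n (\<rho> ` \<Gamma>)" and "torsion_free (Suc n) (\<rho> ` \<Gamma>)"
    and "\<exists>\<xi> \<sigma>. null_vec n \<xi> \<and> \<sigma> \<noteq> 0 \<and> (\<sigma> = 1 \<or> cj \<sigma> = - \<sigma>) \<and>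
      (\<forall>A\<in>\<rho> ` \<Gamma>. \<forall>B\<in>\<rho> ` \<Gamma>. \<exists>r. hf n (app n A \<xi>) (app n B \<xi>) = r *\<^sub>R \<sigma>) \<and> (\<exists>A\<in>\<rho> ` \<Gamma>. hf n \<xi> (app n A \<xi>) \<noteq> 0)"
proof -
  interpret \<Gamma>: hyp_group n \<Gamma> by fact
  have hom: "\<rho> (A * B) = \<rho> A * \<rho> B" if "A \<in> \<Gamma>" "B \<in> \<Gamma>" for A B
    by (rule discrete_faithful_repD(2)[OF \<rho> that])
  have U: "\<rho> A \<in> U_n1 n" if "A \<in> \<Gamma>" for A using discrete_faithful_repD(1)[OF \<rho> that] S by blast
  note inj = discrete_faithful_repD(3)[OF \<rho>] and disc = discrete_faithful_repD(4)[OF \<rho>]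
  note one = image_hyp_group(1)[OF \<Gamma> U hom disc]
  show hg: "hyp_group n (\<rho> ` \<Gamma>)" by (rule image_hyp_group(2)[OF \<Gamma> U hom disc])
  interpret \<Delta>: hyp_group n "\<rho> ` \<Gamma>" by (rule hg)
  have pow: "\<rho> (A ^\<^sub>m k) = \<rho> A ^\<^sub>m k" if A: "A \<in> \<Gamma>" for A k
  proof (induction k)
    case 0
    have "dim_row A = Suc n" "dim_row (\<rho> A) = Suc n"
      using carrier_matD(1)[OF \<Gamma>.carr[OF A]] carrier_matD(1)[OF \<Delta>.carr[OF imageI[OF A]]] by auto
    then show ?case using one by simp
  next
    case (Suc k)
    then show ?case using hom[OF \<Gamma>.pow_in[OF A] A] by simp
  qed
  show "torsion_free (Suc n) (\<rho> ` \<Gamma>)"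
    unfolding torsion_free_def
  proof (intro ballI allI impI, elim conjE)
    fix X k assume "X \<in> \<rho> ` \<Gamma>" and k: "0 < (k::nat)" and X: "X ^\<^sub>m k = 1\<^sub>m (Suc n)"
    then obtain A where A: "A \<in> \<Gamma>" "X = \<rho> A" by blast
    then have "\<rho> (A ^\<^sub>m k) = \<rho> (1\<^sub>m (Suc n))" using X pow[OF A(1)] one by simp
    then have "A ^\<^sub>m k = 1\<^sub>m (Suc n)" by (rule inj_onD[OF inj _ \<Gamma>.pow_in[OF A(1)] \<Gamma>.one_in])
    with tf k A(1) have "A = 1\<^sub>m (Suc n)" unfolding torsion_free_def by blast
    with A one show "X = 1\<^sub>m (Suc n)" by simp
  qed
  have three: "\<Gamma>.three_limits" by (rule \<Gamma>.nonelementary_three_limits[OF ne])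
  have into: "\<rho> A \<in> \<rho> ` \<Gamma>" if "A \<in> \<Gamma>" for A using that by simp
  show "\<exists>\<xi> \<sigma>. null_vec n \<xi> \<and> \<sigma> \<noteq> 0 \<and> (\<sigma> = 1 \<or> cj \<sigma> = - \<sigma>) \<and>
      (\<forall>A\<in>\<rho> ` \<Gamma>. \<forall>B\<in>\<rho> ` \<Gamma>. \<exists>r. hf n (app n A \<xi>) (app n B \<xi>) = r *\<^sub>R \<sigma>) \<and> (\<exists>A\<in>\<rho> ` \<Gamma>. hf n \<xi> (app n A \<xi>) \<noteq> 0)"
  proof (rule \<Delta>.real_trace_form)
    show "cj (mtrace A) = mtrace A" if "A \<in> \<rho> ` \<Gamma>" for A
      unfolding cj_fixed_iff using tr that unfolding trace_field_subset_Reals by blast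
    show "infinite (\<rho> ` \<Gamma>)" by (rule free_image_no_fixed_line(2)[OF \<Gamma> hg three hom one inj into])
    show "\<not> \<Delta>.fixes_line \<theta>" for \<theta> by (rule free_image_no_fixed_line(1)[OF \<Gamma> hg three hom one inj into])
  qed
qed

lemma real_rep_discrete_faithful:
  fixes \<Gamma> :: "'a::hyp_scalar mat set"
  assumes hg: "hyp_group n (\<rho> ` \<Gamma>)" and tf: "torsion_free (Suc n) (\<rho> ` \<Gamma>)"
    and \<rho>: "discrete_faithful_rep \<Gamma> S \<rho>" and R: "hyp_group.real_rep n (\<rho> ` \<Gamma>) R"
    and T: "\<And>A. A \<in> \<rho> ` \<Gamma> \<Longrightarrow> (real_mat n (R A) :: 'a mat) \<in> T"
  shows "discrete_faithful_rep \<Gamma> T (\<lambda>A. real_mat n (R (\<rho> A)))"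
proof -
  interpret \<Delta>: hyp_group n "\<rho> ` \<Gamma>" by (rule hg)
  have "inj_on (\<lambda>A. real_mat n (R (\<rho> A)) :: 'a mat) \<Gamma>"
    using comp_inj_on[OF discrete_faithful_repD(3)[OF \<rho>] \<Delta>.real_rep_faithful[OF R tf]] by (simp add: o_def)
  moreover have "(\<lambda>A. real_mat n (R (\<rho> A)) :: 'a mat) ` \<Gamma> = (\<lambda>A. real_mat n (R A)) ` (\<rho> ` \<Gamma>)"
    by (simp add: image_image)
  moreover have "real_mat n (R (\<rho> (A * B))) = (real_mat n (R (\<rho> A)) :: 'a mat) * real_mat n (R (\<rho> B))"
    if "A \<in> \<Gamma>" "B \<in> \<Gamma>" for A B
  proof -
    show ?thesis unfolding discrete_faithful_repD(2)[OF \<rho> that] by (rule \<Delta>.real_rep_hom[OF R imageI imageI]) (rule that)+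
  qed
  ultimately show ?thesis
    using \<Delta>.real_rep_discrete[OF R] T unfolding discrete_faithful_rep_def is_rep_def by simp
qed

lemma real_mat_Reals: "i < Suc n \<Longrightarrow> j < Suc n \<Longrightarrow> (real_mat n R :: 'a::hyp_scalar mat) $$ (i,j) \<in> range of_real"
  by (simp add: real_mat_def)

lemma real_rep_lorentz: "hyp_group n G \<Longrightarrow> hyp_group.real_rep n G R \<Longrightarrow> A \<in> G \<Longrightarrow> lorentz n (R A)"
  by (simp add: hyp_group.real_rep_def)

text \<open>In the Lorentzian case the frame itself is returned, not just a representation, because
  the determinant correction depends on the frame and its size.\<close>

lemma (in hyp_group) real_rep_exists:
  assumes n: "2 \<le> n" and ex: "\<exists>\<xi> \<sigma>. null_vec n \<xi> \<and> \<sigma> \<noteq> 0 \<and> (\<sigma> = 1 \<or> cj \<sigma> = - \<sigma>) \<and>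
      (\<forall>A\<in>G. \<forall>B\<in>G. \<exists>r. hf n (app n A \<xi>) (app n B \<xi>) = r *\<^sub>R \<sigma>) \<and> (\<exists>A\<in>G. hf n \<xi> (app n A \<xi>) \<noteq> 0)"
  shows "(\<exists>V m e D. m \<le> n \<and> real_frame n G V ({..<m} \<union> {n}) e D \<and>
      (\<forall>i\<in>{..<m} \<union> {n}. \<forall>j\<in>{..<m} \<union> {n}. hf n (e i) (e j) = (if i = j then of_real (sg n i) else 0))) \<or>
    (\<exists>a b c d. real_rep (\<lambda>A. sym_square n (a A) (b A) (c A) (d A)) \<and> (\<forall>A\<in>G. a A * d A - b A * c A = (1::real)))"
proof -
  from ex obtain \<xi> \<sigma> where \<xi>: "null_vec n \<xi>" and \<sigma>: "\<sigma> \<noteq> 0" "\<sigma> = 1 \<or> cj \<sigma> = - \<sigma>"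
    and form: "\<forall>A\<in>G. \<forall>B\<in>G. \<exists>r. hf n (app n A \<xi>) (app n B \<xi>) = r *\<^sub>R \<sigma>" and B: "\<exists>B\<in>G. hf n \<xi> (app n B \<xi>) \<noteq> 0" by blast
  obtain B where B: "B \<in> G" "hf n \<xi> (app n B \<xi>) \<noteq> 0" using B by blast
  have form': "\<exists>r. hf n (app n A \<xi>) (app n B \<xi>) = r *\<^sub>R \<sigma>" if "A \<in> G" "B \<in> G" for A B using form that by blast
  from \<sigma>(2) show ?thesis
  proof
    assume "\<sigma> = 1"
    have "\<exists>r. hf n (app n A \<xi>) (app n B \<xi>) = r *\<^sub>R 1" if "A \<in> G" "B \<in> G" for A B
      using form'[OF that] unfolding \<open>\<sigma> = 1\<close> .
    from real_frame_real[OF \<xi> this B] show ?thesis by blast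
  next
    assume im: "cj \<sigma> = - \<sigma>"
    obtain e D where fr: "real_frame n G (real_span \<xi>) {0, 1} e D" and
      det: "\<forall>A\<in>G. real_frame.coef n e D A 0 0 * real_frame.coef n e D A 1 1 - real_frame.coef n e D A 0 1 * real_frame.coef n e D A 1 0 = 1"
      using real_frame_imaginary[OF \<xi> \<sigma>(1) im form' B] by blast
    interpret F: real_frame n G "real_span \<xi>" "{0, 1}" e D by (rule fr)
    have "real_rep (\<lambda>A. sym_square n (F.coef A 0 0) (F.coef A 0 1) (F.coef A 1 0) (F.coef A 1 1))"
      by (rule F.sym_square_real_rep[OF refl n]) (use det in blast)
    with det show ?thesis
      by (intro disjI2 exI[of _ "\<lambda>A. F.coef A 0 0"] exI[of _ "\<lambda>A. F.coef A 0 1"]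
          exI[of _ "\<lambda>A. F.coef A 1 0"] exI[of _ "\<lambda>A. F.coef A 1 1"]) simp
  qed
qed

section \<open>Determinants of the real representations\<close>

lemma real_mat_delta: "real_mat n (\<lambda>i j. if i = j then 1 else 0) = (1\<^sub>m (Suc n) :: 'a::hyp_scalar mat)"
  by (rule eq_matI) (auto simp: real_mat_def)

lemma I_n1_real_mat: "I_n1 n = (real_mat n (\<lambda>i j. if i = j then sg n i else 0) :: 'a::hyp_scalar mat)"
  by (rule eq_matI) (auto simp: real_mat_def I_n1_def sg_def)

lemma det_I_n1: "det (I_n1 n :: complex mat) \<noteq> 0"
proof -
  have "(I_n1 n :: complex mat) * I_n1 n = real_mat n (\<lambda>i j. if i = j then 1 else 0)"
    unfolding I_n1_real_mat
  proof (rule real_mat_mult)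
    fix i j assume "i \<le> n" "j \<le> n"
    then show "(if i = j then 1 else 0) = (\<Sum>l\<le>n. (if i = l then sg n i else 0) * (if l = j then sg n l else 0))"
      by (subst sum_single_index[of i]) auto
  qed
  then have "det ((I_n1 n :: complex mat) * I_n1 n) = 1" by (simp add: real_mat_delta)
  moreover have "(I_n1 n :: complex mat) \<in> carrier_mat (Suc n) (Suc n)" by (simp add: I_n1_real_mat)
  ultimately have "det (I_n1 n :: complex mat) * det (I_n1 n :: complex mat) = 1" by (simp add: Determinant.det_mult)
  then show ?thesis by auto
qed

lemma det_U_n1:
  assumes "(A :: complex mat) \<in> U_n1 n"
  shows "det (conj_trans cj A) * det A = 1"
proof -
  have c: "A \<in> carrier_mat (Suc n) (Suc n)" "conj_trans cj A \<in> carrier_mat (Suc n) (Suc n)"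
    "(I_n1 n :: complex mat) \<in> carrier_mat (Suc n) (Suc n)"
    using assms by (auto simp: U_n1_def conj_trans_def I_n1_def)
  have "det (conj_trans cj A * I_n1 n * A) = det (I_n1 n :: complex mat)" using assms by (simp add: U_n1_def)
  then have "det (conj_trans cj A) * det (I_n1 n) * det A = det (I_n1 n :: complex mat)"
    using c by (simp add: Determinant.det_mult[of _ "Suc n"])
  with det_I_n1[of n] show ?thesis by (simp add: mult.assoc mult.left_commute[of _ "det (I_n1 n)"])
qed

lemma det_lorentz:
  assumes "lorentz n R"
  shows "det (real_mat n R :: complex mat) * det (real_mat n R :: complex mat) = 1"
proof -
  have "conj_trans cj (real_mat n R :: complex mat) = transpose_mat (real_mat n R)"
    by (rule eq_matI) (auto simp: conj_trans_def real_mat_def)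
  moreover have "det (transpose_mat (real_mat n R :: complex mat)) = det (real_mat n R :: complex mat)"
    by (rule Determinant.det_transpose[OF real_mat_carrier])
  ultimately show ?thesis using det_U_n1[OF real_mat_U[OF assms]] by metis
qed

text \<open>The determinant is a character of SL(2,R) with values 1 and -1. Unipotent matrices are
  squares, so it is 1 on them, and they generate SL(2,R).\<close>

lemma det_sym_square:
  assumes n: "2 \<le> n" and det: "a*d - b*c = (1::real)"
  shows "det (real_mat n (sym_square n a b c d) :: complex mat) = 1"
proof -
  define \<delta> where "\<delta> a b c d = det (real_mat n (sym_square n a b c d) :: complex mat)" for a b c d
  have mult: "\<delta> (a*a' + b*c') (a*b' + b*d') (c*a' + d*c') (c*b' + d*d') = \<delta> a b c d * \<delta> a' b' c' d'"
    for a b c d a' b' c' d'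
    unfolding \<delta>_def Determinant.det_mult[OF real_mat_carrier real_mat_carrier, symmetric]
    by (subst real_mat_mult[OF sym_square_mult[OF n]]) (assumption | rule refl)+
  have sq: "\<delta> a b c d * \<delta> a b c d = 1" if "a*d - b*c = 1" for a b c d
    unfolding \<delta>_def by (rule det_lorentz[OF sym_square_lorentz[OF n that]])
  have up: "\<delta> 1 t 0 1 = 1" for t
    using mult[of 1 1 "t/2" 0 "t/2" 1 0 1] sq[of 1 1 "t/2" 0] by simp
  have lo: "\<delta> 1 0 t 1 = 1" for t
    using mult[of 1 1 0 "t/2" 0 1 "t/2" 1] sq[of 1 1 0 "t/2"] by simp
  have nz: "\<delta> a b c d = 1" if c: "c \<noteq> 0" and det: "a*d - b*c = 1" for a b c d
  proof -
    \<comment> \<open>From the factorization of (a b; c d) as (1 p; 0 1) (1 0; c 1) (1 q; 0 1),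
      valid for nonzero \<open>c\<close>.\<close>
    define p q where "p = (a - 1) / c" and "q = (d - 1) / c"
    have "\<delta> a p c 1 = 1" using mult[of 1 1 p c 0 1 0 1] up[of p] lo[of c] c by (simp add: p_def)
    moreover have "a * q + p = b" using c det by (simp add: p_def q_def field_simps)
    moreover have "c * q + 1 = d" using c by (simp add: q_def)
    ultimately show ?thesis using mult[of a 1 p 0 q 1 c 1] up[of q] by simp
  qed
  show ?thesis unfolding \<delta>_def[symmetric]
  proof (cases "c = 0")
    case True
    then have "d \<noteq> 0" "a * d = 1" using det by auto
    \<comment> \<open>Multiplying by (1 0; 1 1) on the right makes the lower left entry
      \<open>d\<close>, which is nonzero; the factor is then removed with \<open>lo\<close>.\<close>
    then have "\<delta> (a + b) b d d = 1" by (intro nz) (simp_all add: algebra_simps)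
    then show "\<delta> a b c d = 1" using mult[of "a + b" 1 b "-1" 0 1 d d] lo[of "-1"] True by simp
  qed (use nz det in blast)
qed

text \<open>If a slot is free, row \<open>m\<close> has its single nonzero entry on the diagonal, so
  \<open>c\<close> just scales that row.\<close>

lemma det_frame_ext:
  assumes "m < n"
  shows "det (real_mat n (frame_ext n m c r) :: complex mat) = of_real c * det (real_mat n (frame_ext n m 1 r) :: complex mat)"
proof -
  have "(real_mat n (frame_ext n m c r) :: complex mat) = multrow m (of_real c) (real_mat n (frame_ext n m 1 r))"
    using assms by (intro eq_matI) (auto simp: mat_multrow_gen_def real_mat_def frame_ext_def)
  then show ?thesis using assms by (simp add: Determinant.det_multrow[of _ "Suc n"])
qed

text \<open>The symmetric square has determinant 1. For a frame with \<open>m < n\<close> the sign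
  of the determinant is a character that is put into the free slot; for \<open>m = n\<close> the
  frame is a basis of the whole complex space.\<close>

lemma special_lorentz_rep_exists:
  fixes G :: "complex mat set"
  assumes "hyp_group n G" and n: "2 \<le> n" and det: "\<And>A. A \<in> G \<Longrightarrow> det A = 1"
    and ex: "\<exists>\<xi> \<sigma>. null_vec n \<xi> \<and> \<sigma> \<noteq> 0 \<and> (\<sigma> = 1 \<or> cj \<sigma> = - \<sigma>) \<and>
      (\<forall>A\<in>G. \<forall>B\<in>G. \<exists>r. hf n (app n A \<xi>) (app n B \<xi>) = r *\<^sub>R \<sigma>) \<and> (\<exists>A\<in>G. hf n \<xi> (app n A \<xi>) \<noteq> 0)"
  shows "\<exists>R. hyp_group.real_rep n G R \<and> (\<forall>A\<in>G. det (real_mat n (R A) :: complex mat) = 1)"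
proof -
  interpret hyp_group n G by fact
  from real_rep_exists[OF n ex] show ?thesis
  proof (elim disjE exE conjE)
    fix a b c d
    assume "real_rep (\<lambda>A. sym_square n (a A) (b A) (c A) (d A))" "\<forall>A\<in>G. a A * d A - b A * c A = (1::real)"
    then show ?thesis using det_sym_square[OF n] by (intro exI[of _ "\<lambda>A. sym_square n (a A) (b A) (c A) (d A)"]) simp
  next
    fix V m e D
    assume m: "m \<le> n" and "real_frame n G V ({..<m} \<union> {n}) e D" and
      ee: "\<forall>i\<in>{..<m} \<union> {n}. \<forall>j\<in>{..<m} \<union> {n}. hf n (e i) (e j) = (if i = j then of_real (sg n i) else 0)"
    then interpret F: real_frame n G V "{..<m} \<union> {n}" e D by blast
    have ee': "hf n (e i) (e j) = (if i = j then of_real (sg n i) else 0)"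
      if "i \<in> {..<m} \<union> {n}" "j \<in> {..<m} \<union> {n}" for i j using ee that by blast
    define R where "R = (\<lambda>A. frame_ext n m 1 (F.coef A))"
    have R: "real_rep R" unfolding R_def by (rule F.frame_real_rep[OF refl m ee']) simp_all
    define det0 where "det0 A = det (real_mat n (R A) :: complex mat)" for A
    show ?thesis
    proof (cases "m < n")
      case True
      \<comment> \<open>The determinant is its own inverse, so multiplying by it once more makes it
        1.\<close>
      define ch where "ch A = Re (det0 A)" for A
      have "det0 A * det0 A = 1" if "A \<in> G" for A
        unfolding det0_def using R that by (intro det_lorentz) (simp add: real_rep_def)
      then have "det0 A = 1 \<or> det0 A = -1" if "A \<in> G" for A
        using that by (simp add: square_eq_1_iff)
      then have ch: "det0 A = of_real (ch A)" "ch A * ch A = 1" if "A \<in> G" for A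
        using that by (fastforce simp: ch_def)+
      have ch_mult: "ch (A * B) = ch A * ch B" if AB: "A \<in> G" "B \<in> G" for A B
      proof -
        have "det0 (A * B) = det0 A * det0 B"
          unfolding det0_def real_rep_hom[OF R AB] by (rule Determinant.det_mult[OF real_mat_carrier real_mat_carrier])
        then have "complex_of_real (ch (A * B)) = of_real (ch A * ch B)"
          unfolding of_real_mult ch(1)[OF AB(1), symmetric] ch(1)[OF AB(2), symmetric] ch(1)[OF mult_in[OF AB], symmetric] .
        then show ?thesis by (simp only: of_real_eq_iff)
      qed
      have "real_rep (\<lambda>A. frame_ext n m (ch A) (F.coef A))"
        by (rule F.frame_real_rep[OF refl m ee' ch(2) ch_mult])
      moreover have "det (real_mat n (frame_ext n m (ch A) (F.coef A)) :: complex mat) = 1" if "A \<in> G" for A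
      proof -
        have "det (real_mat n (frame_ext n m (ch A) (F.coef A)) :: complex mat) = of_real (ch A) * det0 A"
          unfolding det0_def R_def by (rule det_frame_ext[OF True])
        also have "\<dots> = of_real (ch A * ch A)" by (simp add: ch(1)[OF that])
        finally show ?thesis by (simp add: ch(2)[OF that])
      qed
      ultimately show ?thesis by blast
    next
      case False
      with m have mn: "m = n" by simp
      have I: "{..<m} \<union> {n} = {..n}" by (auto simp: mn)
      \<comment> \<open>The frame vectors as columns. \<open>E\<close> conjugates \<open>A\<close>
        to its real matrix, which therefore has the same determinant 1.\<close>
      define E where "E = Matrix.mat (Suc n) (Suc n) (\<lambda>(l,i). e i l)"
      have E: "E \<in> carrier_mat (Suc n) (Suc n)" by (simp add: E_def)
      have "(\<Sum>l\<le>n. sg n l *\<^sub>R (cj (E $$ (l,i)) * E $$ (l,j))) = hf n (e i) (e j)" if "i \<le> n" "j \<le> n" for i j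
        unfolding hf_def using that by (intro sum.cong refl) (simp add: E_def)
      then have "E \<in> U_n1 n" using E ee' unfolding U_n1_iff I by simp
      then have dE: "det E \<noteq> 0" using det_U_n1[of E n] by auto
      have fe: "frame_ext n m 1 r i j = r i j" if "i \<le> n" "j \<le> n" for r i j
        using that by (auto simp: frame_ext_def mn)
      have "det (real_mat n (R A) :: complex mat) = 1" if A: "A \<in> G" for A
      proof -
        have "A * E = E * real_mat n (R A)"
        proof (rule eq_matI)
          fix l j assume "l < dim_row (E * real_mat n (R A))" "j < dim_col (E * real_mat n (R A))"
          then have lj: "l \<le> n" "j \<le> n" by (auto simp: E_def real_mat_def)
          have jI: "j \<in> {..<m} \<union> {n}" using lj(2) unfolding I by simp
          have "(A * E) $$ (l,j) = app n A (e j) l"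
            using lj by (subst mult_mat_index[OF carr[OF A] E]) (auto simp: app_def E_def)
          also have "\<dots> = (\<Sum>i\<le>n. F.coef A i j *\<^sub>R e i l)"
            unfolding F.coef_def I[symmetric] by (rule F.expand[OF F.inv[OF A F.e[OF jI]] lj(1)])
          also have "\<dots> = (E * real_mat n (R A)) $$ (l,j)"
            using lj fe by (subst mult_mat_index[OF E real_mat_carrier])
              (auto simp: E_def R_def scaleR_conv_of_real mult.commute intro!: sum.cong)
          finally show "(A * E) $$ (l,j) = (E * real_mat n (R A)) $$ (l,j)" .
        qed (use carr[OF A] in \<open>auto simp: E_def real_mat_def\<close>)
        then have "det A * det E = det E * det (real_mat n (R A) :: complex mat)"
          using Determinant.det_mult[OF carr[OF A] E] Determinant.det_mult[OF E real_mat_carrier] by metis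
        with dE det[OF A] show ?thesis by simp
      qed
      with R show ?thesis by blast
    qed
  qed
qed

lemma lorentz_rep_exists:
  fixes G :: "'a::hyp_scalar mat set"
  assumes "hyp_group n G" and n: "2 \<le> n"
    and ex: "\<exists>\<xi> \<sigma>. null_vec n \<xi> \<and> \<sigma> \<noteq> 0 \<and> (\<sigma> = 1 \<or> cj \<sigma> = - \<sigma>) \<and>
      (\<forall>A\<in>G. \<forall>B\<in>G. \<exists>r. hf n (app n A \<xi>) (app n B \<xi>) = r *\<^sub>R \<sigma>) \<and> (\<exists>A\<in>G. hf n \<xi> (app n A \<xi>) \<noteq> 0)"
  shows "\<exists>R. hyp_group.real_rep n G R"
proof -
  interpret hyp_group n G by fact
  from real_rep_exists[OF n ex] show ?thesis
  proof (elim disjE exE conjE)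
    fix V m e D
    assume m: "m \<le> n" and "real_frame n G V ({..<m} \<union> {n}) e D" and
      ee: "\<forall>i\<in>{..<m} \<union> {n}. \<forall>j\<in>{..<m} \<union> {n}. hf n (e i) (e j) = (if i = j then of_real (sg n i) else 0)"
    then interpret F: real_frame n G V "{..<m} \<union> {n}" e D by blast
    have ee': "hf n (e i) (e j) = (if i = j then of_real (sg n i) else 0)"
      if "i \<in> {..<m} \<union> {n}" "j \<in> {..<m} \<union> {n}" for i j using ee that by blast
    have "real_rep (\<lambda>A. frame_ext n m 1 (F.coef A))" by (rule F.frame_real_rep[OF refl m ee']) simp_all
    then show ?thesis by blast
  qed blast
qed

lemma SU_n1_iff: "A \<in> SU_n1 n \<longleftrightarrow> A \<in> U_n1 n \<and> det A = 1"
  by (auto simp: SU_n1_def U_n1_def cj_complex)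

lemma Sp_n1_eq: "Sp_n1 n = U_n1 n"
  by (simp add: Sp_n1_def U_n1_def cj_quat)

lemma real_mtrace:
  assumes "A \<in> carrier_mat (Suc n) (Suc n)" "\<forall>i<Suc n. \<forall>j<Suc n. A $$ (i,j) \<in> range of_real"
  shows "mtrace A \<in> (\<real> :: 'a::hyp_scalar set)"
  using assms by (auto simp: mtrace_def Reals_def[symmetric] simp del: sum.lessThan_Suc intro!: sum_in_Reals)

theorem theorem1p3:
  fixes n :: nat
  assumes "n \<ge> 2"
  shows
   "(\<forall>\<Gamma> :: complex mat set.
       is_mat_subgroup (n+1) \<Gamma> (SU_n1 n) \<and> discrete_mats \<Gamma> \<and> torsion_free (n+1) \<Gamma> \<and>
       nonelementary n \<Gamma> \<longrightarrow>
       ((\<exists>\<rho>. discrete_faithful_rep \<Gamma> (SU_n1 n) \<rho> \<and> trace_field (\<rho> ` \<Gamma>) \<subseteq> range complex_of_real)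
        \<longleftrightarrow> (\<exists>\<rho>. discrete_faithful_rep \<Gamma> (SO_n1 n) \<rho>)))
    \<and>
    (\<forall>\<Gamma> :: quat mat set.
       is_mat_subgroup (n+1) \<Gamma> (Sp_n1 n) \<and> discrete_mats \<Gamma> \<and> torsion_free (n+1) \<Gamma> \<and>
       nonelementary n \<Gamma> \<longrightarrow>
       ((\<exists>\<rho>. discrete_faithful_rep \<Gamma> (Sp_n1 n) \<rho> \<and> trace_field (\<rho> ` \<Gamma>) \<subseteq> range real_quat)
        \<longleftrightarrow> (\<exists>\<rho>. discrete_faithful_rep \<Gamma> (O_n1 n) \<rho>)))"
proof (intro conjI allI impI; elim conjE)
  fix \<Gamma> :: "complex mat set"
  assume sub: "is_mat_subgroup (n+1) \<Gamma> (SU_n1 n)" and disc: "discrete_mats \<Gamma>" and tf: "torsion_free (n+1) \<Gamma>"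
    and ne: "nonelementary n \<Gamma>"
  have SU: "SU_n1 n \<subseteq> U_n1 n" by (auto simp: SU_n1_iff)
  have \<Gamma>: "hyp_group n \<Gamma>"
    using sub disc SU by unfold_locales (auto simp: is_mat_subgroup_def)
  show "(\<exists>\<rho>. discrete_faithful_rep \<Gamma> (SU_n1 n) \<rho> \<and> trace_field (\<rho> ` \<Gamma>) \<subseteq> range complex_of_real)
      \<longleftrightarrow> (\<exists>\<rho>. discrete_faithful_rep \<Gamma> (SO_n1 n) \<rho>)"
  proof (intro iffI; elim exE conjE)
    fix \<rho> assume \<rho>: "discrete_faithful_rep \<Gamma> (SU_n1 n) \<rho>" and tr: "trace_field (\<rho> ` \<Gamma>) \<subseteq> range complex_of_real"
    have "torsion_free (Suc n) \<Gamma>" "trace_field (\<rho> ` \<Gamma>) \<subseteq> \<real>" using tf tr by (simp_all add: Reals_def)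
    note im = real_trace_image[OF \<Gamma> this(1) ne \<rho> SU this(2)]
    have "det A = 1" if "A \<in> \<rho> ` \<Gamma>" for A
      using discrete_faithful_repD(1)[OF \<rho>] that by (auto simp: SU_n1_iff)
    then obtain R where R: "hyp_group.real_rep n (\<rho> ` \<Gamma>) R" "\<forall>A\<in>\<rho> ` \<Gamma>. det (real_mat n (R A) :: complex mat) = 1"
      using special_lorentz_rep_exists[OF im(1) assms _ im(3)] by blast
    have "(real_mat n (R A) :: complex mat) \<in> SO_n1 n" if "A \<in> \<rho> ` \<Gamma>" for A
      using real_mat_U[OF real_rep_lorentz[OF im(1) R(1) that]] bspec[OF R(2) that] real_mat_Reals[of _ n _ "R A"]
      by (simp add: SO_n1_def SU_n1_iff)
    from real_rep_discrete_faithful[OF im(1,2) \<rho> R(1) this] show "\<exists>\<rho>. discrete_faithful_rep \<Gamma> (SO_n1 n) \<rho>" by blast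
  next
    \<comment> \<open>The converse needs no geometry: real entries have real traces, and the reals
      form a division ring containing them.\<close>
    fix \<rho> assume \<rho>: "discrete_faithful_rep \<Gamma> (SO_n1 n) \<rho>"
    then have "discrete_faithful_rep \<Gamma> (SU_n1 n) \<rho>" by (rule discrete_faithful_rep_mono) (auto simp: SO_n1_def)
    moreover have "mtrace A \<in> \<real>" if "A \<in> \<rho> ` \<Gamma>" for A
    proof (rule real_mtrace)
      have A: "A \<in> SO_n1 n" using discrete_faithful_repD(1)[OF \<rho>] that by blast
      then show "A \<in> carrier_mat (Suc n) (Suc n)" by (simp add: SO_n1_def SU_n1_def)
      show "\<forall>i<Suc n. \<forall>j<Suc n. A $$ (i,j) \<in> range of_real" using A by (simp add: SO_n1_def)
    qed
    then have "trace_field (\<rho> ` \<Gamma>) \<subseteq> \<real>" unfolding trace_field_subset_Reals by blast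
    ultimately show "\<exists>\<rho>. discrete_faithful_rep \<Gamma> (SU_n1 n) \<rho> \<and> trace_field (\<rho> ` \<Gamma>) \<subseteq> range complex_of_real"
      unfolding Reals_def by blast
  qed
next
  fix \<Gamma> :: "quat mat set"
  assume sub: "is_mat_subgroup (n+1) \<Gamma> (Sp_n1 n)" and disc: "discrete_mats \<Gamma>" and tf: "torsion_free (n+1) \<Gamma>"
    and ne: "nonelementary n \<Gamma>"
  have \<Gamma>: "hyp_group n \<Gamma>"
    using sub disc by unfold_locales (auto simp: Sp_n1_eq)
  show "(\<exists>\<rho>. discrete_faithful_rep \<Gamma> (Sp_n1 n) \<rho> \<and> trace_field (\<rho> ` \<Gamma>) \<subseteq> range real_quat)
      \<longleftrightarrow> (\<exists>\<rho>. discrete_faithful_rep \<Gamma> (O_n1 n) \<rho>)"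
  proof (intro iffI; elim exE conjE)
    fix \<rho> assume \<rho>: "discrete_faithful_rep \<Gamma> (Sp_n1 n) \<rho>" and tr: "trace_field (\<rho> ` \<Gamma>) \<subseteq> range real_quat"
    have "torsion_free (Suc n) \<Gamma>" "Sp_n1 n \<subseteq> U_n1 n" "trace_field (\<rho> ` \<Gamma>) \<subseteq> \<real>"
      using tf tr by (simp_all add: Reals_def real_quat_of_real Sp_n1_eq)
    note im = real_trace_image[OF \<Gamma> this(1) ne \<rho> this(2,3)]
    obtain R where R: "hyp_group.real_rep n (\<rho> ` \<Gamma>) R"
      using lorentz_rep_exists[OF im(1) assms im(3)] by blast
    have "(real_mat n (R A) :: quat mat) \<in> O_n1 n" if "A \<in> \<rho> ` \<Gamma>" for A
      using real_mat_U[OF real_rep_lorentz[OF im(1) R that]] real_mat_Reals[of _ n _ "R A"]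
      by (simp add: O_n1_def Sp_n1_eq real_quat_of_real)
    from real_rep_discrete_faithful[OF im(1,2) \<rho> R this] show "\<exists>\<rho>. discrete_faithful_rep \<Gamma> (O_n1 n) \<rho>" by blast
  next
    fix \<rho> assume \<rho>: "discrete_faithful_rep \<Gamma> (O_n1 n) \<rho>"
    then have "discrete_faithful_rep \<Gamma> (Sp_n1 n) \<rho>" by (rule discrete_faithful_rep_mono) (auto simp: O_n1_def)
    moreover have "mtrace A \<in> \<real>" if "A \<in> \<rho> ` \<Gamma>" for A
    proof (rule real_mtrace)
      have A: "A \<in> O_n1 n" using discrete_faithful_repD(1)[OF \<rho>] that by blast
      then show "A \<in> carrier_mat (Suc n) (Suc n)" by (simp add: O_n1_def Sp_n1_def)
      show "\<forall>i<Suc n. \<forall>j<Suc n. A $$ (i,j) \<in> range of_real" using A by (simp add: O_n1_def real_quat_of_real)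
    qed
    then have "trace_field (\<rho> ` \<Gamma>) \<subseteq> \<real>" unfolding trace_field_subset_Reals by blast
    ultimately show "\<exists>\<rho>. discrete_faithful_rep \<Gamma> (Sp_n1 n) \<rho> \<and> trace_field (\<rho> ` \<Gamma>) \<subseteq> range real_quat"
      unfolding Reals_def real_quat_of_real by blast
  qed
qed

end
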